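(* There is an absolute constant $C$ (not depending on any of the parameters below) such that the following holds. For all integers $N\ge 1$ and $n\ge 1$, all real $p\in[1,\infty)$, all $q\in[1,\infty]$ and all scalars $a_1,\dots,a_n\in\mathbb{C}$, $$\mathbb{E}\Big\|\sum_{j=1}^n a_j\,(U_j\otimes\bar U_j)(1-P)\Big\|_q^p\;\le\; C^p\;\mathbb{E}\Big\|\sum_{j=1}^n a_j\,Y_j\otimes\bar Y'_j\Big\|_q^p .$$ In fact the same holds with matrix coefficients: for all integers $N\ge 1$, $n\ge 1$ and $k\ge 1$, all real $p\in[1,\infty)$, all $q\in[1,\infty]$ and all $a_1,\dots,a_n\in M_k$, $$\mathbb{E}\Big\|\sum_{j=1}^n a_j\otimes\big[(U_j\otimes\bar U_j)(1-P)\big]\Big\|_q^p\;\le\; C^p\;\mathbb{E}\Big\|\sum_{j=1}^n a_j\otimes Y_j\otimes\bar Y'_j\Big\|_q^p .$$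
   Context: $M_N$ denotes the $N\times N$ complex matrices, and $S_2^N$ denotes $M_N$ equipped with the Hilbert–Schmidt norm (a Hilbert space of dimension $N^2$). For $x,y\in M_N$, the symbol $x\otimes\bar y$ denotes the linear operator on $S_2^N$ given by $\xi\mapsto x\,\xi\,y^*$; sums and scalar multiples are taken in $B(S_2^N)$. $P$ is the orthogonal projection of $S_2^N$ onto the line $\mathbb{C}I$ spanned by the identity matrix, so that $1-P$ is the orthogonal projection onto the orthogonal complement of the identity (the trace-zero matrices). For $a\in M_k$ and $T\in B(S_2^N)$, $a\otimes T$ is the usual tensor product operator on $\mathbb{C}^k\otimes S_2^N$. For each $N$: $(U_j)$ is a sequence of i.i.d. random $N\times N$ matrices uniformly distributed (Haar measure) over the unitary group $U(N)$. $(Y_j)$ is a sequence of i.i.d. random $N\times N$ matrices, each distributed like $Y$, where the entries $Y(i,l)$ are independent and $Y(i,l)=(2N)^{-1/2}(g_{il}+\sqrt{-1}\,g'_{il})$ with $g_{il},g'_{il}$ all independent real standard Gaussian $N(0,1)$ variables (so $\mathbb{E}|Y(i,l)|^2=1/N$). $(Y'_j)$ is an independent copy of $(Y_j)$. $\|x\|_q=(\mathrm{tr}(|x|^q))^{1/q}$ is the Schatten $q$-norm (with the unnormalized trace) for $1\le q<\infty$, and $\|x\|_\infty$ is the operator norm; it is applied here to operators on $S_2^N$ (respectively on $\mathbb{C}^k\otimes S_2^N$). *)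

theory Defs
  imports
    "HOL-Probability.Probability"
    "Jordan_Normal_Form.Schur_Decomposition"
begin

hide_const (open) Finite_Cartesian_Product.mat

definition mat_trace :: "complex mat \<Rightarrow> complex" where
  "mat_trace A = (\<Sum>i<dim_row A. A $$ (i, i))"

definition unitary_mats :: "nat \<Rightarrow> complex mat set" where
  "unitary_mats d =
     {V \<in> carrier_mat d d. V * mat_adjoint V = 1\<^sub>m d \<and> mat_adjoint V * V = 1\<^sub>m d}"

definition mat_sum :: "nat \<Rightarrow> ('i \<Rightarrow> complex mat) \<Rightarrow> 'i set \<Rightarrow> complex mat" where
  "mat_sum d A J = mat d d (\<lambda>rc. \<Sum>j\<in>J. A j $$ rc)"

text \<open>Tensor product of operators, in the product basis enumerated lexicographically.\<close>

definition kron :: "complex mat \<Rightarrow> complex mat \<Rightarrow> complex mat" where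
  "kron A B =
     mat (dim_row A * dim_row B) (dim_col A * dim_col B)
       (\<lambda>(r, c). A $$ (r div dim_row B, c div dim_col B) * B $$ (r mod dim_row B, c mod dim_col B))"

text \<open>
  Functional calculus for a Hermitian matrix, through a unitary diagonalisation.
  The result does not depend on the diagonalisation, see \<open>herm_fun_eqI\<close> below.
\<close>

definition herm_fun :: "(real \<Rightarrow> real) \<Rightarrow> complex mat \<Rightarrow> complex mat" where
  "herm_fun f A =
     (THE B. \<exists>V\<in>unitary_mats (dim_row A). \<exists>d :: nat \<Rightarrow> real.
        A = V * mat_diag (dim_row A) (\<lambda>i. complex_of_real (d i)) * mat_adjoint V \<and>
        B = V * mat_diag (dim_row A) (\<lambda>i. complex_of_real (f (d i))) * mat_adjoint V)"

lemma herm_fun_eqI: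
  assumes V: "V \<in> unitary_mats n"
    and A: "A = V * mat_diag n (\<lambda>i. complex_of_real (d i)) * mat_adjoint V"
  shows "herm_fun f A = V * mat_diag n (\<lambda>i. complex_of_real (f (d i))) * mat_adjoint V"
proof -
  have adj: "mat_adjoint X \<in> carrier_mat n n" if "X \<in> carrier_mat n n" for X :: "complex mat"
    using that by (auto simp: mat_adjoint_def)
  have Vc: "V \<in> carrier_mat n n" "mat_adjoint V \<in> carrier_mat n n"
    using V adj by (auto simp: unitary_mats_def)
  have n: "dim_row A = n"
    using Vc by (simp add: A)
  have uniq: "B = V * mat_diag n (\<lambda>i. complex_of_real (f (d i))) * mat_adjoint V"
    if W: "W \<in> unitary_mats n"
      and AW: "A = W * mat_diag n (\<lambda>i. complex_of_real (e i)) * mat_adjoint W"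
      and BW: "B = W * mat_diag n (\<lambda>i. complex_of_real (f (e i))) * mat_adjoint W"
    for B W e
  proof -
    define D where "D = (\<lambda>h::nat \<Rightarrow> real. mat_diag n (\<lambda>i. complex_of_real (h i)))"
    define X where "X = mat_adjoint W * V"
    have D: "D h \<in> carrier_mat n n" for h
      by (simp add: D_def)
    have Wc: "W \<in> carrier_mat n n" "mat_adjoint W \<in> carrier_mat n n"
      using W adj by (auto simp: unitary_mats_def)
    have X: "X \<in> carrier_mat n n"
      using Wc Vc by (simp add: X_def)
    have WX: "W * X = V"
      using W V Wc Vc by (simp add: X_def unitary_mats_def flip: assoc_mult_mat[of _ n n _ n _ n])
    have VX: "X * mat_adjoint V = mat_adjoint W"
      using W V Wc Vc by (simp add: X_def unitary_mats_def assoc_mult_mat[of _ n n _ n _ n] mult_carrier_mat[of _ n n _ n])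
    have 1: "mat_adjoint W * A * V = X * D d"
    proof -
      have "mat_adjoint W * A * V = X * D d * (mat_adjoint V * V)"
        using Wc Vc D by (simp add: A X_def D_def assoc_mult_mat[of _ n n _ n _ n] mult_carrier_mat[of _ n n _ n])
      then show ?thesis
        using V X D[of d] by (simp add: unitary_mats_def)
    qed
    have 2: "mat_adjoint W * A * V = D e * X"
    proof -
      have "mat_adjoint W * A * V = (mat_adjoint W * W) * (D e * X)"
        using Wc Vc D by (simp add: AW X_def D_def assoc_mult_mat[of _ n n _ n _ n] mult_carrier_mat[of _ n n _ n])
      then show ?thesis
        using W X D[of e] by (simp add: unitary_mats_def)
    qed
    have ent: "X $$ (i, j) * complex_of_real (d j) = complex_of_real (e i) * X $$ (i, j)"
      if "i < n" "j < n" for i j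
    proof -
      have "(X * D d) $$ (i, j) = (D e * X) $$ (i, j)"
        using 1 2 by simp
      then show ?thesis
        using that X by (simp add: D_def mat_diag_mult_left[of _ n n] mat_diag_mult_right[of _ n n])
    qed
    have comm: "X * D (\<lambda>i. f (d i)) = D (\<lambda>i. f (e i)) * X"
    proof (rule eq_matI)
      fix i j assume "i < dim_row (D (\<lambda>i. f (e i)) * X)" "j < dim_col (D (\<lambda>i. f (e i)) * X)"
      then have ij: "i < n" "j < n"
        using X D[of "\<lambda>i. f (e i)"] by auto
      have "X $$ (i, j) = 0 \<or> d j = e i"
        using ent[OF ij] by (auto simp: mult.commute)
      then show "(X * D (\<lambda>i. f (d i))) $$ (i, j) = (D (\<lambda>i. f (e i)) * X) $$ (i, j)"
        using ij X by (auto simp: D_def mat_diag_mult_left[of _ n n] mat_diag_mult_right[of _ n n])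
    qed (use X D[of "\<lambda>i. f (e i)"] D[of "\<lambda>i. f (d i)"] in auto)
    have "B = W * (D (\<lambda>i. f (e i)) * X) * mat_adjoint V"
      using Wc Vc D X by (simp add: BW D_def VX assoc_mult_mat[of _ n n _ n _ n] mult_carrier_mat[of _ n n _ n])
    also have "\<dots> = (W * X) * D (\<lambda>i. f (d i)) * mat_adjoint V"
      unfolding comm[symmetric] using Wc Vc D X by (simp add: assoc_mult_mat[of _ n n _ n _ n] mult_carrier_mat[of _ n n _ n])
    finally show ?thesis
      by (simp add: WX D_def)
  qed
  show ?thesis
    unfolding herm_fun_def n
    by (rule the_equality) (use V A uniq in blast)+
qed

definition mat_abs :: "complex mat \<Rightarrow> complex mat" where
  "mat_abs A = herm_fun sqrt (mat_adjoint A * A)"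

definition vec_l2norm :: "complex vec \<Rightarrow> real" where
  "vec_l2norm v = sqrt (Re (v \<bullet>c v))"

definition op_norm :: "complex mat \<Rightarrow> real" where
  "op_norm A = (SUP v \<in> {v \<in> carrier_vec (dim_col A). vec_l2norm v \<le> 1}. vec_l2norm (A *\<^sub>v v))"

definition schatten_norm :: "ennreal \<Rightarrow> complex mat \<Rightarrow> real" where
  "schatten_norm q A =
     (if q = \<infinity> then op_norm A
      else Re (mat_trace (herm_fun (\<lambda>t. t powr enn2real q) (mat_abs A))) powr (1 / enn2real q))"

text \<open>
  Inner product of the space of \<open>N \<times> N\<close> matrices with the Hilbert-Schmidt norm. Its matrix units
  form an orthonormal basis; the unit with entry 1 at position \<open>(i, l)\<close> gets number \<open>i * N + l\<close>.
  A linear operator \<open>T\<close> on that space is represented by its matrix \<open>hs_op N T\<close> in this basis.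
\<close>

definition hs_inner :: "complex mat \<Rightarrow> complex mat \<Rightarrow> complex" where
  "hs_inner \<xi> \<eta> = mat_trace (\<xi> * mat_adjoint \<eta>)"

definition mat_unit :: "nat \<Rightarrow> nat \<Rightarrow> complex mat" where
  "mat_unit N c = mat N N (\<lambda>il. if il = (c div N, c mod N) then 1 else 0)"

definition hs_op :: "nat \<Rightarrow> (complex mat \<Rightarrow> complex mat) \<Rightarrow> complex mat" where
  "hs_op N T = mat (N * N) (N * N) (\<lambda>(r, c). T (mat_unit N c) $$ (r div N, r mod N))"

text \<open>The operator \<open>x \<otimes> y\<^bsup>-\<^esup>\<close>, where the second leg carries the entrywise conjugate.\<close>

definition tensor_bar :: "nat \<Rightarrow> complex mat \<Rightarrow> complex mat \<Rightarrow> complex mat" where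
  "tensor_bar N x y = hs_op N (\<lambda>\<xi>. x * \<xi> * mat_adjoint y)"

text \<open>Orthogonal projection onto the line spanned by the identity matrix.\<close>

definition proj_id :: "nat \<Rightarrow> complex mat" where
  "proj_id N =
     hs_op N (\<lambda>\<xi>. (hs_inner \<xi> (1\<^sub>m N) / hs_inner (1\<^sub>m N) (1\<^sub>m N)) \<cdot>\<^sub>m 1\<^sub>m N)"

text \<open>The Borel sigma-algebra, obtained by identifying a matrix with the family of its entries.\<close>

definition mat_borel :: "nat \<Rightarrow> complex mat measure" where
  "mat_borel N =
     vimage_algebra (carrier_mat N N) (\<lambda>A. \<lambda>il\<in>{..<N} \<times> {..<N}. A $$ il)
       (\<Pi>\<^sub>M il\<in>{..<N} \<times> {..<N}. borel)"

lemma measurable_mat_borelI: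
  assumes "\<And>x. x \<in> space M \<Longrightarrow> F x \<in> carrier_mat N N"
    and "\<And>i l. i < N \<Longrightarrow> l < N \<Longrightarrow> (\<lambda>x. F x $$ (i, l)) \<in> borel_measurable M"
  shows "F \<in> measurable M (mat_borel N)"
  unfolding mat_borel_def
  using assms by (intro measurable_vimage_algebra2 measurable_restrict) auto

definition is_haar_unitary :: "nat \<Rightarrow> complex mat measure \<Rightarrow> bool" where
  "is_haar_unitary N \<mu> \<longleftrightarrow>
     prob_space \<mu> \<and>
     space \<mu> = unitary_mats N \<and>
     sets \<mu> = sets (restrict_space (mat_borel N) (unitary_mats N)) \<and>
     (\<forall>V\<in>unitary_mats N. distr \<mu> \<mu> (\<lambda>A. V * A) = \<mu>)"

text \<open>
  The law of \<open>Y\<close>. The component of \<open>g\<close> at \<open>(i, l)\<close> is the pair consisting of the two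
  real standard Gaussian variables in the entry \<open>Y(i, l)\<close>.
\<close>

definition gaussian_mat :: "nat \<Rightarrow> complex mat measure" where
  "gaussian_mat N =
     distr (\<Pi>\<^sub>M il\<in>{..<N} \<times> {..<N}. (std_normal_distribution \<Otimes>\<^sub>M std_normal_distribution))
       (mat_borel N)
       (\<lambda>g. mat N N (\<lambda>il. complex_of_real (1 / sqrt (2 * real N)) *
              (complex_of_real (fst (g il)) + \<i> * complex_of_real (snd (g il)))))"

lemma prob_space_gaussian_mat: "prob_space (gaussian_mat N)"
proof -
  interpret std: prob_space std_normal_distribution
    by (simp add: prob_space_normal_density)
  interpret pair_prob_space std_normal_distribution std_normal_distribution ..
  let ?P = "\<Pi>\<^sub>M il\<in>{..<N} \<times> {..<N}. (std_normal_distribution \<Otimes>\<^sub>M std_normal_distribution)"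
  have "prob_space ?P"
    by (intro prob_space_PiM) unfold_locales
  then show ?thesis
    unfolding gaussian_mat_def
    by (intro prob_space.prob_space_distr measurable_mat_borelI) auto
qed

text \<open>
  Joint laws of finite i.i.d. families: only the distribution of the random matrices enters the
  expectations, so the families are realised on the canonical product spaces.
\<close>

abbreviation iid :: "nat \<Rightarrow> complex mat measure \<Rightarrow> (nat \<Rightarrow> complex mat) measure" where
  "iid n \<mu> \<equiv> (\<Pi>\<^sub>M j\<in>{1..n}. \<mu>)"

end

(* Since Y has the polar form V H with H = |Y| and the Gaussian law is bi-unitarily invariant, Y_j may be
   replaced by A_j Y_j R_j with independent Haar unitaries A_j, R_j, and then by A_j (R_j^* H_j R_j).
   Averaging over R_j turns (X (x) conj X)(1 - P), X = R^* H R, into x (1 - P) with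
   x = ((tr |Y|)^2 - |Y|_2^2 / N) / (N^2 - 1), whose Gaussian mean is at least 1/3.  By Jensen's inequality the
   left-hand side is therefore at most 3^p times the moment of the sum of the a_j (x) (Y_j (x) conj Y_j)(1 - P).
   The mean of Y (x) conj Y is P, so Jensen's inequality replaces Y (x) conj Y there by
   Y (x) conj Y - Y' (x) conj Y', and the rotation (Y, Y') -> ((Y + Y')/sqrt 2, (Y' - Y)/sqrt 2) turns this
   into Y (x) conj Y' + Y' (x) conj Y.  This costs a factor 2^p, which gives C = 6.
   Triangle and Jensen inequalities for the Schatten norms, as well as their measurability, all follow from
   writing the norm as a supremum of real-linear functionals. *)
theory Submission
  imports Defs "HOL-Combinatorics.Permutations"
begin

section \<open>Unitary matrices and singular values\<close>

text \<open>The two unitaries \<open>A j\<close> and \<open>R j\<close> have different jobs.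
  Averaging over \<open>R j\<close> makes the tensor square of the conjugated matrix a scalar off
  the identity line. The factor \<open>A j\<close> survives this average and becomes the unitary of
  the left-hand side; before that, right invariance of Haar measure lets it absorb the polar unitary
  of \<open>Y j\<close> and the left half of the conjugation. This absorption takes place inside the
  integral, for one fixed value of Y, where the polar factors may be chosen without regard to
  measurability. The bound 1/3 has this origin: the means of |Y|_2^2 and of |Y|_4^4 are N and 2 N,
  which forces the mean of tr |Y| to be at least N / sqrt 2. The mean of x is then at least (N^2/2 -
  1) / (N^2 - 1), and this is smallest at N = 2. For N = 1 the projection 1 - P vanishes and the
  inequality is trivial. On the Gaussian side 1 - P is dropped only after P has been subtracted;
  dropping it costs nothing, as 1 - P is the mean of two unitaries.\<close>

lemma mat_adjoint_carrier [simp]: "A \<in> carrier_mat m n \<Longrightarrow> mat_adjoint A \<in> carrier_mat n m"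
  by (auto simp: mat_adjoint_def)

lemma dim_mat_adjoint [simp]:
  "dim_row (mat_adjoint A) = dim_col A" "dim_col (mat_adjoint A) = dim_row A"
  by (auto simp: mat_adjoint_def)

lemma index_mat_adjoint [simp]:
  fixes A :: "complex mat"
  assumes "i < dim_col A" "j < dim_row A"
  shows "mat_adjoint A $$ (i, j) = cnj (A $$ (j, i))"
  using assms by (simp add: mat_adjoint_def mat_of_rows_index)

lemma index_mult_mat_sum:
  assumes "A \<in> carrier_mat n m" "B \<in> carrier_mat m l" "i < n" "j < l"
  shows "(A * B) $$ (i, j) = (\<Sum>k<m. A $$ (i, k) * B $$ (k, j))"
  using assms by (auto simp: scalar_prod_def lessThan_atLeast0 intro!: sum.cong)

lemma mat_adjoint_mat_adjoint [simp]: "mat_adjoint (mat_adjoint (A :: complex mat)) = A"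
  by (rule eq_matI) auto

lemma mat_adjoint_mult:
  fixes A B :: "complex mat"
  assumes "A \<in> carrier_mat n m" "B \<in> carrier_mat m l"
  shows "mat_adjoint (A * B) = mat_adjoint B * mat_adjoint A"
proof (rule eq_matI)
  fix i j assume "i < dim_row (mat_adjoint B * mat_adjoint A)" "j < dim_col (mat_adjoint B * mat_adjoint A)"
  then have "i < l" "j < n" using assms by auto
  then show "mat_adjoint (A * B) $$ (i, j) = (mat_adjoint B * mat_adjoint A) $$ (i, j)"
    using assms by (simp add: index_mult_mat_sum[of _ n m _ l] index_mult_mat_sum[of _ l m _ n]
        mult.commute del: index_mult_mat(1))
qed (use assms in auto)

lemma index_adjoint_mult:
  fixes A B :: "complex mat"
  assumes "A \<in> carrier_mat m n" "B \<in> carrier_mat m l" "i < n" "j < l"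
  shows "(mat_adjoint A * B) $$ (i, j) = (\<Sum>k<m. cnj (A $$ (k, i)) * B $$ (k, j))"
  using assms by (subst index_mult_mat_sum[of _ n m _ l]) (auto intro!: sum.cong)

lemma unitary_matsD:
  assumes "V \<in> unitary_mats n"
  shows "V \<in> carrier_mat n n" "mat_adjoint V \<in> carrier_mat n n"
    "V * mat_adjoint V = 1\<^sub>m n" "mat_adjoint V * V = 1\<^sub>m n"
  using assms by (auto simp: unitary_mats_def)

text \<open>A left inverse of a square matrix is also a right inverse, so orthonormality of the
  columns is all that has to be checked.\<close>

lemma unitary_matsI:
  assumes "V \<in> carrier_mat n n"
    and "\<And>i j. i < n \<Longrightarrow> j < n \<Longrightarrow> (\<Sum>r<n. cnj (V $$ (r, i)) * V $$ (r, j)) = (if i = j then 1 else 0)"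
  shows "V \<in> unitary_mats n"
proof -
  have *: "mat_adjoint V * V = 1\<^sub>m n"
    by (rule eq_matI) (use assms in \<open>auto simp: index_adjoint_mult[of _ n n _ n] simp del: index_mult_mat(1)\<close>)
  moreover have "V * mat_adjoint V = 1\<^sub>m n"
    using mat_mult_left_right_inverse[OF _ _ *] assms by auto
  ultimately show ?thesis using assms by (simp add: unitary_mats_def)
qed

lemma unitary_mats_cols:
  assumes "V \<in> unitary_mats n" "i < n" "j < n"
  shows "(\<Sum>r<n. cnj (V $$ (r, i)) * V $$ (r, j)) = (if i = j then 1 else 0)"
  using unitary_matsD[OF assms(1)] assms(2,3) index_adjoint_mult[of V n n V n i j] by simp

lemma unitary_mats_rows:
  assumes "V \<in> unitary_mats n" "i < n" "j < n"
  shows "(\<Sum>r<n. V $$ (i, r) * cnj (V $$ (j, r))) = (if i = j then 1 else 0)"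
proof -
  have "(V * mat_adjoint V) $$ (i, j) = (\<Sum>r<n. V $$ (i, r) * cnj (V $$ (j, r)))"
    using unitary_matsD(1,2)[OF assms(1)] assms(2,3)
    by (subst index_mult_mat_sum[of _ n n _ n]) (auto intro!: sum.cong)
  then show ?thesis using unitary_matsD[OF assms(1)] assms by simp
qed

lemma unitary_mats_mult:
  assumes "V \<in> unitary_mats n" "W \<in> unitary_mats n"
  shows "V * W \<in> unitary_mats n"
proof -
  note V = unitary_matsD[OF assms(1)] and W = unitary_matsD[OF assms(2)]
  have adj: "mat_adjoint (V * W) = mat_adjoint W * mat_adjoint V"
    using V W by (simp add: mat_adjoint_mult[of _ n n _ n])
  have "V * W * (mat_adjoint W * mat_adjoint V) = V * (W * mat_adjoint W) * mat_adjoint V"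
    using V(1,2) W(1,2) by (simp add: assoc_mult_mat[of _ n n _ n _ n] mult_carrier_mat[of _ n n _ n])
  moreover have "mat_adjoint W * mat_adjoint V * (V * W) = mat_adjoint W * (mat_adjoint V * V) * W"
    using V(1,2) W(1,2) by (simp add: assoc_mult_mat[of _ n n _ n _ n] mult_carrier_mat[of _ n n _ n])
  ultimately show ?thesis
    using V W by (simp add: unitary_mats_def adj)
qed

lemma unitary_mats_adjoint: "V \<in> unitary_mats n \<Longrightarrow> mat_adjoint V \<in> unitary_mats n"
  by (auto simp: unitary_mats_def)

lemma mat_adjoint_one [simp]: "mat_adjoint (1\<^sub>m n :: complex mat) = 1\<^sub>m n"
  by (rule eq_matI) auto

lemma unitary_mats_one: "1\<^sub>m n \<in> unitary_mats n"
  by (simp add: unitary_mats_def)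

lemma sum_cnj_mult_self:
  "(\<Sum>r\<in>S. cnj (f r) * f r) = complex_of_real (\<Sum>r\<in>S. (cmod (f r))\<^sup>2)"
  unfolding of_real_sum by (intro sum.cong refl) (metis complex_norm_square mult.commute)

lemma unitary_mats_entry_le:
  assumes "V \<in> unitary_mats n" "i < n" "j < n"
  shows "cmod (V $$ (i, j)) \<le> 1"
proof -
  have "complex_of_real (\<Sum>r<n. (cmod (V $$ (r, j)))\<^sup>2) = 1"
    using unitary_mats_cols[OF assms(1,3,3)] unfolding sum_cnj_mult_self by simp
  then have "(\<Sum>r<n. (cmod (V $$ (r, j)))\<^sup>2) = 1"
    by (simp only: of_real_eq_1_iff)
  moreover have "(cmod (V $$ (i, j)))\<^sup>2 \<le> (\<Sum>r<n. (cmod (V $$ (r, j)))\<^sup>2)"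
    using assms by (intro member_le_sum) auto
  ultimately have "(cmod (V $$ (i, j)))\<^sup>2 \<le> 1\<^sup>2" by simp
  then show ?thesis by (rule power2_le_imp_le) simp
qed

text \<open>Induction on the number of missing columns. The matrix with the given columns and zeros
  elsewhere is singular, and so is its transpose; a kernel vector of the transpose, conjugated and
  normalised, is orthogonal to every given column and fills one more place. \<open>S\<close> is an
  arbitrary index set because the singular value decomposition prescribes the columns with nonzero
  singular value, wherever these stand.\<close>

lemma unitary_mats_extend:
  assumes "S \<subseteq> {..<n}"
    and "\<And>i j. i \<in> S \<Longrightarrow> j \<in> S \<Longrightarrow> (\<Sum>r<n. cnj (f r i) * f r j) = (if i = j then 1 else 0)"
  shows "\<exists>W\<in>unitary_mats n. \<forall>i\<in>S. \<forall>r<n. W $$ (r, i) = f r i"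
  using assms
proof (induction "n - card S" arbitrary: S f)
  case 0
  have "finite S" using "0.prems"(1) finite_subset by blast
  then have "S = {..<n}"
    using "0.hyps" "0.prems"(1) card_mono[of "{..<n}" S] by (intro card_subset_eq) auto
  define W where "W = mat n n (\<lambda>(r, i). f r i)"
  have "W \<in> unitary_mats n"
    using "0.prems"(2) \<open>S = {..<n}\<close> by (intro unitary_matsI) (simp_all add: W_def)
  moreover have "\<forall>i\<in>S. \<forall>r<n. W $$ (r, i) = f r i"
    using \<open>S = {..<n}\<close> by (simp add: W_def)
  ultimately show ?case by (rule bexI[of _ W, rotated])
next
  case (Suc m)
  have fin: "finite S" using Suc.prems(1) finite_subset by blast
  have "S \<noteq> {..<n}" using Suc.hyps(2) by auto
  then obtain z where z: "z < n" "z \<notin> S" using Suc.prems(1) by auto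
  define F where "F = mat n n (\<lambda>(r, i). if i \<in> S then f r i else 0)"
  have F: "F \<in> carrier_mat n n" by (simp add: F_def)
  have "F *\<^sub>v unit_vec n z = 0\<^sub>v n"
    using z by (intro eq_vecI) (auto simp: F_def)
  moreover have "unit_vec n z \<noteq> (0\<^sub>v n :: complex vec)"
    using z by simp
  ultimately have "Determinant.det F = 0"
    using det_0_iff_vec_prod_zero[OF F] by (metis unit_vec_carrier)
  then have "Determinant.det (transpose_mat F) = 0"
    using det_transpose[OF F] by simp
  then obtain w where w: "w \<in> carrier_vec n" "w \<noteq> 0\<^sub>v n" "transpose_mat F *\<^sub>v w = 0\<^sub>v n"
    using det_0_iff_vec_prod_zero[of "transpose_mat F" n] F by auto
  have orth: "(\<Sum>r<n. f r i * w $ r) = 0" if "i \<in> S" for i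
  proof -
    have "i < n" using that Suc.prems(1) by auto
    have "(transpose_mat F *\<^sub>v w) $ i = (\<Sum>r<n. f r i * w $ r)"
      using \<open>i < n\<close> that w(1) F
      by (auto simp: scalar_prod_def F_def lessThan_atLeast0 intro!: sum.cong)
    then show ?thesis using w \<open>i < n\<close> by simp
  qed
  define s where "s = sqrt (\<Sum>r<n. (cmod (w $ r))\<^sup>2)"
  obtain r0 where "r0 < n" "w $ r0 \<noteq> 0"
    using w(1,2) by (metis carrier_vecD eq_vecI index_zero_vec(1,2))
  then have "(\<Sum>r<n. (cmod (w $ r))\<^sup>2) > 0"
    by (intro sum_pos2[of _ r0]) auto
  then have s: "s > 0" "s\<^sup>2 = (\<Sum>r<n. (cmod (w $ r))\<^sup>2)"
    by (auto simp: s_def)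
  \<comment> \<open>The kernel relation is bilinear, without conjugation; passing to
    \<open>cnj (w $ r)\<close> turns it into orthogonality for the Hermitian product.\<close>
  define g where "g = (\<lambda>r i. if i = z then cnj (w $ r) / of_real s else f r i)"
  have gz: "(\<Sum>r<n. cnj (g r z) * g r z) = 1"
    unfolding sum_cnj_mult_self using s
    by (simp add: g_def norm_divide power_divide flip: sum_divide_distrib) (metis less_irrefl zero_less_power)
  have gi: "(\<Sum>r<n. cnj (g r i) * g r z) = 0" if "i \<in> S" for i
  proof -
    have "i \<noteq> z" using that z by auto
    have "(\<Sum>r<n. cnj (g r i) * g r z) = cnj (\<Sum>r<n. f r i * w $ r) / of_real s"
      using \<open>i \<noteq> z\<close> by (simp add: g_def sum_divide_distrib)
    then show ?thesis using orth[OF that] by simp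
  qed
  have gi': "(\<Sum>r<n. cnj (g r z) * g r i) = 0" if "i \<in> S" for i
  proof -
    have "(\<Sum>r<n. cnj (g r z) * g r i) = cnj (\<Sum>r<n. cnj (g r i) * g r z)"
      by (simp add: mult.commute)
    then show ?thesis using gi[OF that] by simp
  qed
  have "\<exists>W\<in>unitary_mats n. \<forall>i\<in>insert z S. \<forall>r<n. W $$ (r, i) = g r i"
  proof (rule Suc.hyps(1))
    show "m = n - card (insert z S)" using Suc.hyps(2) z fin by simp
    show "insert z S \<subseteq> {..<n}" using z Suc.prems by auto
    fix i j assume ij: "i \<in> insert z S" "j \<in> insert z S"
    show "(\<Sum>r<n. cnj (g r i) * g r j) = (if i = j then 1 else 0)"
    proof (cases "i = z \<or> j = z")
      case True
      then show ?thesis using ij gz gi gi' z by auto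
    next
      case False
      then show ?thesis using ij Suc.prems(2) by (simp add: g_def)
    qed
  qed
  then obtain W where "W \<in> unitary_mats n" "\<forall>i\<in>insert z S. \<forall>r<n. W $$ (r, i) = g r i" by blast
  then show ?case using z by (intro bexI[of _ W]) (auto simp: g_def)
qed

text \<open>Deflation. A unit eigenvector is made the first column of a unitary; after conjugation
  the first column is a multiple of a unit vector, and hermiticity does the same to the first row.
  The remaining block is again Hermitian.\<close>

lemma hermitian_diagonalization:
  assumes "A \<in> carrier_mat n n" "mat_adjoint A = A"
  shows "\<exists>V\<in>unitary_mats n. \<exists>d :: nat \<Rightarrow> real. mat_adjoint V * A * V = mat_diag n (\<lambda>i. of_real (d i))"
  using assms
proof (induction n arbitrary: A)
  case 0
  then show ?case by (intro bexI[of _ "1\<^sub>m 0"] exI[of _ "\<lambda>_. 0"] eq_matI) (auto simp: unitary_mats_one mat_diag_def)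
next
  case (Suc n)
  let ?N = "Suc n"
  note A = Suc.prems(1)
  obtain es where es: "char_poly A = (\<Prod>a\<leftarrow>es. [:- a, 1:])" "length es = ?N"
    using char_poly_factorized[OF A] by blast
  then obtain e where "e \<in> set es" by (cases es) auto
  then have "eigenvalue A e"
    using es A by (subst eigenvalue_root_char_poly[OF A]) (auto simp: poly_prod_list prod_list_zero_iff)
  then obtain v where v: "v \<in> carrier_vec ?N" "v \<noteq> 0\<^sub>v ?N" "A *\<^sub>v v = e \<cdot>\<^sub>v v"
    using A by (auto simp: eigenvalue_def eigenvector_def)
  define s where "s = sqrt (\<Sum>r<?N. (cmod (v $ r))\<^sup>2)"
  obtain r0 where "r0 < ?N" "v $ r0 \<noteq> 0"
    using v(1,2) by (metis carrier_vecD eq_vecI index_zero_vec(1,2))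
  then have "(\<Sum>r<?N. (cmod (v $ r))\<^sup>2) > 0"
    by (intro sum_pos2[of _ r0]) (auto simp del: sum.lessThan_Suc)
  then have s: "s > 0" "s\<^sup>2 = (\<Sum>r<?N. (cmod (v $ r))\<^sup>2)"
    by (auto simp: s_def simp del: sum.lessThan_Suc)
  have unit: "(\<Sum>r<?N. cnj (v $ r / of_real s) * (v $ r / of_real s)) = 1"
    unfolding sum_cnj_mult_self using s
    by (simp add: norm_divide power_divide del: sum.lessThan_Suc flip: sum_divide_distrib) (metis less_irrefl zero_less_power)
  have "\<exists>W\<in>unitary_mats ?N. \<forall>i\<in>{0}. \<forall>r<?N. W $$ (r, i) = v $ r / of_real s"
    by (rule unitary_mats_extend) (use unit in auto)
  then obtain W where W: "W \<in> unitary_mats ?N" and W0: "\<And>r. r < ?N \<Longrightarrow> W $$ (r, 0) = v $ r / of_real s"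
    by auto
  note Wc = unitary_matsD[OF W]
  define B where "B = mat_adjoint W * A * W"
  have B: "B \<in> carrier_mat ?N ?N" using Wc A by (auto simp: B_def)
  have Bherm: "mat_adjoint B = B"
    using Wc(1,2) A Suc.prems(2)
    by (simp add: B_def mat_adjoint_mult[of _ ?N ?N _ ?N] assoc_mult_mat[of _ ?N ?N _ ?N _ ?N] mult_carrier_mat[of _ ?N ?N _ ?N])
  have AW0: "(A * W) $$ (i, 0) = e * W $$ (i, 0)" if "i < ?N" for i
  proof -
    have "(A * W) $$ (i, 0) = (\<Sum>k<?N. A $$ (i, k) * v $ k) / of_real s"
      using that A Wc W0 by (simp add: index_mult_mat_sum[of _ ?N ?N _ ?N] sum_divide_distrib del: index_mult_mat(1) sum.lessThan_Suc)
    also have "(\<Sum>k<?N. A $$ (i, k) * v $ k) = (A *\<^sub>v v) $ i"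
      using that A v(1) by (auto simp: scalar_prod_def lessThan_atLeast0 simp del: sum.op_ivl_Suc intro!: sum.cong)
    finally show ?thesis using that v W0[OF that] by simp
  qed
  have B0: "B $$ (i, 0) = (if i = 0 then e else 0)" if "i < ?N" for i
  proof -
    have "B $$ (i, 0) = (mat_adjoint W * (A * W)) $$ (i, 0)"
      using A Wc by (simp add: B_def assoc_mult_mat[of _ ?N ?N _ ?N _ ?N])
    also have "\<dots> = (\<Sum>k<?N. cnj (W $$ (k, i)) * (A * W) $$ (k, 0))"
      using that A Wc by (intro index_adjoint_mult[of _ ?N ?N _ ?N]) auto
    also have "\<dots> = e * (\<Sum>k<?N. cnj (W $$ (k, i)) * W $$ (k, 0))"
      unfolding sum_distrib_left by (intro sum.cong) (auto simp: AW0 simp del: index_mult_mat(1))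
    finally show ?thesis using unitary_mats_cols[OF W that, of 0] by simp
  qed
  have Bij: "cnj (B $$ (j, i)) = B $$ (i, j)" if "i < ?N" "j < ?N" for i j
    using arg_cong[OF Bherm, of "\<lambda>M. M $$ (i, j)"] that B by simp
  have B0': "B $$ (0, i) = (if i = 0 then e else 0)" if "i < ?N" for i
    using Bij[of 0 i] B0[OF that] B0[of 0] that by (cases "i = 0") (simp_all del: sum.lessThan_Suc)
  \<comment> \<open>The eigenvalue is a diagonal entry of a Hermitian matrix, hence real.\<close>
  have "cnj e = e" using Bij[of 0 0] B0[of 0] by simp
  then have ereal: "of_real (Re e) = e"
    by (simp add: complex_eq_iff)
  define C where "C = mat n n (\<lambda>(i, j). B $$ (Suc i, Suc j))"
  have C: "C \<in> carrier_mat n n" by (simp add: C_def)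
  have "mat_adjoint C = C"
    by (rule eq_matI) (auto simp: C_def Bij)
  with Suc.IH[OF C] obtain X d where X: "X \<in> unitary_mats n"
    and d: "mat_adjoint X * C * X = mat_diag n (\<lambda>i. of_real (d i))" by auto
  note Xc = unitary_matsD[OF X]
  \<comment> \<open>The unitary of the block is bordered by a 1 in the corner, so that it leaves the
    eigenvector column alone.\<close>
  define V where "V = mat ?N ?N (\<lambda>(i, j). if i = 0 \<or> j = 0 then (if i = j then 1 else 0) else X $$ (i - 1, j - 1))"
  have Vc: "V \<in> carrier_mat ?N ?N" by (simp add: V_def)
  have V: "V \<in> unitary_mats ?N"
  proof (rule unitary_matsI[OF Vc])
    fix i j assume "i < ?N" "j < ?N"
    then show "(\<Sum>r<?N. cnj (V $$ (r, i)) * V $$ (r, j)) = (if i = j then 1 else 0)"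
      by (cases i; cases j) (simp_all add: V_def sum.lessThan_Suc_shift unitary_mats_cols[OF X] del: sum.lessThan_Suc)
  qed
  have key: "mat_adjoint V * B * V = mat_diag ?N (\<lambda>i. of_real (case i of 0 \<Rightarrow> Re e | Suc i \<Rightarrow> d i))"
  proof (rule eq_matI)
    fix i j assume "i < dim_row (mat_diag ?N (\<lambda>i. complex_of_real (case i of 0 \<Rightarrow> Re e | Suc i \<Rightarrow> d i)))"
      "j < dim_col (mat_diag ?N (\<lambda>i. complex_of_real (case i of 0 \<Rightarrow> Re e | Suc i \<Rightarrow> d i)))"
    then have ij: "i < ?N" "j < ?N" by (auto simp: mat_diag_def)
    have Cij: "(\<Sum>k<n. cnj (X $$ (k, a)) * (\<Sum>l<n. C $$ (k, l) * X $$ (l, b))) = (if a = b then of_real (d a) else 0)"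
      if "a < n" "b < n" for a b
    proof -
      have "(mat_adjoint X * (C * X)) $$ (a, b) = (\<Sum>k<n. cnj (X $$ (k, a)) * (C * X) $$ (k, b))"
        using that C Xc by (intro index_adjoint_mult[of _ n n _ n]) auto
      also have "\<dots> = (\<Sum>k<n. cnj (X $$ (k, a)) * (\<Sum>l<n. C $$ (k, l) * X $$ (l, b)))"
        using that C Xc by (intro sum.cong refl) (simp add: index_mult_mat_sum[of _ n n _ n] del: index_mult_mat(1))
      finally have "(\<Sum>k<n. cnj (X $$ (k, a)) * (\<Sum>l<n. C $$ (k, l) * X $$ (l, b))) = (mat_adjoint X * C * X) $$ (a, b)"
        using C Xc(1,2) by (simp add: assoc_mult_mat[of _ n n _ n _ n] del: index_mult_mat(1))
      then show ?thesis
        using that by (simp add: d mat_diag_def)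
    qed
    have "(mat_adjoint V * B * V) $$ (i, j) = (mat_adjoint V * (B * V)) $$ (i, j)"
      using Vc B by (simp add: assoc_mult_mat[of _ ?N ?N _ ?N _ ?N])
    also have "\<dots> = (\<Sum>k<?N. cnj (V $$ (k, i)) * (B * V) $$ (k, j))"
      using ij B Vc by (intro index_adjoint_mult[of _ ?N ?N _ ?N]) auto
    also have "\<dots> = (\<Sum>k<?N. cnj (V $$ (k, i)) * (\<Sum>l<?N. B $$ (k, l) * V $$ (l, j)))"
      using ij B Vc by (intro sum.cong refl) (simp add: index_mult_mat_sum[of _ ?N ?N _ ?N] del: index_mult_mat(1) sum.lessThan_Suc)
    also have "\<dots> = (if i = j then of_real (case i of 0 \<Rightarrow> Re e | Suc i \<Rightarrow> d i) else 0)"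
      using ij ereal Cij
      by (cases i; cases j) (simp_all add: V_def B0 B0' C_def sum.lessThan_Suc_shift del: sum.lessThan_Suc)
    finally show "(mat_adjoint V * B * V) $$ (i, j) = mat_diag ?N (\<lambda>i. complex_of_real (case i of 0 \<Rightarrow> Re e | Suc i \<Rightarrow> d i)) $$ (i, j)"
      using ij by (auto simp: mat_diag_def)
  qed (use Vc in \<open>auto simp: mat_diag_def\<close>)
  have "mat_adjoint (W * V) * A * (W * V) = mat_adjoint V * B * V"
    using A Wc(1,2) Vc unitary_matsD(2)[OF V]
    by (simp add: B_def mat_adjoint_mult[of _ ?N ?N _ ?N] assoc_mult_mat[of _ ?N ?N _ ?N _ ?N] mult_carrier_mat[of _ ?N ?N _ ?N])
  then show ?case
    using key unitary_mats_mult[OF W V] by (intro bexI[of _ "W * V"]) auto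
qed

text \<open>Diagonalising the Gram matrix by \<open>V\<close> makes the columns of
  \<open>A * V\<close> orthogonal, with the eigenvalues as squared lengths. The nonzero columns,
  normalised, are extended to the unitary \<open>U\<close>; its other columns are multiplied by
  zero.\<close>

lemma singular_value_decomposition:
  assumes A: "A \<in> carrier_mat n n"
  obtains U V s where "U \<in> unitary_mats n" "V \<in> unitary_mats n" "\<And>i. s i \<ge> (0::real)"
    "A = U * mat_diag n (\<lambda>i. of_real (s i)) * mat_adjoint V"
proof -
  have "mat_adjoint A * A \<in> carrier_mat n n" "mat_adjoint (mat_adjoint A * A) = mat_adjoint A * A"
    using A by (auto simp: mat_adjoint_mult[of _ n n _ n])
  from hermitian_diagonalization[OF this] obtain V d where V: "V \<in> unitary_mats n"
    and d: "mat_adjoint V * (mat_adjoint A * A) * V = mat_diag n (\<lambda>i. of_real (d i :: real))" by auto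
  note Vc = unitary_matsD[OF V]
  define B where "B = A * V"
  have B: "B \<in> carrier_mat n n" using A Vc by (auto simp: B_def)
  have "mat_adjoint B * B = mat_diag n (\<lambda>i. of_real (d i))"
    using A Vc(1,2) by (simp add: d[symmetric] B_def mat_adjoint_mult[of _ n n _ n] assoc_mult_mat[of _ n n _ n _ n] mult_carrier_mat[of _ n n _ n])
  then have BB: "(\<Sum>r<n. cnj (B $$ (r, i)) * B $$ (r, j)) = (if i = j then of_real (d i) else 0)"
    if "i < n" "j < n" for i j
    unfolding index_adjoint_mult[OF B B that, symmetric] using that by (simp add: mat_diag_def)
  have dsum: "d i = (\<Sum>r<n. (cmod (B $$ (r, i)))\<^sup>2)" if "i < n" for i
  proof -
    have "complex_of_real (d i) = of_real (\<Sum>r<n. (cmod (B $$ (r, i)))\<^sup>2)"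
      using BB[OF that that] unfolding sum_cnj_mult_self by simp
    then show ?thesis by (simp only: of_real_eq_iff)
  qed
  \<comment> \<open>The default 0 from \<open>n\<close> on gives nonnegativity at every index, which
    is the form in which later lemmas ask for it.\<close>
  define s where "s = (\<lambda>i. if i < n then sqrt (d i) else 0)"
  have dnn: "d i \<ge> 0" if "i < n" for i using dsum[OF that] by (simp add: sum_nonneg)
  then have s: "s i \<ge> 0" for i by (simp add: s_def)
  have "\<exists>U\<in>unitary_mats n. \<forall>i\<in>{i. i < n \<and> d i \<noteq> 0}. \<forall>r<n. U $$ (r, i) = B $$ (r, i) / of_real (s i)"
  proof (rule unitary_mats_extend)
    fix i j assume ij: "i \<in> {i. i < n \<and> d i \<noteq> 0}" "j \<in> {i. i < n \<and> d i \<noteq> 0}"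
    have "(\<Sum>r<n. cnj (B $$ (r, i) / of_real (s i)) * (B $$ (r, j) / of_real (s j)))
      = (\<Sum>r<n. cnj (B $$ (r, i)) * B $$ (r, j)) / (of_real (s i) * of_real (s j))"
      by (simp add: sum_divide_distrib)
    also have "\<dots> = (if i = j then of_real (d i) / of_real (s i * s i) else 0)"
      using BB ij by simp
    also have "\<dots> = (if i = j then 1 else 0)"
      using ij dnn[of i] by (auto simp: s_def)
    finally show "(\<Sum>r<n. cnj (B $$ (r, i) / of_real (s i)) * (B $$ (r, j) / of_real (s j))) = (if i = j then 1 else 0)" .
  qed auto
  then obtain U where U: "U \<in> unitary_mats n"
    and Ui: "\<And>i r. i < n \<Longrightarrow> d i \<noteq> 0 \<Longrightarrow> r < n \<Longrightarrow> U $$ (r, i) = B $$ (r, i) / of_real (s i)"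
    by auto
  have "U * mat_diag n (\<lambda>i. of_real (s i)) = B"
  proof (rule eq_matI)
    fix r i assume "r < dim_row B" "i < dim_col B"
    then have ri: "r < n" "i < n" using B by auto
    have "U $$ (r, i) * of_real (s i) = B $$ (r, i)"
    proof (cases "d i = 0")
      case True
      then have "(\<Sum>r<n. (cmod (B $$ (r, i)))\<^sup>2) = 0" using dsum ri by simp
      then have "B $$ (r, i) = 0" using ri by (simp add: sum_nonneg_eq_0_iff)
      then show ?thesis using True by (simp add: s_def)
    next
      case False
      then show ?thesis using Ui[OF ri(2) False ri(1)] ri dnn[of i] by (simp add: s_def)
    qed
    then show "(U * mat_diag n (\<lambda>i. of_real (s i))) $$ (r, i) = B $$ (r, i)"
      using ri unitary_matsD(1)[OF U] by (simp add: mat_diag_mult_right[of _ n n] del: index_mult_mat(1))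
  qed (use B unitary_matsD(1)[OF U] in \<open>auto simp: mat_diag_def\<close>)
  moreover have "A = B * mat_adjoint V"
    using A Vc by (simp add: B_def assoc_mult_mat[of _ n n _ n _ n])
  ultimately have "A = U * mat_diag n (\<lambda>i. of_real (s i)) * mat_adjoint V" by simp
  then show ?thesis by (intro that[of U V s] U V s)
qed

section \<open>Schatten norms by duality\<close>

lemma mat_trace_diag_conj:
  assumes V: "V \<in> unitary_mats n"
  shows "mat_trace (V * mat_diag n f * mat_adjoint V) = (\<Sum>i<n. f i)"
proof -
  note Vc = unitary_matsD[OF V]
  have ent: "(V * mat_diag n f * mat_adjoint V) $$ (i, i) = (\<Sum>k<n. V $$ (i, k) * f k * cnj (V $$ (i, k)))"
    if "i < n" for i
  proof -
    have "V * mat_diag n f \<in> carrier_mat n n" using Vc(1) by (auto simp: mat_diag_def)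
    then show ?thesis using that Vc
      by (simp add: index_mult_mat_sum[of _ n n _ n] mat_diag_mult_right[OF Vc(1)] del: index_mult_mat(1))
  qed
  have "mat_trace (V * mat_diag n f * mat_adjoint V) = (\<Sum>i<n. \<Sum>k<n. V $$ (i, k) * f k * cnj (V $$ (i, k)))"
    unfolding mat_trace_def using Vc(1) ent by (auto intro!: sum.cong simp del: index_mult_mat(1))
  also have "\<dots> = (\<Sum>k<n. f k * (\<Sum>i<n. cnj (V $$ (i, k)) * V $$ (i, k)))"
    by (subst sum.swap) (simp add: sum_distrib_left mult_ac)
  also have "\<dots> = (\<Sum>k<n. f k)"
    using unitary_mats_cols[OF V] by (auto intro!: sum.cong)
  finally show ?thesis .
qed

lemma adjoint_mat_diag: "mat_adjoint (mat_diag n (\<lambda>i. complex_of_real (s i))) = mat_diag n (\<lambda>i. of_real (s i))"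
  by (rule eq_matI) (auto simp: mat_diag_def)

lemma gram_svd:
  assumes U: "U \<in> unitary_mats n" and V: "V \<in> unitary_mats n"
    and A: "A = U * mat_diag n (\<lambda>i. complex_of_real (s i)) * mat_adjoint V"
  shows "mat_adjoint A * A = V * mat_diag n (\<lambda>i. of_real ((s i)\<^sup>2)) * mat_adjoint V"
proof -
  note Uc = unitary_matsD[OF U] and Vc = unitary_matsD[OF V]
  let ?D = "mat_diag n (\<lambda>i. complex_of_real (s i))"
  have D: "?D \<in> carrier_mat n n" by (simp add: mat_diag_def)
  have "mat_adjoint A = V * (?D * mat_adjoint U)"
    using Uc(1,2) Vc(1,2) D
    by (simp add: A mat_adjoint_mult[of _ n n _ n] adjoint_mat_diag assoc_mult_mat[of _ n n _ n _ n] mult_carrier_mat[of _ n n _ n])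
  then have "mat_adjoint A * A = V * (?D * (mat_adjoint U * U) * ?D) * mat_adjoint V"
    using Uc(1,2) Vc(1,2) D
    by (simp add: A assoc_mult_mat[of _ n n _ n _ n] mult_carrier_mat[of _ n n _ n])
  then show ?thesis
    using Uc(4) D by (simp add: mat_diag_diag power2_eq_square)
qed

lemma mat_abs_svd:
  assumes U: "U \<in> unitary_mats n" and V: "V \<in> unitary_mats n" and s: "\<And>i. s i \<ge> 0"
    and A: "A = U * mat_diag n (\<lambda>i. complex_of_real (s i)) * mat_adjoint V"
  shows "mat_abs A = V * mat_diag n (\<lambda>i. of_real (s i)) * mat_adjoint V"
  unfolding mat_abs_def herm_fun_eqI[OF V gram_svd[OF U V A]] using s by simp

lemma schatten_norm_svd:
  assumes U: "U \<in> unitary_mats n" and V: "V \<in> unitary_mats n" and s: "\<And>i. s i \<ge> 0"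
    and A: "A = U * mat_diag n (\<lambda>i. complex_of_real (s i)) * mat_adjoint V"
    and q: "q \<noteq> \<infinity>"
  shows "schatten_norm q A = (\<Sum>i<n. s i powr enn2real q) powr (1 / enn2real q)"
  using q unfolding schatten_norm_def herm_fun_eqI[OF V mat_abs_svd[OF U V s A]]
  by (simp add: mat_trace_diag_conj[OF V])

definition lin_fun :: "nat \<Rightarrow> (nat \<Rightarrow> nat \<Rightarrow> complex) \<Rightarrow> complex mat \<Rightarrow> real" where
  "lin_fun d \<kappa> Z = Re (\<Sum>r<d. \<Sum>c<d. \<kappa> r c * Z $$ (r, c))"

text \<open>
  A norm that is a supremum of real-linear functionals. Convexity, homogeneity, Jensen's inequality and
  lower semicontinuity (hence measurability) need nothing else.
\<close>

definition supported_norm :: "nat \<Rightarrow> (complex mat \<Rightarrow> real) \<Rightarrow> bool" where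
  "supported_norm d \<nu> \<longleftrightarrow> (\<forall>Z\<in>carrier_mat d d. 0 \<le> \<nu> Z) \<and>
    (\<forall>M\<in>carrier_mat d d. \<forall>c<\<nu> M. \<exists>\<kappa>. c < lin_fun d \<kappa> M \<and> (\<forall>Z\<in>carrier_mat d d. lin_fun d \<kappa> Z \<le> \<nu> Z))"

text \<open>Young's inequality for \<open>x powr (q - 1)\<close> and \<open>y\<close> with the
  conjugate exponents q/(q-1) and q. At q = 1 the first exponent is not defined, hence the separate
  case.\<close>

lemma youngs_inequality_powr:
  fixes x y q :: real
  assumes "q \<ge> 1" "x \<ge> 0" "y \<ge> 0"
  shows "x powr (q - 1) * y \<le> (1 - 1 / q) * x powr q + y powr q / q"
proof (cases "q = 1")
  case True
  then show ?thesis using assms by (cases "x = 0") auto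
next
  case False
  then have q: "q > 1" using assms by simp
  have "x powr (q - 1) * y \<le> (x powr (q - 1)) powr (q / (q - 1)) / (q / (q - 1)) + y powr q / q"
    using q assms by (intro Youngs_inequality) (auto simp: field_simps)
  also have "(x powr (q - 1)) powr (q / (q - 1)) / (q / (q - 1)) = (1 - 1 / q) * x powr q"
  proof -
    have "(q - 1) * (q / (q - 1)) = q" "1 / (q / (q - 1)) = 1 - 1 / q" using q by (auto simp: field_simps)
    then show ?thesis unfolding powr_powr by (metis divide_inverse inverse_eq_divide mult.commute)
  qed
  finally show ?thesis .
qed

text \<open>With both power sums normalised to one, Young's inequality is applied to each pair (i,
  k). The row and column sums of \<open>D\<close> collapse the resulting double sum to (1 - 1/q) +
  1/q = 1.\<close>

lemma doubly_stochastic_holder: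
  fixes D :: "nat \<Rightarrow> nat \<Rightarrow> real" and s \<sigma> :: "nat \<Rightarrow> real"
  assumes q: "q \<ge> 1" and s: "\<And>i. s i \<ge> 0" and \<sigma>: "\<And>i. \<sigma> i \<ge> 0"
    and D: "\<And>i k. D i k \<ge> 0" "\<And>i. i < n \<Longrightarrow> (\<Sum>k<n. D i k) = 1" "\<And>k. k < n \<Longrightarrow> (\<Sum>i<n. D i k) = 1"
  shows "(\<Sum>i<n. \<Sum>k<n. D i k * (s i powr (q - 1) * \<sigma> k))
     \<le> (\<Sum>i<n. s i powr q) powr (1 - 1 / q) * (\<Sum>k<n. \<sigma> k powr q) powr (1 / q)"
proof (cases "(\<Sum>i<n. s i powr q) = 0 \<or> (\<Sum>i<n. \<sigma> i powr q) = 0")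
  case True
  then have "(\<forall>i<n. s i = 0) \<or> (\<forall>i<n. \<sigma> i = 0)"
    by (auto simp: sum_nonneg_eq_0_iff)
  then have "(\<Sum>i<n. \<Sum>k<n. D i k * (s i powr (q - 1) * \<sigma> k)) = 0"
    by (auto intro!: sum.neutral)
  then show ?thesis by simp
next
  case False
  define S T where "S = (\<Sum>i<n. s i powr q)" and "T = (\<Sum>k<n. \<sigma> k powr q)"
  have pos: "S > 0" "T > 0"
    using False by (auto simp: S_def T_def sum_nonneg order_less_le)
  define a b where "a = S powr (1 / q)" and "b = T powr (1 / q)"
  have ab: "a > 0" "b > 0" "a powr q = S" "b powr q = T"
    using pos q by (auto simp: a_def b_def powr_powr)
  have aq: "a powr (q - 1) = S powr (1 - 1 / q)"
    using q by (simp add: a_def powr_powr field_simps)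
  have "(\<Sum>i<n. \<Sum>k<n. D i k * (s i powr (q - 1) * \<sigma> k))
      = a powr (q - 1) * b * (\<Sum>i<n. \<Sum>k<n. D i k * ((s i / a) powr (q - 1) * (\<sigma> k / b)))"
    using ab s by (simp add: sum_distrib_left powr_divide field_simps)
  also have "\<dots> \<le> a powr (q - 1) * b * (\<Sum>i<n. \<Sum>k<n. D i k * ((1 - 1 / q) * (s i / a) powr q + (\<sigma> k / b) powr q / q))"
    using ab s \<sigma> q D by (intro mult_left_mono sum_mono youngs_inequality_powr) auto
  also have "(\<Sum>i<n. \<Sum>k<n. D i k * ((1 - 1 / q) * (s i / a) powr q + (\<sigma> k / b) powr q / q)) =
      (\<Sum>i<n. (1 - 1 / q) * (s i / a) powr q * (\<Sum>k<n. D i k)) + (\<Sum>k<n. (\<sigma> k / b) powr q / q * (\<Sum>i<n. D i k))"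
    unfolding distrib_left sum.distrib
  proof (intro arg_cong2[where f = "(+)"])
    show "(\<Sum>i<n. \<Sum>k<n. D i k * ((\<sigma> k / b) powr q / q)) = (\<Sum>k<n. (\<sigma> k / b) powr q / q * (\<Sum>i<n. D i k))"
      by (subst sum.swap) (simp add: sum_distrib_left sum_divide_distrib mult_ac)
    show "(\<Sum>i<n. \<Sum>k<n. D i k * ((1 - 1 / q) * (s i / a) powr q)) = (\<Sum>i<n. (1 - 1 / q) * (s i / a) powr q * (\<Sum>k<n. D i k))"
      by (intro sum.cong refl) (subst sum_distrib_left, rule sum.cong, rule refl, rule mult.commute)
  qed
  also have "\<dots> = (1 - 1 / q) * (\<Sum>i<n. (s i / a) powr q) + (\<Sum>k<n. (\<sigma> k / b) powr q) / q"
    using D by (simp add: sum_distrib_left sum_divide_distrib)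
  also have "(\<Sum>i<n. (s i / a) powr q) = 1"
    using ab s pos by (simp add: powr_divide S_def flip: sum_divide_distrib)
  also have "(\<Sum>k<n. (\<sigma> k / b) powr q) = 1"
    using ab \<sigma> pos by (simp add: powr_divide T_def flip: sum_divide_distrib)
  finally show ?thesis using aq by (simp add: b_def S_def T_def)
qed

lemma svd_index:
  assumes "U \<in> carrier_mat n n" "V \<in> carrier_mat n n" "r < n" "c < n"
  shows "(U * mat_diag n f * mat_adjoint V) $$ (r, c) = (\<Sum>k<n. U $$ (r, k) * f k * cnj (V $$ (c, k)))"
proof -
  have "U * mat_diag n f \<in> carrier_mat n n" using assms by (auto simp: mat_diag_def)
  then show ?thesis using assms
    by (simp add: index_mult_mat_sum[of _ n n _ n] mat_diag_mult_right[OF assms(1)] del: index_mult_mat(1))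
qed

text \<open>
  If \<open>M = U s V\<^sup>*\<close>, the norming functional at \<open>M\<close> is a multiple of the trace of \<open>V s\<^bsup>p-1\<^esup> U\<^sup>* Z\<close>. The diagonal
  of \<open>U\<^sup>* Z V\<close> is dominated by a doubly stochastic average of the singular values of \<open>Z\<close>, so the Hoelder-type
  bound above applies.
\<close>

lemma schatten_norm_supported:
  assumes q: "q \<ge> 1" "q \<noteq> \<infinity>"
  shows "supported_norm n (schatten_norm q)"
  unfolding supported_norm_def
proof (intro conjI ballI allI impI)
  define p where "p = enn2real q"
  have p: "p \<ge> 1"
    using q by (cases q) (auto simp: p_def)
  fix Z show "0 \<le> schatten_norm q Z" using q by (simp add: schatten_norm_def)
next
  define p where "p = enn2real q"
  have p: "p \<ge> 1"
    using q by (cases q) (auto simp: p_def)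
  fix M :: "complex mat" and c assume M: "M \<in> carrier_mat n n" and c: "c < schatten_norm q M"
  obtain U V s where U: "U \<in> unitary_mats n" and V: "V \<in> unitary_mats n" and s: "\<And>i. s i \<ge> 0"
    and Meq: "M = U * mat_diag n (\<lambda>i. of_real (s i)) * mat_adjoint V"
    using singular_value_decomposition[OF M] by metis
  note Uc = unitary_matsD[OF U] and Vc = unitary_matsD[OF V]
  define S where "S = (\<Sum>i<n. s i powr p)"
  have S: "S \<ge> 0" by (simp add: S_def sum_nonneg)
  \<comment> \<open>For S > 0, \<open>S powr (1 - 1 / p)\<close> is the norm of the sequence
    \<open>s i powr (p - 1)\<close> for the exponent dual to p; dividing by it gives the functional
    dual norm one.\<close>
  define t where "t = S powr (1 / p - 1)"
  define \<kappa> where "\<kappa> = (\<lambda>r c. of_real t * (\<Sum>i<n. of_real (s i powr (p - 1)) * cnj (U $$ (r, i)) * V $$ (c, i)))"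
  \<comment> \<open>One formula for two uses: at \<open>M\<close> itself, where the inner sums are
    Kronecker deltas, and at an arbitrary \<open>Z\<close> through its own singular value
    decomposition.\<close>
  have lin: "lin_fun n \<kappa> Z = t * (\<Sum>i<n. s i powr (p - 1) * Re (\<Sum>k<n.
       (\<Sum>r<n. cnj (U $$ (r, i)) * U' $$ (r, k)) * of_real (\<sigma> k) * (\<Sum>c<n. cnj (V' $$ (c, k)) * V $$ (c, i))))"
    if U': "U' \<in> carrier_mat n n" and V': "V' \<in> carrier_mat n n"
      and Z: "Z = U' * mat_diag n (\<lambda>i. of_real (\<sigma> i)) * mat_adjoint V'" for Z U' V' \<sigma>
  proof -
    have "(\<Sum>r<n. \<Sum>c<n. \<kappa> r c * Z $$ (r, c)) = (\<Sum>r<n. \<Sum>c<n. \<Sum>i<n. \<Sum>k<n.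
        of_real t * of_real (s i powr (p - 1)) * cnj (U $$ (r, i)) * V $$ (c, i) * (U' $$ (r, k) * of_real (\<sigma> k) * cnj (V' $$ (c, k))))"
      by (intro sum.cong refl) (simp add: Z svd_index[OF U' V'] \<kappa>_def sum_product sum_distrib_left sum_distrib_right mult_ac del: index_mult_mat(1))
    also have "\<dots> = (\<Sum>i<n. \<Sum>k<n. \<Sum>r<n. \<Sum>c<n.
        of_real t * of_real (s i powr (p - 1)) * cnj (U $$ (r, i)) * V $$ (c, i) * (U' $$ (r, k) * of_real (\<sigma> k) * cnj (V' $$ (c, k))))"
      by (subst sum.swap[of _ "{..<n}" "{..<n}"], subst (2) sum.swap, subst (3) sum.swap, subst sum.swap, subst (2) sum.swap, subst sum.swap) (rule refl)
    also have "\<dots> = of_real t * (\<Sum>i<n. of_real (s i powr (p - 1)) * (\<Sum>k<n.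
       (\<Sum>r<n. cnj (U $$ (r, i)) * U' $$ (r, k)) * of_real (\<sigma> k) * (\<Sum>c<n. cnj (V' $$ (c, k)) * V $$ (c, i))))"
      by (simp add: sum_distrib_left sum_distrib_right mult_ac)
    finally show ?thesis by (simp add: lin_fun_def)
  qed
  show "\<exists>\<kappa>. c < lin_fun n \<kappa> M \<and> (\<forall>Z\<in>carrier_mat n n. lin_fun n \<kappa> Z \<le> schatten_norm q Z)"
  proof (cases "S = 0")
    case True
    then have "c < 0" using c schatten_norm_svd[OF U V s Meq q(2)] by (simp add: S_def p_def)
    then show ?thesis using q by (intro exI[of _ "\<lambda>_ _. 0"]) (auto simp: lin_fun_def schatten_norm_def)
  next
    case False
    then have S: "S > 0" using S by simp
    have "lin_fun n \<kappa> M = t * (\<Sum>i<n. s i powr (p - 1) * s i)"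
      unfolding lin[OF Uc(1) Vc(1) Meq]
      by (intro arg_cong2[where f = "(*)"] refl sum.cong)
        (simp add: unitary_mats_cols[OF U] unitary_mats_cols[OF V] if_distrib[of "\<lambda>x. x * _"] cong: if_cong)
    also have "\<dots> = t * S"
      unfolding S_def
    proof (intro arg_cong2[where f = "(*)"] refl sum.cong)
      fix i show "s i powr (p - 1) * s i = s i powr p"
        using s[of i] by (cases "s i = 0") (auto simp: powr_diff)
    qed
    also have "\<dots> = S powr (1 / p)"
      using S by (simp add: t_def powr_diff)
    also have "\<dots> = schatten_norm q M"
      using schatten_norm_svd[OF U V s Meq q(2)] by (simp add: S_def p_def)
    finally have 1: "c < lin_fun n \<kappa> M" using c by simp
    have 2: "lin_fun n \<kappa> Z \<le> schatten_norm q Z" if "Z \<in> carrier_mat n n" for Z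
    proof -
      obtain U' V' \<sigma> where U': "U' \<in> unitary_mats n" and V': "V' \<in> unitary_mats n" and \<sigma>: "\<And>i. \<sigma> i \<ge> 0"
        and Zeq: "Z = U' * mat_diag n (\<lambda>i. of_real (\<sigma> i)) * mat_adjoint V'"
        using singular_value_decomposition[OF \<open>Z \<in> carrier_mat n n\<close>] by metis
      note U'c = unitary_matsD[OF U'] and V'c = unitary_matsD[OF V']
      define a where "a = mat_adjoint U * U'"
      define b where "b = mat_adjoint V' * V"
      have au: "a \<in> unitary_mats n" and bu: "b \<in> unitary_mats n"
        using U U' V V' by (auto simp: a_def b_def intro: unitary_mats_mult unitary_mats_adjoint)
      have a: "a $$ (i, k) = (\<Sum>r<n. cnj (U $$ (r, i)) * U' $$ (r, k))" if "i < n" "k < n" for i k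
        unfolding a_def using that Uc U'c by (intro index_adjoint_mult) auto
      have b: "b $$ (k, i) = (\<Sum>c<n. cnj (V' $$ (c, k)) * V $$ (c, i))" if "i < n" "k < n" for i k
        unfolding b_def using that Vc V'c by (intro index_adjoint_mult) auto
      \<comment> \<open>By the arithmetic-geometric mean \<open>D i k\<close> dominates |a(i,k)|
        |b(k,i)|, and it is doubly stochastic because rows and columns of the unitaries a and b have
        length one.\<close>
      define D where "D = (\<lambda>i k. ((cmod (a $$ (i, k)))\<^sup>2 + (cmod (b $$ (k, i)))\<^sup>2) / 2)"
      have col: "(\<Sum>i<n. (cmod (w $$ (i, k)))\<^sup>2) = 1" if "w \<in> unitary_mats n" "k < n" for w k
      proof -
        have "(\<Sum>i<n. cnj (w $$ (i, k)) * w $$ (i, k)) = 1"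
          using unitary_mats_cols[OF that that(2)] by simp
        then show ?thesis unfolding sum_cnj_mult_self of_real_eq_1_iff .
      qed
      have row: "(\<Sum>i<n. (cmod (w $$ (k, i)))\<^sup>2) = 1" if "w \<in> unitary_mats n" "k < n" for w k
      proof -
        have "(\<Sum>i<n. cnj (w $$ (k, i)) * w $$ (k, i)) = 1"
          using unitary_mats_rows[OF that that(2)] by (simp add: mult.commute)
        then show ?thesis unfolding sum_cnj_mult_self of_real_eq_1_iff .
      qed
      have "lin_fun n \<kappa> Z = t * (\<Sum>i<n. s i powr (p - 1) * Re (\<Sum>k<n. a $$ (i, k) * of_real (\<sigma> k) * b $$ (k, i)))"
        unfolding lin[OF U'c(1) V'c(1) Zeq] by (simp add: a b)
      also have "\<dots> \<le> t * (\<Sum>i<n. s i powr (p - 1) * (\<Sum>k<n. D i k * \<sigma> k))"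
      proof (intro mult_left_mono sum_mono)
        fix i
        have "Re (\<Sum>k<n. a $$ (i, k) * of_real (\<sigma> k) * b $$ (k, i)) = (\<Sum>k<n. Re (a $$ (i, k) * b $$ (k, i)) * \<sigma> k)"
          unfolding Re_sum by (intro sum.cong) (auto simp: algebra_simps)
        also have "\<dots> \<le> (\<Sum>k<n. D i k * \<sigma> k)"
        proof (intro sum_mono mult_right_mono \<sigma>)
          fix k
          have "Re (a $$ (i, k) * b $$ (k, i)) \<le> cmod (a $$ (i, k)) * cmod (b $$ (k, i))"
            using complex_Re_le_cmod[of "a $$ (i, k) * b $$ (k, i)"] by (simp add: norm_mult)
          also have "\<dots> \<le> D i k"
            using sum_squares_bound[of "cmod (a $$ (i, k))" "cmod (b $$ (k, i))"] by (simp add: D_def)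
          finally show "Re (a $$ (i, k) * b $$ (k, i)) \<le> D i k" .
        qed
        finally show "Re (\<Sum>k<n. a $$ (i, k) * of_real (\<sigma> k) * b $$ (k, i)) \<le> (\<Sum>k<n. D i k * \<sigma> k)" .
      qed (auto simp: t_def)
      also have "(\<Sum>i<n. s i powr (p - 1) * (\<Sum>k<n. D i k * \<sigma> k)) = (\<Sum>i<n. \<Sum>k<n. D i k * (s i powr (p - 1) * \<sigma> k))"
        by (simp add: sum_distrib_left mult_ac)
      also have "t * \<dots> \<le> t * (S powr (1 - 1 / p) * (\<Sum>k<n. \<sigma> k powr p) powr (1 / p))"
        unfolding S_def
      proof (intro mult_left_mono doubly_stochastic_holder p s \<sigma>)
        show "D i k \<ge> 0" for i k by (simp add: D_def)
        show "(\<Sum>k<n. D i k) = 1" "(\<Sum>k<n. D k i) = 1" if "i < n" for i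
          using row[OF au that] col[OF bu that] col[OF au that] row[OF bu that]
          by (simp_all add: D_def sum.distrib flip: sum_divide_distrib)
      qed (simp add: t_def)
      also have "\<dots> = (\<Sum>k<n. \<sigma> k powr p) powr (1 / p)"
        using S by (simp add: t_def flip: powr_add mult.assoc)
      also have "\<dots> = schatten_norm q Z"
        using schatten_norm_svd[OF U' V' \<sigma> Zeq q(2)] by (simp add: p_def)
      finally show ?thesis .
    qed
    from 1 2 show ?thesis by blast
  qed
qed

section \<open>The operator norm as a supremum of functionals\<close>

lemma vec_l2norm_eq: "vec_l2norm v = L2_set (\<lambda>i. cmod (v $ i)) {..<dim_vec v}"
proof -
  have "v \<bullet>c v = of_real (\<Sum>i<dim_vec v. (cmod (v $ i))\<^sup>2)"
    by (simp add: scalar_prod_def lessThan_atLeast0 of_real_sum complex_norm_square del: of_real_power)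
  then show ?thesis by (simp add: vec_l2norm_def L2_set_def)
qed

text \<open>\<open>op_norm\<close> is a supremum of reals and says something only over a set that is
  bounded above. The sum of the moduli of all entries is a crude but sufficient bound.\<close>

lemma op_norm_bdd:
  assumes A: "A \<in> carrier_mat n n"
  shows "bdd_above ((\<lambda>v. vec_l2norm (A *\<^sub>v v)) ` {v \<in> carrier_vec n. vec_l2norm v \<le> 1})"
proof (intro bdd_aboveI2)
  fix v assume "v \<in> {v \<in> carrier_vec n. vec_l2norm v \<le> 1}"
  then have v: "v \<in> carrier_vec n" "L2_set (\<lambda>i. cmod (v $ i)) {..<n} \<le> 1"
    by (auto simp: vec_l2norm_eq)
  have vi: "cmod (v $ i) \<le> 1" if "i < n" for i
    using v(2) member_le_L2_set[of "{..<n}" i "\<lambda>i. cmod (v $ i)"] that by simp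
  have "vec_l2norm (A *\<^sub>v v) = L2_set (\<lambda>i. cmod ((A *\<^sub>v v) $ i)) {..<n}"
    using A by (simp add: vec_l2norm_eq)
  also have "\<dots> \<le> (\<Sum>i<n. cmod ((A *\<^sub>v v) $ i))"
    by (rule L2_set_le_sum) simp
  also have "\<dots> \<le> (\<Sum>i<n. \<Sum>j<n. cmod (A $$ (i, j)))"
  proof (rule sum_mono)
    fix i assume "i \<in> {..<n}"
    then have "(A *\<^sub>v v) $ i = (\<Sum>j<n. A $$ (i, j) * v $ j)"
      using A v(1) by (auto simp: scalar_prod_def lessThan_atLeast0 intro!: sum.cong)
    also have "cmod \<dots> \<le> (\<Sum>j<n. cmod (A $$ (i, j) * v $ j))" by (rule norm_sum)
    also have "\<dots> \<le> (\<Sum>j<n. cmod (A $$ (i, j)))"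
      using vi by (intro sum_mono) (auto simp: norm_mult mult_left_le)
    finally show "cmod ((A *\<^sub>v v) $ i) \<le> (\<Sum>j<n. cmod (A $$ (i, j)))" .
  qed
  finally show "vec_l2norm (A *\<^sub>v v) \<le> (\<Sum>i<n. \<Sum>j<n. cmod (A $$ (i, j)))" .
qed

lemma op_norm_upper:
  assumes "A \<in> carrier_mat n n" "v \<in> carrier_vec n" "vec_l2norm v \<le> 1"
  shows "vec_l2norm (A *\<^sub>v v) \<le> op_norm A"
  unfolding op_norm_def using assms op_norm_bdd[OF assms(1)] by (intro cSUP_upper) auto

lemma op_norm_nonneg:
  assumes "A \<in> carrier_mat n n"
  shows "op_norm A \<ge> 0"
proof -
  have "0 \<le> vec_l2norm (A *\<^sub>v 0\<^sub>v n)" by (simp add: vec_l2norm_eq)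
  also have "\<dots> \<le> op_norm A"
    using assms by (intro op_norm_upper) (auto simp: vec_l2norm_eq L2_set_def)
  finally show ?thesis .
qed

text \<open>Let v nearly attain the norm at M, and let w = M v. The functional Z -> Re <Z v, w> /
  |w| has the value |w| at M, and by the Cauchy-Schwarz inequality it stays below the operator
  norm.\<close>

lemma op_norm_supported: "supported_norm n op_norm"
  unfolding supported_norm_def
proof (intro conjI ballI allI impI)
  fix Z :: "complex mat" assume "Z \<in> carrier_mat n n" then show "0 \<le> op_norm Z" by (rule op_norm_nonneg)
next
  fix M :: "complex mat" and c assume M: "M \<in> carrier_mat n n" and c: "c < op_norm M"
  show "\<exists>\<kappa>. c < lin_fun n \<kappa> M \<and> (\<forall>Z\<in>carrier_mat n n. lin_fun n \<kappa> Z \<le> op_norm Z)"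
  \<comment> \<open>Below zero the zero functional serves. For c \<ge> 0 the image of the vector
    chosen below is nonzero, so that one can divide by its length.\<close>
  proof (cases "c < 0")
    case True
    then show ?thesis by (intro exI[of _ "\<lambda>_ _. 0"]) (auto simp: lin_fun_def op_norm_nonneg)
  next
    case False
    have ne: "{v \<in> carrier_vec n. vec_l2norm v \<le> 1} \<noteq> {}"
      by (auto simp: vec_l2norm_eq L2_set_def intro!: exI[of _ "0\<^sub>v n"])
    from c obtain v where v: "v \<in> carrier_vec n" "vec_l2norm v \<le> 1" and cv: "c < vec_l2norm (M *\<^sub>v v)"
      unfolding op_norm_def using less_cSUP_iff[OF ne op_norm_bdd[OF M]] M by auto
    define w where "w = M *\<^sub>v v"
    define t where "t = vec_l2norm w"
    have t: "t > 0" using cv False by (simp add: t_def w_def)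
    define \<kappa> where "\<kappa> = (\<lambda>r c. cnj (w $ r) * v $ c / of_real t)"
    have Zv: "(\<Sum>c<n. Z $$ (r, c) * v $ c) = (Z *\<^sub>v v) $ r" if "Z \<in> carrier_mat n n" "r < n" for Z r
      using that v(1) by (auto simp: scalar_prod_def lessThan_atLeast0 intro!: sum.cong)
    have lin: "lin_fun n \<kappa> Z = Re (\<Sum>r<n. cnj (w $ r) * (Z *\<^sub>v v) $ r) / t" if "Z \<in> carrier_mat n n" for Z
    proof -
      have "(\<Sum>r<n. \<Sum>c<n. \<kappa> r c * Z $$ (r, c)) = (\<Sum>r<n. cnj (w $ r) * (\<Sum>c<n. Z $$ (r, c) * v $ c)) / of_real t"
        by (simp add: \<kappa>_def sum_distrib_left sum_divide_distrib mult_ac)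
      also have "\<dots> = (\<Sum>r<n. cnj (w $ r) * (Z *\<^sub>v v) $ r) / of_real t"
        using Zv[OF that] by simp
      finally show ?thesis by (simp add: lin_fun_def)
    qed
    have dw: "dim_vec w = n" using M by (simp add: w_def)
    have t2: "t\<^sup>2 = (\<Sum>r<n. (cmod (w $ r))\<^sup>2)"
      by (simp add: t_def vec_l2norm_eq L2_set_def dw sum_nonneg)
    have "lin_fun n \<kappa> M = t"
      unfolding lin[OF M] w_def[symmetric] sum_cnj_mult_self t2[symmetric] using t by (simp add: power2_eq_square)
    then have 1: "c < lin_fun n \<kappa> M" using cv by (simp add: t_def w_def)
    have 2: "lin_fun n \<kappa> Z \<le> op_norm Z" if Z: "Z \<in> carrier_mat n n" for Z
    proof -
      have "Re (\<Sum>r<n. cnj (w $ r) * (Z *\<^sub>v v) $ r) \<le> (\<Sum>r<n. cmod (cnj (w $ r) * (Z *\<^sub>v v) $ r))"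
        using complex_Re_le_cmod norm_sum order_trans by blast
      also have "\<dots> = (\<Sum>r<n. \<bar>cmod (w $ r)\<bar> * \<bar>cmod ((Z *\<^sub>v v) $ r)\<bar>)"
        by (simp add: norm_mult)
      also have "\<dots> \<le> L2_set (\<lambda>r. cmod (w $ r)) {..<n} * L2_set (\<lambda>r. cmod ((Z *\<^sub>v v) $ r)) {..<n}"
        by (rule L2_set_mult_ineq)
      also have "\<dots> = t * vec_l2norm (Z *\<^sub>v v)"
        using Z by (simp add: t_def vec_l2norm_eq dw)
      also have "\<dots> \<le> t * op_norm Z"
        using t op_norm_upper[OF Z v] by simp
      finally show ?thesis using t by (simp add: lin[OF Z] divide_le_eq mult.commute)
    qed
    from 1 2 show ?thesis by blast
  qed
qed

lemma vec_l2norm_unitary: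
  assumes W: "W \<in> unitary_mats n" and v: "v \<in> carrier_vec n"
  shows "vec_l2norm (W *\<^sub>v v) = vec_l2norm v"
proof -
  note Wc = unitary_matsD[OF W]
  have Wv: "(W *\<^sub>v v) $ r = (\<Sum>c<n. W $$ (r, c) * v $ c)" if "r < n" for r
    using that v Wc(1) by (auto simp: scalar_prod_def lessThan_atLeast0 intro!: sum.cong)
  have "complex_of_real (\<Sum>r<n. (cmod ((W *\<^sub>v v) $ r))\<^sup>2) = (\<Sum>r<n. cnj ((W *\<^sub>v v) $ r) * (W *\<^sub>v v) $ r)"
    by (rule sum_cnj_mult_self[symmetric])
  also have "\<dots> = (\<Sum>r<n. \<Sum>c<n. \<Sum>c'<n. cnj (W $$ (r, c)) * cnj (v $ c) * (W $$ (r, c') * v $ c'))"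
    by (simp add: Wv sum_product)
  also have "\<dots> = (\<Sum>c<n. \<Sum>c'<n. \<Sum>r<n. cnj (W $$ (r, c)) * cnj (v $ c) * (W $$ (r, c') * v $ c'))"
    by (subst sum.swap, subst (2) sum.swap) (rule refl)
  also have "\<dots> = (\<Sum>c<n. \<Sum>c'<n. cnj (v $ c) * v $ c' * (\<Sum>r<n. cnj (W $$ (r, c)) * W $$ (r, c')))"
    by (simp add: sum_distrib_left mult_ac)
  also have "\<dots> = (\<Sum>c<n. cnj (v $ c) * v $ c)"
    by (simp add: unitary_mats_cols[OF W] if_distrib[of "\<lambda>x. _ * x"] cong: if_cong)
  also have "\<dots> = complex_of_real (\<Sum>r<n. (cmod (v $ r))\<^sup>2)"
    by (rule sum_cnj_mult_self)
  finally have "(\<Sum>r<n. (cmod ((W *\<^sub>v v) $ r))\<^sup>2) = (\<Sum>r<n. (cmod (v $ r))\<^sup>2)"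
    by (simp only: of_real_eq_iff)
  then show ?thesis using v Wc(1) by (simp add: vec_l2norm_eq L2_set_def)
qed

lemma op_norm_unitary_le:
  assumes M: "M \<in> carrier_mat n n" and W: "W \<in> unitary_mats n"
  shows "op_norm (M * W) \<le> op_norm M"
  unfolding op_norm_def[of "M * W"]
proof (rule cSUP_least)
  note Wc = unitary_matsD[OF W]
  show "{v \<in> carrier_vec (dim_col (M * W)). vec_l2norm v \<le> 1} \<noteq> {}"
    by (auto simp: vec_l2norm_eq L2_set_def intro!: exI[of _ "0\<^sub>v (dim_col W)"])
  fix v assume "v \<in> {v \<in> carrier_vec (dim_col (M * W)). vec_l2norm v \<le> 1}"
  then have v: "v \<in> carrier_vec n" "vec_l2norm v \<le> 1" using Wc(1) by auto
  have "vec_l2norm (M * W *\<^sub>v v) = vec_l2norm (M *\<^sub>v (W *\<^sub>v v))"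
    using M Wc(1) v(1) by (simp add: assoc_mult_mat_vec[of _ n n _ n])
  also have "\<dots> \<le> op_norm M"
    using M Wc(1) v vec_l2norm_unitary[OF W v(1)] by (intro op_norm_upper) auto
  finally show "vec_l2norm (M * W *\<^sub>v v) \<le> op_norm M" .
qed

text \<open>For finite q only the right singular vectors change. For the operator norm, W maps the
  unit ball into itself, which gives one inequality, and its adjoint gives the other.\<close>

lemma schatten_norm_mult_unitary:
  assumes M: "M \<in> carrier_mat n n" and W: "W \<in> unitary_mats n"
  shows "schatten_norm q (M * W) = schatten_norm q M"
proof (cases "q = \<infinity>")
  case True
  note Wc = unitary_matsD[OF W]
  have "M = M * W * mat_adjoint W" using M Wc by (simp add: assoc_mult_mat[of _ n n _ n _ n])
  then have "op_norm M \<le> op_norm (M * W)"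
    using op_norm_unitary_le[of "M * W" n "mat_adjoint W"] M Wc unitary_mats_adjoint[OF W] by simp
  then show ?thesis using True op_norm_unitary_le[OF M W] by (simp add: schatten_norm_def)
next
  case False
  obtain U V s where U: "U \<in> unitary_mats n" and V: "V \<in> unitary_mats n" and s: "\<And>i. s i \<ge> 0"
    and Meq: "M = U * mat_diag n (\<lambda>i. of_real (s i)) * mat_adjoint V"
    using singular_value_decomposition[OF M] by metis
  note Wc = unitary_matsD[OF W] and Uc = unitary_matsD[OF U] and Vc = unitary_matsD[OF V]
  define V' where "V' = mat_adjoint W * V"
  have V': "V' \<in> unitary_mats n"
    using unitary_mats_adjoint[OF W] V by (simp add: V'_def unitary_mats_mult)
  have "mat_diag n (\<lambda>i. complex_of_real (s i)) \<in> carrier_mat n n" by (simp add: mat_diag_def)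
  then have "M * W = U * mat_diag n (\<lambda>i. of_real (s i)) * mat_adjoint V'"
    using Wc(1,2) Uc(1) Vc(1,2)
    by (simp add: Meq V'_def mat_adjoint_mult[of _ n n _ n] assoc_mult_mat[of _ n n _ n _ n] mult_carrier_mat[of _ n n _ n])
  from schatten_norm_svd[OF U V' s this False] schatten_norm_svd[OF U V s Meq False]
  show ?thesis by simp
qed

lemma schatten_supported:
  assumes "q \<ge> 1"
  shows "supported_norm n (schatten_norm q)"
proof (cases "q = \<infinity>")
  case True
  then have "schatten_norm q = op_norm" by (auto simp: schatten_norm_def)
  then show ?thesis using op_norm_supported by simp
qed (use assms schatten_norm_supported in auto)

section \<open>Norm axioms, Jensen's inequality and measurability from supporting
  functionals\<close>

lemma supported_normD:
  assumes "supported_norm d \<nu>" "M \<in> carrier_mat d d"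
  shows "0 \<le> \<nu> M"
    and "c < \<nu> M \<Longrightarrow> \<exists>\<kappa>. c < lin_fun d \<kappa> M \<and> (\<forall>Z\<in>carrier_mat d d. lin_fun d \<kappa> Z \<le> \<nu> Z)"
  using assms by (auto simp: supported_norm_def)

lemma lin_fun_add:
  assumes "A \<in> carrier_mat d d" "B \<in> carrier_mat d d"
  shows "lin_fun d \<kappa> (A + B) = lin_fun d \<kappa> A + lin_fun d \<kappa> B"
  using assms by (simp add: lin_fun_def distrib_left sum.distrib)

lemma lin_fun_smult:
  assumes "A \<in> carrier_mat d d"
  shows "lin_fun d \<kappa> (complex_of_real b \<cdot>\<^sub>m A) = b * lin_fun d \<kappa> A"
proof -
  have "(\<Sum>r<d. \<Sum>c<d. \<kappa> r c * (complex_of_real b \<cdot>\<^sub>m A) $$ (r, c)) = of_real b * (\<Sum>r<d. \<Sum>c<d. \<kappa> r c * A $$ (r, c))"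
    using assms by (simp add: sum_distrib_left mult_ac)
  then show ?thesis by (simp add: lin_fun_def)
qed

text \<open>A functional that nearly attains the norm at \<open>A + B\<close> splits into its values
  at \<open>A\<close> and \<open>B\<close>, and each is bounded by its own norm.\<close>

lemma supported_norm_add:
  assumes \<nu>: "supported_norm d \<nu>" and A: "A \<in> carrier_mat d d" and B: "B \<in> carrier_mat d d"
  shows "\<nu> (A + B) \<le> \<nu> A + \<nu> B"
proof (rule dense_le)
  fix c assume c: "c < \<nu> (A + B)"
  have AB: "A + B \<in> carrier_mat d d" using A B by simp
  obtain \<kappa> where \<kappa>: "c < lin_fun d \<kappa> (A + B)" "\<forall>Z\<in>carrier_mat d d. lin_fun d \<kappa> Z \<le> \<nu> Z"
    using supported_normD(2)[OF \<nu> AB c] by blast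
  have "lin_fun d \<kappa> A \<le> \<nu> A" "lin_fun d \<kappa> B \<le> \<nu> B" using \<kappa>(2) A B by auto
  then show "c \<le> \<nu> A + \<nu> B" using \<kappa>(1) by (simp add: lin_fun_add[OF A B])
qed

text \<open>A supporting functional at A, evaluated at b A, gives a lower bound only. The same bound
  for the factor 1/b and the matrix b A gives the converse.\<close>

lemma supported_norm_smult:
  assumes \<nu>: "supported_norm d \<nu>" and A: "A \<in> carrier_mat d d" and b: "b > 0"
  shows "\<nu> (complex_of_real b \<cdot>\<^sub>m A) = b * \<nu> A"
proof -
  have ge: "b * \<nu> A \<le> \<nu> (complex_of_real b \<cdot>\<^sub>m A)" if A: "A \<in> carrier_mat d d" and b: "b > 0" for A b
  proof (rule dense_le)
    fix c assume "c < b * \<nu> A"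
    then have "c / b < \<nu> A" using b by (simp add: field_simps)
    from supported_normD(2)[OF \<nu> A this] obtain \<kappa> where \<kappa>:
      "c / b < lin_fun d \<kappa> A" "\<forall>Z\<in>carrier_mat d d. lin_fun d \<kappa> Z \<le> \<nu> Z" by blast
    then have "c < lin_fun d \<kappa> (complex_of_real b \<cdot>\<^sub>m A)"
      using b A by (simp add: lin_fun_smult field_simps)
    moreover have "lin_fun d \<kappa> (complex_of_real b \<cdot>\<^sub>m A) \<le> \<nu> (complex_of_real b \<cdot>\<^sub>m A)"
      using \<kappa> A by auto
    ultimately show "c \<le> \<nu> (complex_of_real b \<cdot>\<^sub>m A)" by simp
  qed
  have "inverse b * \<nu> (complex_of_real b \<cdot>\<^sub>m A) \<le> \<nu> (complex_of_real (inverse b) \<cdot>\<^sub>m (complex_of_real b \<cdot>\<^sub>m A))"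
    using A b by (intro ge) auto
  also have "complex_of_real (inverse b) \<cdot>\<^sub>m (complex_of_real b \<cdot>\<^sub>m A) = A"
    using A b by (intro eq_matI) auto
  finally show ?thesis using ge[OF A b] b by (simp add: field_simps)
qed

lemma supported_norm_zero:
  assumes \<nu>: "supported_norm d \<nu>"
  shows "\<nu> (0\<^sub>m d d) = 0"
proof -
  have "complex_of_real 2 \<cdot>\<^sub>m 0\<^sub>m d d = (0\<^sub>m d d :: complex mat)" by (rule eq_matI) auto
  then have "\<nu> (0\<^sub>m d d) = 2 * \<nu> (0\<^sub>m d d)"
    using supported_norm_smult[OF \<nu>, of "0\<^sub>m d d" 2] by simp
  then show ?thesis by simp
qed

lemma integral_lin_fun:
  assumes "\<And>r c. r < d \<Longrightarrow> c < d \<Longrightarrow> integrable M (\<lambda>\<omega>. Z \<omega> $$ (r, c))"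
  shows "integrable M (\<lambda>\<omega>. lin_fun d \<kappa> (Z \<omega>))"
    and "(\<integral>\<omega>. lin_fun d \<kappa> (Z \<omega>) \<partial>M) = lin_fun d \<kappa> (mat d d (\<lambda>rc. \<integral>\<omega>. Z \<omega> $$ rc \<partial>M))"
proof -
  have 1: "integrable M (\<lambda>\<omega>. \<Sum>r<d. \<Sum>c<d. \<kappa> r c * Z \<omega> $$ (r, c))"
    by (intro Bochner_Integration.integrable_sum Bochner_Integration.integrable_mult_right) (use assms in auto)
  then show "integrable M (\<lambda>\<omega>. lin_fun d \<kappa> (Z \<omega>))"
    unfolding lin_fun_def by (rule integrable_Re)
  have "(\<integral>\<omega>. lin_fun d \<kappa> (Z \<omega>) \<partial>M) = Re (\<integral>\<omega>. (\<Sum>r<d. \<Sum>c<d. \<kappa> r c * Z \<omega> $$ (r, c)) \<partial>M)"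
    unfolding lin_fun_def by (rule integral_Re[OF 1])
  also have "(\<integral>\<omega>. (\<Sum>r<d. \<Sum>c<d. \<kappa> r c * Z \<omega> $$ (r, c)) \<partial>M) = (\<Sum>r<d. \<Sum>c<d. \<kappa> r c * (\<integral>\<omega>. Z \<omega> $$ (r, c) \<partial>M))"
  proof -
    have "(\<integral>\<omega>. (\<Sum>r<d. \<Sum>c<d. \<kappa> r c * Z \<omega> $$ (r, c)) \<partial>M) = (\<Sum>r<d. \<integral>\<omega>. (\<Sum>c<d. \<kappa> r c * Z \<omega> $$ (r, c)) \<partial>M)"
      by (intro Bochner_Integration.integral_sum Bochner_Integration.integrable_sum Bochner_Integration.integrable_mult_right) (use assms in auto)
    also have "\<dots> = (\<Sum>r<d. \<Sum>c<d. \<integral>\<omega>. \<kappa> r c * Z \<omega> $$ (r, c) \<partial>M)"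
      by (intro sum.cong refl Bochner_Integration.integral_sum Bochner_Integration.integrable_mult_right) (use assms in auto)
    finally show ?thesis by simp
  qed
  finally show "(\<integral>\<omega>. lin_fun d \<kappa> (Z \<omega>) \<partial>M) = lin_fun d \<kappa> (mat d d (\<lambda>rc. \<integral>\<omega>. Z \<omega> $$ rc \<partial>M))"
    by (simp add: lin_fun_def)
qed

text \<open>Convexity of the power function. It is used on the open half-line, where the derivative
  exists, so t = 0 is treated by hand.\<close>

lemma powr_tangent:
  fixes p c t :: real
  assumes p: "p \<ge> 1" and c: "c > 0" and t: "t \<ge> 0"
  shows "c powr p + p * c powr (p - 1) * (t - c) \<le> t powr p"
proof (cases "t = 0")
  case True
  have "c powr p = c powr (p - 1) * c" using c by (simp add: powr_diff)
  then have "c powr p + p * c powr (p - 1) * (t - c) = c powr p * (1 - p)"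
    using True by (simp add: algebra_simps)
  also have "\<dots> \<le> 0" using p by (simp add: mult_nonneg_nonpos)
  finally show ?thesis using True by simp
next
  case False
  then have t: "t > 0" using t by simp
  have "p * c powr (p - 1) * (t - c) \<le> t powr p - c powr p"
    by (rule convex_on_imp_above_tangent[where A = "{0<..}" and f' = "p * c powr (p - 1)", OF powr_convex[OF p]])
      (use c t in \<open>auto intro!: derivative_eq_intros simp: interior_open\<close>)
  then show ?thesis by simp
qed

text \<open>Both nonlinear ingredients are linearised: the norm is replaced by a supporting
  functional, the power by its tangent at c, and what is left is linearity of the expectation.
  Supporting functionals are available only for c below the norm of the mean, so the bound passes to
  the limit at the end. The right-hand side may be infinite, whence the extended integral.\<close>

lemma supported_norm_jensen:
  assumes "prob_space M" and \<nu>: "supported_norm d \<nu>" and p: "p \<ge> 1"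
    and Z: "\<And>\<omega>. \<omega> \<in> space M \<Longrightarrow> Z \<omega> \<in> carrier_mat d d"
    and int: "\<And>r c. r < d \<Longrightarrow> c < d \<Longrightarrow> integrable M (\<lambda>\<omega>. Z \<omega> $$ (r, c))"
  shows "ennreal (\<nu> (mat d d (\<lambda>rc. \<integral>\<omega>. Z \<omega> $$ rc \<partial>M)) powr p) \<le> (\<integral>\<^sup>+\<omega>. ennreal (\<nu> (Z \<omega>) powr p) \<partial>M)"
proof -
  interpret prob_space M by fact
  define E where "E = mat d d (\<lambda>rc. \<integral>\<omega>. Z \<omega> $$ rc \<partial>M)"
  have E: "E \<in> carrier_mat d d" by (simp add: E_def)
  have main: "ennreal (c powr p) \<le> (\<integral>\<^sup>+\<omega>. ennreal (\<nu> (Z \<omega>) powr p) \<partial>M)" if c: "0 < c" "c < \<nu> E" for c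
  proof -
    from supported_normD(2)[OF \<nu> E c(2)] obtain \<kappa> where \<kappa>:
      "c < lin_fun d \<kappa> E" "\<And>Z. Z \<in> carrier_mat d d \<Longrightarrow> lin_fun d \<kappa> Z \<le> \<nu> Z" by blast
    define h where "h = (\<lambda>\<omega>. c powr p + p * c powr (p - 1) * (lin_fun d \<kappa> (Z \<omega>) - c))"
    have h: "integrable M h" unfolding h_def using integral_lin_fun(1)[where Z = Z and \<kappa> = \<kappa>, OF int]
      by (intro Bochner_Integration.integrable_add integrable_mult_right Bochner_Integration.integrable_diff) auto
    have "(\<integral>\<omega>. h \<omega> \<partial>M) = c powr p + p * c powr (p - 1) * (lin_fun d \<kappa> E - c)"
      unfolding h_def E_def using integral_lin_fun[where Z = Z and \<kappa> = \<kappa>, OF int] by (simp add: prob_space)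
    then have "c powr p \<le> (\<integral>\<omega>. h \<omega> \<partial>M)" using \<kappa>(1) p by simp
    \<comment> \<open>The tangent can be negative, whereas the extended integral sees nonnegative
      values only.\<close>
    also have "\<dots> \<le> (\<integral>\<omega>. max 0 (h \<omega>) \<partial>M)" using h by (intro integral_mono) auto
    finally have "ennreal (c powr p) \<le> ennreal (\<integral>\<omega>. max 0 (h \<omega>) \<partial>M)" by (rule ennreal_leI)
    also have "\<dots> = (\<integral>\<^sup>+\<omega>. ennreal (max 0 (h \<omega>)) \<partial>M)"
      using h by (intro nn_integral_eq_integral[symmetric]) auto
    also have "\<dots> \<le> (\<integral>\<^sup>+\<omega>. ennreal (\<nu> (Z \<omega>) powr p) \<partial>M)"
    proof (intro nn_integral_mono ennreal_leI)
      fix \<omega> assume \<omega>: "\<omega> \<in> space M"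
      have n: "0 \<le> \<nu> (Z \<omega>)" using supported_normD(1)[OF \<nu> Z[OF \<omega>]] .
      have "h \<omega> \<le> c powr p + p * c powr (p - 1) * (\<nu> (Z \<omega>) - c)"
        unfolding h_def using \<kappa>(2)[OF Z[OF \<omega>]] p by (intro add_mono mult_left_mono) auto
      also have "\<dots> \<le> \<nu> (Z \<omega>) powr p" by (rule powr_tangent[OF p c(1) n])
      finally show "max 0 (h \<omega>) \<le> \<nu> (Z \<omega>) powr p" by simp
    qed
    finally show ?thesis .
  qed
  have "ennreal (\<nu> E powr p) \<le> (\<integral>\<^sup>+\<omega>. ennreal (\<nu> (Z \<omega>) powr p) \<partial>M)"
  proof (cases "\<nu> E = 0")
    case False
    then have pos: "\<nu> E > 0" using supported_normD(1)[OF \<nu> E] by simp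
    have "((\<lambda>c. ennreal (c powr p)) \<longlongrightarrow> ennreal (\<nu> E powr p)) (at_left (\<nu> E))"
      using pos by (intro tendsto_intros) auto
    moreover have "\<forall>\<^sub>F c in at_left (\<nu> E). ennreal (c powr p) \<le> (\<integral>\<^sup>+\<omega>. ennreal (\<nu> (Z \<omega>) powr p) \<partial>M)"
      using eventually_at_left_real[OF pos] by eventually_elim (use main in auto)
    ultimately show ?thesis
      by (rule tendsto_upperbound) simp
  qed simp
  then show ?thesis by (simp only: E_def)
qed

text \<open>A supremum of continuous functionals is lower semicontinuous: the set where the norm
  exceeds c is a union of open half-spaces. The union may be uncountable, so the argument goes
  through openness rather than through countable suprema.\<close>

lemma borel_measurable_supported_norm:
  assumes \<nu>: "supported_norm d \<nu>"
    and Z: "\<And>\<omega>. \<omega> \<in> space M \<Longrightarrow> Z \<omega> \<in> carrier_mat d d"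
    and meas: "\<And>r c. r < d \<Longrightarrow> c < d \<Longrightarrow> (\<lambda>\<omega>. Z \<omega> $$ (r, c)) \<in> borel_measurable M"
  shows "(\<lambda>\<omega>. \<nu> (Z \<omega>)) \<in> borel_measurable M"
proof -
  \<comment> \<open>The norm is transported to all functions on pairs of naturals, whose product
    topology supplies open sets and Borel maps; entries outside the d by d window are discarded by
    \<open>mat\<close>.\<close>
  define \<phi> where "\<phi> = (\<lambda>f :: nat \<times> nat \<Rightarrow> complex. \<nu> (mat d d f))"
  have "\<phi> \<in> borel_measurable borel"
  proof (rule borel_measurableI_greater)
    fix c
    have "{f. c < \<phi> f} = (\<Union>\<kappa>\<in>{\<kappa>. \<forall>Z\<in>carrier_mat d d. lin_fun d \<kappa> Z \<le> \<nu> Z}. {f. c < lin_fun d \<kappa> (mat d d f)})" (is "_ = ?R")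
    proof (intro equalityI subsetI)
      fix f assume "f \<in> {f. c < \<phi> f}"
      then show "f \<in> ?R" using supported_normD(2)[OF \<nu>, of "mat d d f" c] by (auto simp: \<phi>_def)
    next
      fix f assume "f \<in> ?R"
      then show "f \<in> {f. c < \<phi> f}" by (auto simp: \<phi>_def intro: less_le_trans)
    qed
    moreover have "open {f. c < lin_fun d \<kappa> (mat d d f)}" for \<kappa>
      unfolding lin_fun_def
      by (intro open_Collect_less continuous_intros) (auto intro!: continuous_on_cong[THEN iffD1, OF refl _ continuous_on_const] sum.cong continuous_intros)
    ultimately have "open {f. c < \<phi> f}" by (auto intro!: open_UN)
    then show "{f \<in> space borel. c < \<phi> f} \<in> sets borel" by simp
  qed
  moreover have "(\<lambda>\<omega>. \<lambda>rc. if fst rc < d \<and> snd rc < d then Z \<omega> $$ rc else 0) \<in> borel_measurable M"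
  proof (rule measurable_coordinatewise_then_product)
    fix rc :: "nat \<times> nat"
    show "(\<lambda>\<omega>. if fst rc < d \<and> snd rc < d then Z \<omega> $$ rc else 0) \<in> borel_measurable M"
      using meas[of "fst rc" "snd rc"] by (cases "fst rc < d \<and> snd rc < d") auto
  qed
  ultimately have "(\<lambda>\<omega>. \<phi> (\<lambda>rc. if fst rc < d \<and> snd rc < d then Z \<omega> $$ rc else 0)) \<in> borel_measurable M"
    by (rule measurable_compose[rotated])
  moreover have "\<phi> (\<lambda>rc. if fst rc < d \<and> snd rc < d then Z \<omega> $$ rc else 0) = \<nu> (Z \<omega>)" if "\<omega> \<in> space M" for \<omega>
    unfolding \<phi>_def by (rule arg_cong[of _ _ \<nu>], rule eq_matI) (use Z[OF that] in auto)
  ultimately show ?thesis by (subst (asm) measurable_cong) auto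
qed

section \<open>Invariance of the Gaussian law\<close>

lemma measure_preserving_nn_integral:
  assumes "T \<in> measurable M M" "distr M M T = M" "f \<in> borel_measurable M"
  shows "(\<integral>\<^sup>+x. f (T x) \<partial>M) = (\<integral>\<^sup>+x. f x \<partial>M)"
  using nn_integral_distr[OF assms(1), of f] assms by simp

lemma measure_preservingI:
  assumes "T \<in> measurable M M"
    and "\<And>f. f \<in> borel_measurable M \<Longrightarrow> (\<integral>\<^sup>+x. f (T x) \<partial>M) = (\<integral>\<^sup>+x. f x \<partial>M)"
  shows "distr M M T = M"
proof (rule measure_eqI)
  fix A assume "A \<in> sets (distr M M T)"
  then have A: "A \<in> sets M" by simp
  have "emeasure (distr M M T) A = (\<integral>\<^sup>+x. indicator A x \<partial>distr M M T)" using A by simp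
  also have "\<dots> = (\<integral>\<^sup>+x. indicator A (T x) \<partial>M)" using A assms(1) by (intro nn_integral_distr) auto
  also have "\<dots> = (\<integral>\<^sup>+x. indicator A x \<partial>M)" using A by (intro assms(2)) auto
  finally show "emeasure (distr M M T) A = emeasure M A" using A by simp
qed simp

lemma distr_comp_preserving:
  assumes "T \<in> measurable M M" "distr M M T = M" "S \<in> measurable M M" "distr M M S = M"
  shows "distr M M (\<lambda>x. S (T x)) = M"
  using distr_distr[OF assms(3,1)] assms by (simp add: comp_def)

lemma distr_PiM_componentwise:
  assumes I: "finite I" and M: "prob_space M" and f: "\<And>i. i \<in> I \<Longrightarrow> f i \<in> measurable M M"
    and inv: "\<And>i. i \<in> I \<Longrightarrow> distr M M (f i) = M"
  shows "distr (PiM I (\<lambda>_. M)) (PiM I (\<lambda>_. M)) (\<lambda>x. \<lambda>i\<in>I. f i (x i)) = PiM I (\<lambda>_. M)"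
proof -
  interpret prob_space M by fact
  interpret product_prob_space "\<lambda>_. M" I by unfold_locales
  have T: "(\<lambda>x. \<lambda>i\<in>I. f i (x i)) \<in> measurable (PiM I (\<lambda>_. M)) (PiM I (\<lambda>_. M))"
  proof (rule measurable_restrict)
    fix i assume i: "i \<in> I"
    show "(\<lambda>x. f i (x i)) \<in> measurable (PiM I (\<lambda>_. M)) M"
      using measurable_compose[OF measurable_component_singleton[OF i] f[OF i]] .
  qed
  show ?thesis
  proof (rule PiM_eqI[OF I])
    fix A assume A: "\<And>i. i \<in> I \<Longrightarrow> A i \<in> sets M"
    have "(\<lambda>x. \<lambda>i\<in>I. f i (x i)) -` Pi\<^sub>E I A \<inter> space (PiM I (\<lambda>_. M)) = Pi\<^sub>E I (\<lambda>i. f i -` A i \<inter> space M)"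
      by (auto simp: space_PiM PiE_iff restrict_def)
    then have "emeasure (distr (PiM I (\<lambda>_. M)) (PiM I (\<lambda>_. M)) (\<lambda>x. \<lambda>i\<in>I. f i (x i))) (Pi\<^sub>E I A)
       = emeasure (PiM I (\<lambda>_. M)) (Pi\<^sub>E I (\<lambda>i. f i -` A i \<inter> space M))"
      using A I by (subst emeasure_distr[OF T]) (auto intro!: sets_PiM_I_finite)
    also have "\<dots> = (\<Prod>i\<in>I. emeasure M (f i -` A i \<inter> space M))"
      using A f I by (intro emeasure_PiM) (auto intro!: measurable_sets)
    also have "\<dots> = (\<Prod>i\<in>I. emeasure M (A i))"
    proof (rule prod.cong[OF refl])
      fix i assume i: "i \<in> I"
      show "emeasure M (f i -` A i \<inter> space M) = emeasure M (A i)"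
        using emeasure_distr[OF f[OF i], of "A i"] A[OF i] inv[OF i] by simp
    qed
    finally show "emeasure (distr (PiM I (\<lambda>_. M)) (PiM I (\<lambda>_. M)) (\<lambda>x. \<lambda>i\<in>I. f i (x i))) (Pi\<^sub>E I A)
       = (\<Prod>i\<in>I. emeasure M (A i))" .
  qed simp
qed

section \<open>Rotation invariance of pairs of Gaussian variables\<close>

abbreviation "std_normal \<equiv> std_normal_distribution"

lemma prob_space_std_normal: "prob_space std_normal"
  by (simp add: prob_space_normal_density)

text \<open>For fixed x the shear translates y, and Lebesgue measure is translation
  invariant.\<close>

lemma nn_integral_shear:
  fixes h :: "real \<Rightarrow> real \<Rightarrow> ennreal"
  assumes h: "(\<lambda>(x, y). h x y) \<in> borel_measurable (borel \<Otimes>\<^sub>M borel)"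
  shows "(\<integral>\<^sup>+x. \<integral>\<^sup>+y. h x (y + t * x) \<partial>lborel \<partial>lborel) = (\<integral>\<^sup>+x. \<integral>\<^sup>+y. h x y \<partial>lborel \<partial>lborel)"
proof (rule nn_integral_cong)
  fix x
  have "(\<lambda>y. h x y) \<in> borel_measurable borel"
    using measurable_compose[OF measurable_Pair1' h, of x] by simp
  from nn_integral_real_affine[OF this, of 1 "t * x"]
  show "(\<integral>\<^sup>+y. h x (y + t * x) \<partial>lborel) = (\<integral>\<^sup>+y. h x y \<partial>lborel)"
    by (simp add: add.commute)
qed

lemma nn_integral_shear':
  fixes h :: "real \<Rightarrow> real \<Rightarrow> ennreal"
  assumes h[measurable]: "(\<lambda>(x, y). h x y) \<in> borel_measurable (borel \<Otimes>\<^sub>M borel)"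
  shows "(\<integral>\<^sup>+x. \<integral>\<^sup>+y. h (x + t * y) y \<partial>lborel \<partial>lborel) = (\<integral>\<^sup>+x. \<integral>\<^sup>+y. h x y \<partial>lborel \<partial>lborel)"
proof -
  have h': "(\<lambda>(y, x). h x y) \<in> borel_measurable (borel \<Otimes>\<^sub>M borel)" by measurable
  have "(\<integral>\<^sup>+x. \<integral>\<^sup>+y. h (x + t * y) y \<partial>lborel \<partial>lborel) = (\<integral>\<^sup>+y. \<integral>\<^sup>+x. h (x + t * y) y \<partial>lborel \<partial>lborel)"
    by (rule lborel_pair.Fubini'[symmetric]) measurable
  also have "\<dots> = (\<integral>\<^sup>+y. \<integral>\<^sup>+x. h x y \<partial>lborel \<partial>lborel)"
    by (rule nn_integral_shear[OF h'])
  also have "\<dots> = (\<integral>\<^sup>+x. \<integral>\<^sup>+y. h x y \<partial>lborel \<partial>lborel)"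
    by (rule lborel_pair.Fubini') measurable
  finally show ?thesis .
qed

text \<open>A rotation is a product of three shears.\<close>

lemma nn_integral_rotate_lborel:
  fixes h :: "real \<Rightarrow> real \<Rightarrow> ennreal"
  assumes h[measurable]: "(\<lambda>(x, y). h x y) \<in> borel_measurable (borel \<Otimes>\<^sub>M borel)"
    and cs: "c\<^sup>2 + s\<^sup>2 = 1" and c: "c \<noteq> -1"
  shows "(\<integral>\<^sup>+x. \<integral>\<^sup>+y. h (c * x + s * y) (c * y - s * x) \<partial>lborel \<partial>lborel) = (\<integral>\<^sup>+x. \<integral>\<^sup>+y. h x y \<partial>lborel \<partial>lborel)"
proof -
  \<comment> \<open>The tangent of half the angle: the rotation is the product of the shears with
    parameters t, -s and t. For c = -1 the half angle is a right angle and its tangent does not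
    exist.\<close>
  define t where "t = s / (1 + c)"
  have c1: "1 + c \<noteq> 0" using c by auto
  have st: "1 - s * t = c"
    using c1 cs by (simp add: t_def field_simps power2_eq_square)
  have tc: "t * (1 + c) = s" using c1 by (simp add: t_def)
  define F where "F = (\<lambda>x y. h (x + t * y) y)"
  define G where "G = (\<lambda>x y. F x (y + (- s) * x))"
  have F[measurable]: "(\<lambda>(x, y). F x y) \<in> borel_measurable (borel \<Otimes>\<^sub>M borel)"
    unfolding F_def by measurable
  have G[measurable]: "(\<lambda>(x, y). G x y) \<in> borel_measurable (borel \<Otimes>\<^sub>M borel)"
    unfolding G_def by measurable
  have "h (c * x + s * y) (c * y - s * x) = G (x + t * y) y" for x y
  proof -
    have "y + (- s) * (x + t * y) = (1 - s * t) * y - s * x" by (simp add: algebra_simps)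
    also have "\<dots> = c * y - s * x" by (simp add: st)
    finally have 1: "y + (- s) * (x + t * y) = c * y - s * x" .
    have "x + t * y + t * (c * y - s * x) = (1 - s * t) * x + (t * (1 + c)) * y" by (simp add: algebra_simps)
    also have "\<dots> = c * x + s * y" by (simp only: st tc)
    finally show ?thesis unfolding G_def F_def 1 by simp
  qed
  then have "(\<integral>\<^sup>+x. \<integral>\<^sup>+y. h (c * x + s * y) (c * y - s * x) \<partial>lborel \<partial>lborel)
     = (\<integral>\<^sup>+x. \<integral>\<^sup>+y. G (x + t * y) y \<partial>lborel \<partial>lborel)" by simp
  also have "\<dots> = (\<integral>\<^sup>+x. \<integral>\<^sup>+y. G x y \<partial>lborel \<partial>lborel)" by (rule nn_integral_shear'[OF G])
  also have "\<dots> = (\<integral>\<^sup>+x. \<integral>\<^sup>+y. F x y \<partial>lborel \<partial>lborel)" unfolding G_def by (rule nn_integral_shear[OF F])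
  also have "\<dots> = (\<integral>\<^sup>+x. \<integral>\<^sup>+y. h x y \<partial>lborel \<partial>lborel)" unfolding F_def by (rule nn_integral_shear'[OF h])
  finally show ?thesis .
qed

text \<open>The joint density is a function of x^2 + y^2 alone, which is what makes the law of the
  pair rotation invariant.\<close>

lemma nn_integral_std_normal_pair:
  fixes h :: "real \<Rightarrow> real \<Rightarrow> ennreal"
  assumes h[measurable]: "(\<lambda>(x, y). h x y) \<in> borel_measurable (borel \<Otimes>\<^sub>M borel)"
  shows "(\<integral>\<^sup>+x. \<integral>\<^sup>+y. h x y \<partial>std_normal \<partial>std_normal) = (\<integral>\<^sup>+x. \<integral>\<^sup>+y. ennreal (exp (- (x\<^sup>2 + y\<^sup>2) / 2) / (2 * pi)) * h x y \<partial>lborel \<partial>lborel)"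
proof -
  have "(\<integral>\<^sup>+x. \<integral>\<^sup>+y. h x y \<partial>std_normal \<partial>std_normal) = (\<integral>\<^sup>+x. ennreal (std_normal_density x) * (\<integral>\<^sup>+y. ennreal (std_normal_density y) * h x y \<partial>lborel) \<partial>lborel)"
    by (simp add: nn_integral_density)
  also have "\<dots> = (\<integral>\<^sup>+x. \<integral>\<^sup>+y. ennreal (exp (- (x\<^sup>2 + y\<^sup>2) / 2) / (2 * pi)) * h x y \<partial>lborel \<partial>lborel)"
  proof (rule nn_integral_cong)
    fix x
    have "ennreal (std_normal_density x) * (\<integral>\<^sup>+y. ennreal (std_normal_density y) * h x y \<partial>lborel)
       = (\<integral>\<^sup>+y. ennreal (std_normal_density x) * (ennreal (std_normal_density y) * h x y) \<partial>lborel)"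
      by (rule nn_integral_cmult[symmetric]) measurable
    also have "\<dots> = (\<integral>\<^sup>+y. ennreal (exp (- (x\<^sup>2 + y\<^sup>2) / 2) / (2 * pi)) * h x y \<partial>lborel)"
    proof (rule nn_integral_cong)
      fix y
      have "std_normal_density x * std_normal_density y = exp (- (x\<^sup>2 + y\<^sup>2) / 2) / (2 * pi)"
        by (simp add: std_normal_density_def add_divide_distrib flip: exp_add)
      then show "ennreal (std_normal_density x) * (ennreal (std_normal_density y) * h x y) = ennreal (exp (- (x\<^sup>2 + y\<^sup>2) / 2) / (2 * pi)) * h x y"
        by (simp flip: mult.assoc ennreal_mult')
    qed
    finally show "ennreal (std_normal_density x) * (\<integral>\<^sup>+y. ennreal (std_normal_density y) * h x y \<partial>lborel)
      = (\<integral>\<^sup>+y. ennreal (exp (- (x\<^sup>2 + y\<^sup>2) / 2) / (2 * pi)) * h x y \<partial>lborel)" .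
  qed
  finally show ?thesis .
qed

lemma nn_integral_rotate_std_normal:
  fixes h :: "real \<Rightarrow> real \<Rightarrow> ennreal"
  assumes h[measurable]: "(\<lambda>(x, y). h x y) \<in> borel_measurable (borel \<Otimes>\<^sub>M borel)"
    and cs: "c\<^sup>2 + s\<^sup>2 = 1"
  shows "(\<integral>\<^sup>+x. \<integral>\<^sup>+y. h (c * x + s * y) (c * y - s * x) \<partial>std_normal \<partial>std_normal) = (\<integral>\<^sup>+x. \<integral>\<^sup>+y. h x y \<partial>std_normal \<partial>std_normal)"
proof -
  have main: "(\<integral>\<^sup>+x. \<integral>\<^sup>+y. h (c * x + s * y) (c * y - s * x) \<partial>std_normal \<partial>std_normal) = (\<integral>\<^sup>+x. \<integral>\<^sup>+y. h x y \<partial>std_normal \<partial>std_normal)"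
    if [measurable]: "(\<lambda>(x, y). h x y) \<in> borel_measurable (borel \<Otimes>\<^sub>M borel)" and cs: "c\<^sup>2 + s\<^sup>2 = 1" and c: "c \<noteq> -1"
    for h :: "real \<Rightarrow> real \<Rightarrow> ennreal" and c s :: real
  proof -
    define k where "k = (\<lambda>x y. ennreal (exp (- (x\<^sup>2 + y\<^sup>2) / 2) / (2 * pi)) * h x y)"
    have k: "(\<lambda>(x, y). k x y) \<in> borel_measurable (borel \<Otimes>\<^sub>M borel)"
      unfolding k_def by measurable
    have "(c * x + s * y)\<^sup>2 + (c * y - s * x)\<^sup>2 = (c\<^sup>2 + s\<^sup>2) * (x\<^sup>2 + y\<^sup>2)" for x y
      by (simp add: power2_eq_square algebra_simps)
    then have rot: "(c * x + s * y)\<^sup>2 + (c * y - s * x)\<^sup>2 = x\<^sup>2 + y\<^sup>2" for x y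
      using cs by simp
    have "(\<integral>\<^sup>+x. \<integral>\<^sup>+y. h (c * x + s * y) (c * y - s * x) \<partial>std_normal \<partial>std_normal)
        = (\<integral>\<^sup>+x. \<integral>\<^sup>+y. k (c * x + s * y) (c * y - s * x) \<partial>lborel \<partial>lborel)"
      unfolding k_def rot by (rule nn_integral_std_normal_pair) measurable
    also have "\<dots> = (\<integral>\<^sup>+x. \<integral>\<^sup>+y. k x y \<partial>lborel \<partial>lborel)"
      by (rule nn_integral_rotate_lborel[OF k cs c])
    also have "\<dots> = (\<integral>\<^sup>+x. \<integral>\<^sup>+y. h x y \<partial>std_normal \<partial>std_normal)"
      unfolding k_def by (rule nn_integral_std_normal_pair[symmetric]) measurable
    finally show ?thesis .
  qed
  show ?thesis
  proof (cases "c = -1")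
    case False then show ?thesis using main[OF h cs] by blast
  next
    case True
    \<comment> \<open>The half turn, excluded from the shear decomposition, is a quarter turn taken
      twice.\<close>
    then have s: "s = 0" using cs by simp
    have "(\<integral>\<^sup>+x. \<integral>\<^sup>+y. h (- x) (- y) \<partial>std_normal \<partial>std_normal) = (\<integral>\<^sup>+x. \<integral>\<^sup>+y. h (- y) x \<partial>std_normal \<partial>std_normal)"
      using main[of "\<lambda>x y. h (- x) (- y)" 0 1] by simp
    also have "\<dots> = (\<integral>\<^sup>+x. \<integral>\<^sup>+y. h x y \<partial>std_normal \<partial>std_normal)"
      using main[of "\<lambda>x y. h (- y) x" 0 1] by simp
    finally show ?thesis using True s by simp
  qed
qed

text \<open>Not normalised: real and imaginary part have variance one each, so the mean of |z|^2 is
  2. The factor 1 / sqrt (2 N) comes in with \<open>mat_of_gauss\<close>.\<close>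

definition cgauss :: "complex measure" where
  "cgauss = distr (std_normal \<Otimes>\<^sub>M std_normal) borel (\<lambda>(x, y). Complex x y)"

lemma measurable_Complex [measurable]:
  assumes "f \<in> borel_measurable M" "g \<in> borel_measurable M"
  shows "(\<lambda>x. Complex (f x) (g x)) \<in> borel_measurable M"
proof -
  have "(\<lambda>x. complex_of_real (f x) + \<i> * complex_of_real (g x)) \<in> borel_measurable M"
    using assms by measurable
  then show ?thesis by (simp add: Complex_eq)
qed

lemma sets_cgauss [simp, measurable_cong]: "sets cgauss = sets borel"
  by (simp add: cgauss_def)

lemma space_cgauss [simp]: "space cgauss = UNIV"
  by (simp add: cgauss_def)

lemma prob_space_cgauss: "prob_space cgauss"
proof -
  interpret std: prob_space std_normal by (rule prob_space_std_normal)
  interpret pair_prob_space std_normal std_normal ..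
  show ?thesis unfolding cgauss_def by (rule prob_space_distr) measurable
qed

lemma nn_integral_cgauss:
  assumes [measurable]: "f \<in> borel_measurable borel"
  shows "(\<integral>\<^sup>+z. f z \<partial>cgauss) = (\<integral>\<^sup>+x. \<integral>\<^sup>+y. f (Complex x y) \<partial>std_normal \<partial>std_normal)"
proof -
  interpret std: prob_space std_normal by (rule prob_space_std_normal)
  have "(\<integral>\<^sup>+z. f z \<partial>cgauss) = (\<integral>\<^sup>+(x, y). f (Complex x y) \<partial>(std_normal \<Otimes>\<^sub>M std_normal))"
    unfolding cgauss_def by (subst nn_integral_distr) (auto simp: case_prod_unfold)
  also have "\<dots> = (\<integral>\<^sup>+x. \<integral>\<^sup>+y. f (Complex x y) \<partial>std_normal \<partial>std_normal)"
    by (subst std.nn_integral_fst[symmetric]) (auto simp: case_prod_unfold)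
  finally show ?thesis .
qed

lemma cgauss_phase:
  assumes u: "cmod u = 1"
  shows "distr cgauss cgauss (\<lambda>z. u * z) = cgauss"
proof (rule measure_preservingI)
  fix f :: "complex \<Rightarrow> ennreal" assume "f \<in> borel_measurable cgauss"
  then have [measurable]: "f \<in> borel_measurable borel" by (simp cong: measurable_cong_sets)
  have cs: "(Re u)\<^sup>2 + (- Im u)\<^sup>2 = 1" using u by (simp add: cmod_def)
  have "(\<integral>\<^sup>+z. f (u * z) \<partial>cgauss) = (\<integral>\<^sup>+x. \<integral>\<^sup>+y. f (Complex (Re u * x + (- Im u) * y) (Re u * y - (- Im u) * x)) \<partial>std_normal \<partial>std_normal)"
    by (subst nn_integral_cgauss) (auto intro!: nn_integral_cong arg_cong[of _ _ f] simp: complex_eq_iff)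
  also have "\<dots> = (\<integral>\<^sup>+x. \<integral>\<^sup>+y. f (Complex x y) \<partial>std_normal \<partial>std_normal)"
    by (rule nn_integral_rotate_std_normal[OF _ cs, of "\<lambda>x y. f (Complex x y)"]) measurable
  also have "\<dots> = (\<integral>\<^sup>+z. f z \<partial>cgauss)" by (rule nn_integral_cgauss[symmetric]) measurable
  finally show "(\<integral>\<^sup>+z. f (u * z) \<partial>cgauss) = (\<integral>\<^sup>+z. f z \<partial>cgauss)" .
qed measurable

text \<open>A rotation with real coefficients acts on the two real parts and on the two imaginary
  parts separately. Fubini brings each of these pairs together, and the planar statement applies to
  each.\<close>

lemma nn_integral_rotate_cgauss:
  fixes f :: "complex \<Rightarrow> complex \<Rightarrow> ennreal"
  assumes f[measurable]: "(\<lambda>(x, y). f x y) \<in> borel_measurable (borel \<Otimes>\<^sub>M borel)" and cs: "c\<^sup>2 + s\<^sup>2 = 1"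
  shows "(\<integral>\<^sup>+z. \<integral>\<^sup>+w. f (of_real c * z + of_real s * w) (of_real c * w - of_real s * z) \<partial>cgauss \<partial>cgauss)
       = (\<integral>\<^sup>+z. \<integral>\<^sup>+w. f z w \<partial>cgauss \<partial>cgauss)"
proof -
  interpret std: prob_space std_normal by (rule prob_space_std_normal)
  interpret pp: pair_prob_space std_normal std_normal ..
  interpret cg: prob_space cgauss by (rule prob_space_cgauss)
  have exp: "(\<integral>\<^sup>+z. \<integral>\<^sup>+w. g z w \<partial>cgauss \<partial>cgauss) = (\<integral>\<^sup>+x. \<integral>\<^sup>+x'. \<integral>\<^sup>+y. \<integral>\<^sup>+y'. g (Complex x y) (Complex x' y') \<partial>std_normal \<partial>std_normal \<partial>std_normal \<partial>std_normal)"
    if [measurable]: "(\<lambda>(x, y). g x y) \<in> borel_measurable (borel \<Otimes>\<^sub>M borel)" for g :: "complex \<Rightarrow> complex \<Rightarrow> ennreal"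
  proof -
    have "(\<integral>\<^sup>+z. \<integral>\<^sup>+w. g z w \<partial>cgauss \<partial>cgauss) = (\<integral>\<^sup>+x. \<integral>\<^sup>+y. \<integral>\<^sup>+w. g (Complex x y) w \<partial>cgauss \<partial>std_normal \<partial>std_normal)"
      by (rule nn_integral_cgauss) measurable
    also have "\<dots> = (\<integral>\<^sup>+x. \<integral>\<^sup>+y. \<integral>\<^sup>+x'. \<integral>\<^sup>+y'. g (Complex x y) (Complex x' y') \<partial>std_normal \<partial>std_normal \<partial>std_normal \<partial>std_normal)"
      by (intro nn_integral_cong nn_integral_cgauss) measurable
    also have "\<dots> = (\<integral>\<^sup>+x. \<integral>\<^sup>+x'. \<integral>\<^sup>+y. \<integral>\<^sup>+y'. g (Complex x y) (Complex x' y') \<partial>std_normal \<partial>std_normal \<partial>std_normal \<partial>std_normal)"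
      by (intro nn_integral_cong pp.Fubini') measurable
    finally show ?thesis .
  qed
  have re: "of_real c * Complex x y + of_real s * Complex x' y' = Complex (c * x + s * x') (c * y + s * y')"
     "of_real c * Complex x' y' - of_real s * Complex x y = Complex (c * x' - s * x) (c * y' - s * y)" for x y x' y'
    by (simp_all add: complex_eq_iff)
  have "(\<integral>\<^sup>+z. \<integral>\<^sup>+w. f (of_real c * z + of_real s * w) (of_real c * w - of_real s * z) \<partial>cgauss \<partial>cgauss)
     = (\<integral>\<^sup>+x. \<integral>\<^sup>+x'. \<integral>\<^sup>+y. \<integral>\<^sup>+y'. f (Complex (c * x + s * x') (c * y + s * y')) (Complex (c * x' - s * x) (c * y' - s * y)) \<partial>std_normal \<partial>std_normal \<partial>std_normal \<partial>std_normal)"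
    unfolding re[symmetric] by (rule exp) measurable
  also have "\<dots> = (\<integral>\<^sup>+x. \<integral>\<^sup>+x'. \<integral>\<^sup>+y. \<integral>\<^sup>+y'. f (Complex (c * x + s * x') y) (Complex (c * x' - s * x) y') \<partial>std_normal \<partial>std_normal \<partial>std_normal \<partial>std_normal)"
    by (intro nn_integral_cong nn_integral_rotate_std_normal[OF _ cs, where h = "\<lambda>y y'. f (Complex _ y) (Complex _ y')"]) measurable
  also have "\<dots> = (\<integral>\<^sup>+x. \<integral>\<^sup>+x'. \<integral>\<^sup>+y. \<integral>\<^sup>+y'. f (Complex x y) (Complex x' y') \<partial>std_normal \<partial>std_normal \<partial>std_normal \<partial>std_normal)"
    by (rule nn_integral_rotate_std_normal[OF _ cs, where h = "\<lambda>x x'. \<integral>\<^sup>+y. \<integral>\<^sup>+y'. f (Complex x y) (Complex x' y') \<partial>std_normal \<partial>std_normal"]) measurable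
  also have "\<dots> = (\<integral>\<^sup>+z. \<integral>\<^sup>+w. f z w \<partial>cgauss \<partial>cgauss)"
    by (rule exp[symmetric]) measurable
  finally show ?thesis .
qed

text \<open>Two independent families amount to one family of independent pairs. In the induction a
  coordinate is split off from both families, and Fubini moves the two new variables next to each
  other.\<close>

lemma PiM_pair_distr:
  fixes f :: "('i \<Rightarrow> 'a) \<Rightarrow> ('i \<Rightarrow> 'a) \<Rightarrow> ennreal"
  assumes I: "finite I" and M: "prob_space M"
    and f: "(\<lambda>(x, y). f x y) \<in> borel_measurable (PiM I (\<lambda>_. M) \<Otimes>\<^sub>M PiM I (\<lambda>_. M))"
  shows "(\<integral>\<^sup>+x. \<integral>\<^sup>+y. f x y \<partial>PiM I (\<lambda>_. M) \<partial>PiM I (\<lambda>_. M))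
     = (\<integral>\<^sup>+z. f (\<lambda>i\<in>I. fst (z i)) (\<lambda>i\<in>I. snd (z i)) \<partial>PiM I (\<lambda>_. M \<Otimes>\<^sub>M M))"
  using I f
proof (induction I arbitrary: f)
  case empty
  show ?case by (simp add: PiM_empty nn_integral_count_space_finite)
next
  case (insert i I)
  interpret M: prob_space M by fact
  interpret MM: pair_prob_space M M ..
  interpret P: product_prob_space "\<lambda>_. M" I by unfold_locales
  interpret P': product_prob_space "\<lambda>_. M" "insert i I" by unfold_locales
  interpret PP: product_prob_space "\<lambda>_. M \<Otimes>\<^sub>M M" I by unfold_locales
  interpret PM: pair_prob_space M "PiM I (\<lambda>_. M)" ..
  note [measurable] = insert.prems
  have up: "(\<lambda>(x, a). x(i := a)) \<in> measurable (PiM I (\<lambda>_. M) \<Otimes>\<^sub>M M) (PiM (insert i I) (\<lambda>_. M))"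
    by (rule measurable_add_dim)
  have up': "(\<lambda>\<omega>. (g \<omega>)(i := h \<omega>)) \<in> measurable N (PiM (insert i I) (\<lambda>_. M))"
    if "g \<in> measurable N (PiM I (\<lambda>_. M))" "h \<in> measurable N M" for g h and N :: "'n measure"
    using measurable_compose[OF measurable_Pair[OF that] up] by simp
  have m4: "(\<lambda>\<omega>. f ((g \<omega>)(i := a \<omega>)) ((h \<omega>)(i := b \<omega>))) \<in> borel_measurable N"
    if "g \<in> measurable N (PiM I (\<lambda>_. M))" "h \<in> measurable N (PiM I (\<lambda>_. M))" "a \<in> measurable N M" "b \<in> measurable N M"
    for g h a b and N :: "'n measure"
    using measurable_compose[OF measurable_Pair[OF up'[OF that(1,3)] up'[OF that(2,4)]] insert.prems] by simp
  have "(\<integral>\<^sup>+x. \<integral>\<^sup>+y. f x y \<partial>PiM (insert i I) (\<lambda>_. M) \<partial>PiM (insert i I) (\<lambda>_. M))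
     = (\<integral>\<^sup>+x. \<integral>\<^sup>+a. \<integral>\<^sup>+y. f (x(i := a)) y \<partial>PiM (insert i I) (\<lambda>_. M) \<partial>M \<partial>PiM I (\<lambda>_. M))"
    using insert.hyps by (intro P.product_nn_integral_insert) measurable
  also have "\<dots> = (\<integral>\<^sup>+x. \<integral>\<^sup>+a. \<integral>\<^sup>+y. \<integral>\<^sup>+b. f (x(i := a)) (y(i := b)) \<partial>M \<partial>PiM I (\<lambda>_. M) \<partial>M \<partial>PiM I (\<lambda>_. M))"
  proof (intro nn_integral_cong P.product_nn_integral_insert insert.hyps)
    fix x a assume "x \<in> space (PiM I (\<lambda>_. M))" "a \<in> space M"
    then have "x(i := a) \<in> space (PiM (insert i I) (\<lambda>_. M))"
      using measurable_space[OF up, of "(x, a)"] by (simp add: space_pair_measure)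
    then show "f (x(i := a)) \<in> borel_measurable (PiM (insert i I) (\<lambda>_. M))"
      using measurable_compose[OF measurable_Pair1' insert.prems] by simp
  qed
  also have "\<dots> = (\<integral>\<^sup>+x. \<integral>\<^sup>+y. \<integral>\<^sup>+a. \<integral>\<^sup>+b. f (x(i := a)) (y(i := b)) \<partial>M \<partial>M \<partial>PiM I (\<lambda>_. M) \<partial>PiM I (\<lambda>_. M))"
  proof (intro nn_integral_cong PM.Fubini'[symmetric])
    fix x assume [measurable]: "x \<in> space (PiM I (\<lambda>_. M))"
    show "(\<lambda>(a, y). \<integral>\<^sup>+b. f (x(i := a)) (y(i := b)) \<partial>M) \<in> borel_measurable (M \<Otimes>\<^sub>M PiM I (\<lambda>_. M))"
      unfolding case_prod_unfold by (rule M.borel_measurable_nn_integral) (unfold case_prod_unfold, rule m4; measurable)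
  qed
  also have "\<dots> = (\<integral>\<^sup>+z. \<integral>\<^sup>+a. \<integral>\<^sup>+b. f ((\<lambda>j\<in>I. fst (z j))(i := a)) ((\<lambda>j\<in>I. snd (z j))(i := b)) \<partial>M \<partial>M \<partial>PiM I (\<lambda>_. M \<Otimes>\<^sub>M M))"
  proof (rule insert.IH)
    show "(\<lambda>(x, y). \<integral>\<^sup>+a. \<integral>\<^sup>+b. f (x(i := a)) (y(i := b)) \<partial>M \<partial>M) \<in> borel_measurable (PiM I (\<lambda>_. M) \<Otimes>\<^sub>M PiM I (\<lambda>_. M))"
      unfolding case_prod_unfold
      by (rule M.borel_measurable_nn_integral, unfold case_prod_unfold, rule M.borel_measurable_nn_integral, unfold case_prod_unfold, rule m4; measurable)
  qed
  also have "\<dots> = (\<integral>\<^sup>+z. \<integral>\<^sup>+ab. f ((\<lambda>j\<in>I. fst (z j))(i := fst ab)) ((\<lambda>j\<in>I. snd (z j))(i := snd ab)) \<partial>(M \<Otimes>\<^sub>M M) \<partial>PiM I (\<lambda>_. M \<Otimes>\<^sub>M M))"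
  proof (rule nn_integral_cong)
    fix z assume z[measurable]: "z \<in> space (PiM I (\<lambda>_. M \<Otimes>\<^sub>M M))"
    have 1: "(\<lambda>j\<in>I. fst (z j)) \<in> space (PiM I (\<lambda>_. M))" "(\<lambda>j\<in>I. snd (z j)) \<in> space (PiM I (\<lambda>_. M))"
      using z by (auto simp: space_PiM PiE_iff space_pair_measure)
    have "(\<lambda>ab. f ((\<lambda>j\<in>I. fst (z j))(i := fst ab)) ((\<lambda>j\<in>I. snd (z j))(i := snd ab))) \<in> borel_measurable (M \<Otimes>\<^sub>M M)"
      by (rule m4) (use 1 in measurable)
    from M.nn_integral_fst[OF this, symmetric]
    show "(\<integral>\<^sup>+a. \<integral>\<^sup>+b. f ((\<lambda>j\<in>I. fst (z j))(i := a)) ((\<lambda>j\<in>I. snd (z j))(i := b)) \<partial>M \<partial>M)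
       = (\<integral>\<^sup>+ab. f ((\<lambda>j\<in>I. fst (z j))(i := fst ab)) ((\<lambda>j\<in>I. snd (z j))(i := snd ab)) \<partial>(M \<Otimes>\<^sub>M M))"
      by simp
  qed
  also have "\<dots> = (\<integral>\<^sup>+z. \<integral>\<^sup>+ab. f (\<lambda>j\<in>insert i I. fst ((z(i := ab)) j)) (\<lambda>j\<in>insert i I. snd ((z(i := ab)) j)) \<partial>(M \<Otimes>\<^sub>M M) \<partial>PiM I (\<lambda>_. M \<Otimes>\<^sub>M M))"
  proof (intro nn_integral_cong arg_cong2[where f = f])
    fix z ab
    show "(\<lambda>j\<in>I. fst (z j))(i := fst ab) = (\<lambda>j\<in>insert i I. fst ((z(i := ab)) j))"
      "(\<lambda>j\<in>I. snd (z j))(i := snd ab) = (\<lambda>j\<in>insert i I. snd ((z(i := ab)) j))"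
      using insert.hyps by (auto simp: fun_eq_iff restrict_def)
  qed
  also have "\<dots> = (\<integral>\<^sup>+z. f (\<lambda>j\<in>insert i I. fst (z j)) (\<lambda>j\<in>insert i I. snd (z j)) \<partial>PiM (insert i I) (\<lambda>_. M \<Otimes>\<^sub>M M))"
  proof (rule PP.product_nn_integral_insert[symmetric, OF insert.hyps])
    show "(\<lambda>z. f (\<lambda>j\<in>insert i I. fst (z j)) (\<lambda>j\<in>insert i I. snd (z j))) \<in> borel_measurable (PiM (insert i I) (\<lambda>_. M \<Otimes>\<^sub>M M))"
    proof -
      have "(\<lambda>z. (\<lambda>j\<in>insert i I. fst (z j), \<lambda>j\<in>insert i I. snd (z j))) \<in> measurable (PiM (insert i I) (\<lambda>_. M \<Otimes>\<^sub>M M)) (PiM (insert i I) (\<lambda>_. M) \<Otimes>\<^sub>M PiM (insert i I) (\<lambda>_. M))"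
        by measurable
      from measurable_compose[OF this insert.prems] show ?thesis by simp
    qed
  qed
  finally show ?case .
qed

text \<open>Invariance of one pair carries over to two families on which the map acts index by
  index. This serves at two levels: for the entries of two Gaussian matrices, and for the members of
  two Gaussian families.\<close>

lemma pair_PiM_preserving:
  assumes I: "finite I" and M: "prob_space M"
    and \<rho>: "\<rho> \<in> measurable (M \<Otimes>\<^sub>M M) (M \<Otimes>\<^sub>M M)" "distr (M \<Otimes>\<^sub>M M) (M \<Otimes>\<^sub>M M) \<rho> = M \<Otimes>\<^sub>M M"
    and f: "f \<in> borel_measurable (PiM I (\<lambda>_. M) \<Otimes>\<^sub>M PiM I (\<lambda>_. M))"
  shows "(\<integral>\<^sup>+xy. f (\<lambda>i\<in>I. fst (\<rho> (fst xy i, snd xy i)), \<lambda>i\<in>I. snd (\<rho> (fst xy i, snd xy i))) \<partial>(PiM I (\<lambda>_. M) \<Otimes>\<^sub>M PiM I (\<lambda>_. M)))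
     = (\<integral>\<^sup>+xy. f xy \<partial>(PiM I (\<lambda>_. M) \<Otimes>\<^sub>M PiM I (\<lambda>_. M)))"
proof -
  interpret M: prob_space M by fact
  interpret MM: pair_prob_space M M ..
  interpret P: product_prob_space "\<lambda>_. M" I by unfold_locales
  interpret PP: product_prob_space "\<lambda>_. M \<Otimes>\<^sub>M M" I by unfold_locales
  let ?Q = "PiM I (\<lambda>_. M)" and ?R = "PiM I (\<lambda>_. M \<Otimes>\<^sub>M M)"
  note [measurable] = \<rho>(1)
  have iter: "(\<integral>\<^sup>+xy. g xy \<partial>(?Q \<Otimes>\<^sub>M ?Q)) = (\<integral>\<^sup>+z. g (\<lambda>i\<in>I. fst (z i), \<lambda>i\<in>I. snd (z i)) \<partial>?R)"
    if g: "g \<in> borel_measurable (?Q \<Otimes>\<^sub>M ?Q)" for g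
    using PiM_pair_distr[OF I M, of "\<lambda>x y. g (x, y)"] P.nn_integral_fst[OF g] g by simp
  have T: "(\<lambda>xy. (\<lambda>i\<in>I. fst (\<rho> (fst xy i, snd xy i)), \<lambda>i\<in>I. snd (\<rho> (fst xy i, snd xy i)))) \<in> measurable (?Q \<Otimes>\<^sub>M ?Q) (?Q \<Otimes>\<^sub>M ?Q)"
    by measurable
  have S: "(\<lambda>z. (\<lambda>i\<in>I. fst (z i), \<lambda>i\<in>I. snd (z i))) \<in> measurable ?R (?Q \<Otimes>\<^sub>M ?Q)"
    by measurable
  have "(\<integral>\<^sup>+xy. f (\<lambda>i\<in>I. fst (\<rho> (fst xy i, snd xy i)), \<lambda>i\<in>I. snd (\<rho> (fst xy i, snd xy i))) \<partial>(?Q \<Otimes>\<^sub>M ?Q))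
      = (\<integral>\<^sup>+z. f (\<lambda>i\<in>I. fst (\<rho> (z i)), \<lambda>i\<in>I. snd (\<rho> (z i))) \<partial>?R)"
    by (subst iter[OF measurable_compose[OF T f]]) (simp cong: restrict_cong)
  also have "\<dots> = (\<integral>\<^sup>+z. (\<lambda>z. f (\<lambda>i\<in>I. fst (z i), \<lambda>i\<in>I. snd (z i))) (\<lambda>i\<in>I. \<rho> (z i)) \<partial>?R)"
    by (simp cong: restrict_cong)
  also have "\<dots> = (\<integral>\<^sup>+z. f (\<lambda>i\<in>I. fst (z i), \<lambda>i\<in>I. snd (z i)) \<partial>?R)"
  proof (rule measure_preserving_nn_integral)
    show "distr ?R ?R (\<lambda>z. \<lambda>i\<in>I. \<rho> (z i)) = ?R"
      by (rule distr_PiM_componentwise[OF I]) (use \<rho> in \<open>auto intro: MM.prob_space_axioms\<close>)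
  qed (use measurable_compose[OF S f] in measurable)
  also have "\<dots> = (\<integral>\<^sup>+xy. f xy \<partial>(?Q \<Otimes>\<^sub>M ?Q))"
    by (rule iter[OF f, symmetric])
  finally show ?thesis .
qed

section \<open>Unitary invariance of a finite family of complex Gaussian variables\<close>

abbreviation cgaussP :: "'i set \<Rightarrow> ('i \<Rightarrow> complex) measure" where
  "cgaussP I \<equiv> PiM I (\<lambda>_. cgauss)"

text \<open>Fubini isolates the two coordinates that are mixed; all others are held fixed.\<close>

lemma PiM_cgauss_rotate:
  assumes I: "finite I" and xy: "x \<in> I" "y \<in> I" "x \<noteq> y" and cs: "c\<^sup>2 + s\<^sup>2 = (1::real)"
  defines "T \<equiv> \<lambda>g. (g(y := of_real c * g y - of_real s * g x))(x := of_real c * g x + of_real s * g y)"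
  shows "T \<in> measurable (cgaussP I) (cgaussP I)" "distr (cgaussP I) (cgaussP I) T = cgaussP I"
proof -
  interpret M: prob_space cgauss by (rule prob_space_cgauss)
  interpret P: product_prob_space "\<lambda>_. cgauss" I by unfold_locales
  have comp[measurable]: "(\<lambda>g. g i) \<in> borel_measurable (cgaussP I)" if "i \<in> I" for i
    using measurable_component_singleton[OF that, of "\<lambda>_. cgauss"] by (simp cong: measurable_cong_sets)
  have Teq: "T g = (\<lambda>i\<in>I. if i = x then of_real c * g x + of_real s * g y
      else if i = y then of_real c * g y - of_real s * g x else g i)" if "g \<in> space (cgaussP I)" for g
    using that xy by (auto simp: T_def fun_eq_iff space_PiM PiE_iff extensional_def)
  have "(\<lambda>g. \<lambda>i\<in>I. if i = x then of_real c * g x + of_real s * g y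
      else if i = y then of_real c * g y - of_real s * g x else g i) \<in> measurable (cgaussP I) (cgaussP I)"
  proof (rule measurable_restrict)
    fix i assume "i \<in> I"
    then have "(\<lambda>g. if i = x then of_real c * g x + of_real s * g y
      else if i = y then of_real c * g y - of_real s * g x else g i) \<in> borel_measurable (cgaussP I)"
      using xy comp by (cases "i = x"; cases "i = y") auto
    then show "(\<lambda>g. if i = x then of_real c * g x + of_real s * g y
      else if i = y then of_real c * g y - of_real s * g x else g i) \<in> measurable (cgaussP I) cgauss"
      by (simp cong: measurable_cong_sets)
  qed
  then show T: "T \<in> measurable (cgaussP I) (cgaussP I)"
    using Teq by (subst measurable_cong) auto
  define K where "K = I - {x, y}"
  have K: "finite K" "y \<notin> K" "finite (insert y K)" "x \<notin> insert y K" "I = insert x (insert y K)"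
    using I xy by (auto simp: K_def)
  have iter: "(\<integral>\<^sup>+g. f g \<partial>cgaussP I) = (\<integral>\<^sup>+k. \<integral>\<^sup>+b. \<integral>\<^sup>+a. f (k(y := b, x := a)) \<partial>cgauss \<partial>cgauss \<partial>cgaussP K)"
    if f: "f \<in> borel_measurable (cgaussP I)" for f
  proof -
    have f': "f \<in> borel_measurable (PiM (insert x (insert y K)) (\<lambda>_. cgauss))" using f K(5) by simp
    have "(\<lambda>g. \<integral>\<^sup>+a. f (g(x := a)) \<partial>cgauss) \<in> borel_measurable (cgaussP (insert y K))"
    proof (rule M.borel_measurable_nn_integral)
      show "(\<lambda>(g, a). f (g(x := a))) \<in> borel_measurable (cgaussP (insert y K) \<Otimes>\<^sub>M cgauss)"
        using measurable_compose[OF measurable_add_dim f'] by (simp add: case_prod_unfold)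
    qed
    then show ?thesis
      unfolding K(5) using K f' by (simp add: P.product_nn_integral_insert)
  qed
  show "distr (cgaussP I) (cgaussP I) T = cgaussP I"
  proof (rule measure_preservingI[OF T])
    fix f :: "_ \<Rightarrow> ennreal" assume f: "f \<in> borel_measurable (cgaussP I)"
    have "(\<integral>\<^sup>+g. f (T g) \<partial>cgaussP I) = (\<integral>\<^sup>+k. \<integral>\<^sup>+b. \<integral>\<^sup>+a. f (T (k(y := b, x := a))) \<partial>cgauss \<partial>cgauss \<partial>cgaussP K)"
      by (rule iter) (rule measurable_compose[OF T f])
    \<comment> \<open>In the iterated integral the coordinate y is the outer variable and x the
      inner one; read in this order, the rotation has the parameter -s.\<close>
    also have "\<dots> = (\<integral>\<^sup>+k. \<integral>\<^sup>+b. \<integral>\<^sup>+a. f (k(y := of_real c * b + of_real (- s) * a, x := of_real c * a - of_real (- s) * b)) \<partial>cgauss \<partial>cgauss \<partial>cgaussP K)"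
      using xy by (intro nn_integral_cong arg_cong[of _ _ f]) (auto simp: T_def fun_eq_iff)
    also have "\<dots> = (\<integral>\<^sup>+k. \<integral>\<^sup>+b. \<integral>\<^sup>+a. f (k(y := b, x := a)) \<partial>cgauss \<partial>cgauss \<partial>cgaussP K)"
    proof (rule nn_integral_cong)
      fix k assume k: "k \<in> space (cgaussP K)"
      have "(\<lambda>(b, a). k(y := b, x := a)) \<in> measurable (borel \<Otimes>\<^sub>M borel) (cgaussP I)"
      proof -
        have "(\<lambda>(b, a). \<lambda>i\<in>I. if i = x then a else if i = y then b else k i) \<in> measurable (borel \<Otimes>\<^sub>M borel) (cgaussP I)"
          unfolding case_prod_unfold
        proof (rule measurable_restrict)
          fix i
          show "(\<lambda>ab. if i = x then snd ab else if i = y then fst ab else k i) \<in> measurable (borel \<Otimes>\<^sub>M borel) cgauss"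
            by (cases "i = x"; cases "i = y") (auto cong: measurable_cong_sets)
        qed
        moreover have "(\<lambda>(b, a). \<lambda>i\<in>I. if i = x then a else if i = y then b else k i) = (\<lambda>(b, a). k(y := b, x := a))"
          using k xy by (auto simp: fun_eq_iff space_PiM PiE_iff extensional_def K_def)
        ultimately show ?thesis by simp
      qed
      from measurable_compose[OF this f]
      have "(\<lambda>(b, a). f (k(y := b, x := a))) \<in> borel_measurable (borel \<Otimes>\<^sub>M borel)"
        by (simp add: case_prod_unfold)
      from nn_integral_rotate_cgauss[OF this, of c "- s"] cs
      show "(\<integral>\<^sup>+b. \<integral>\<^sup>+a. f (k(y := of_real c * b + of_real (- s) * a, x := of_real c * a - of_real (- s) * b)) \<partial>cgauss \<partial>cgauss)
        = (\<integral>\<^sup>+b. \<integral>\<^sup>+a. f (k(y := b, x := a)) \<partial>cgauss \<partial>cgauss)" by simp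
    qed
    also have "\<dots> = (\<integral>\<^sup>+g. f g \<partial>cgaussP I)" by (rule iter[OF f, symmetric])
    finally show "(\<integral>\<^sup>+g. f (T g) \<partial>cgaussP I) = (\<integral>\<^sup>+g. f g \<partial>cgaussP I)" .
  qed
qed

lemma PiM_cgauss_phase:
  assumes I: "finite I" and x: "x \<in> I" and u: "cmod u = 1"
  defines "T \<equiv> \<lambda>g. g(x := u * g x)"
  shows "T \<in> measurable (cgaussP I) (cgaussP I)" "distr (cgaussP I) (cgaussP I) T = cgaussP I"
proof -
  define f where "f = (\<lambda>i. if i = x then (\<lambda>z. u * z) else (\<lambda>z. z))"
  have f: "f i \<in> measurable cgauss cgauss" for i
    by (auto simp: f_def cong: measurable_cong_sets)
  have Teq: "T g = (\<lambda>i\<in>I. f i (g i))" if "g \<in> space (cgaussP I)" for g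
    using that x by (auto simp: T_def f_def fun_eq_iff space_PiM PiE_iff extensional_def)
  have "(\<lambda>g. \<lambda>i\<in>I. f i (g i)) \<in> measurable (cgaussP I) (cgaussP I)"
  proof (rule measurable_restrict)
    fix i assume i: "i \<in> I"
    show "(\<lambda>g. f i (g i)) \<in> measurable (cgaussP I) cgauss"
      using measurable_compose[OF measurable_component_singleton[OF i] f] .
  qed
  then show "T \<in> measurable (cgaussP I) (cgaussP I)"
    using Teq by (subst measurable_cong) auto
  have "distr (cgaussP I) (cgaussP I) (\<lambda>g. \<lambda>i\<in>I. f i (g i)) = cgaussP I"
    using I prob_space_cgauss f
  proof (rule distr_PiM_componentwise)
    fix i show "distr cgauss cgauss (f i) = cgauss"
      using cgauss_phase[OF u] by (simp add: f_def distr_id2)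
  qed
  moreover have "distr (cgaussP I) (cgaussP I) T = distr (cgaussP I) (cgaussP I) (\<lambda>g. \<lambda>i\<in>I. f i (g i))"
    using Teq by (intro distr_cong) auto
  ultimately show "distr (cgaussP I) (cgaussP I) T = cgaussP I" by simp
qed

text \<open>Matrices are functions on an arbitrary index set, since the case of interest has the
  positions (i, l) of an N by N matrix as indices.\<close>

definition lin_map :: "'i set \<Rightarrow> ('i \<Rightarrow> 'i \<Rightarrow> complex) \<Rightarrow> ('i \<Rightarrow> complex) \<Rightarrow> 'i \<Rightarrow> complex" where
  "lin_map I u g = (\<lambda>x\<in>I. \<Sum>y\<in>I. u x y * g y)"

definition col_orthonormal :: "'i set \<Rightarrow> ('i \<Rightarrow> 'i \<Rightarrow> complex) \<Rightarrow> bool" where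
  "col_orthonormal I u \<longleftrightarrow> (\<forall>y\<in>I. \<forall>z\<in>I. (\<Sum>x\<in>I. cnj (u x y) * u x z) = (if y = z then 1 else 0))"

definition cgauss_invariant :: "'i set \<Rightarrow> ('i \<Rightarrow> 'i \<Rightarrow> complex) \<Rightarrow> bool" where
  "cgauss_invariant I u \<longleftrightarrow> distr (cgaussP I) (cgaussP I) (lin_map I u) = cgaussP I"

lemma measurable_lin_map [measurable]: "lin_map I u \<in> measurable (cgaussP I) (cgaussP I)"
  unfolding lin_map_def
proof (rule measurable_restrict)
  fix x
  have "(\<lambda>g. g y) \<in> borel_measurable (cgaussP I)" if "y \<in> I" for y
    using measurable_component_singleton[OF that, of "\<lambda>_. cgauss"] by (simp cong: measurable_cong_sets)
  then have "(\<lambda>g. \<Sum>y\<in>I. u x y * g y) \<in> borel_measurable (cgaussP I)"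
    by (intro borel_measurable_sum) auto
  then show "(\<lambda>g. \<Sum>y\<in>I. u x y * g y) \<in> measurable (cgaussP I) cgauss"
    by (simp cong: measurable_cong_sets)
qed

text \<open>Scaling a row composes \<open>lin_map I u\<close> with multiplication of one coordinate
  by a phase, which preserves the law. The two conclusions run in opposite directions because
  elimination does: orthonormality goes forward to the simplified matrix, invariance comes back from
  it.\<close>

lemma row_scale:
  fixes u :: "'i \<Rightarrow> 'i \<Rightarrow> complex"
  assumes I: "finite I" and k: "k \<in> I" and \<theta>: "cmod \<theta> = 1"
  defines "u' \<equiv> \<lambda>x y. if x = k then \<theta> * u x y else u x y"
  shows "cgauss_invariant I u' \<Longrightarrow> cgauss_invariant I u" "col_orthonormal I u \<Longrightarrow> col_orthonormal I u'"
proof -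
  have \<theta>\<theta>: "cnj \<theta> * \<theta> = 1" using \<theta> complex_norm_square[of \<theta>] by (simp add: mult.commute)
  assume inv: "cgauss_invariant I u'"
  have "lin_map I u g = (\<lambda>g. g(k := cnj \<theta> * g k)) (lin_map I u' g)" for g
  proof
    fix i
    have "cnj \<theta> * (\<Sum>y\<in>I. \<theta> * u k y * g y) = (cnj \<theta> * \<theta>) * (\<Sum>y\<in>I. u k y * g y)"
      by (simp add: sum_distrib_left mult_ac)
    then show "lin_map I u g i = (\<lambda>g. g(k := cnj \<theta> * g k)) (lin_map I u' g) i"
      using k \<theta>\<theta> by (auto simp: lin_map_def u'_def)
  qed
  then have "lin_map I u = (\<lambda>g. (\<lambda>g. g(k := cnj \<theta> * g k)) (lin_map I u' g))" by blast
  then show "cgauss_invariant I u"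
    using distr_comp_preserving[OF measurable_lin_map inv[unfolded cgauss_invariant_def] PiM_cgauss_phase[OF I k, of "cnj \<theta>"]] \<theta>
    unfolding cgauss_invariant_def by simp
next
  have \<theta>\<theta>: "cnj \<theta> * \<theta> = 1" using \<theta> complex_norm_square[of \<theta>] by (simp add: mult.commute)
  assume "col_orthonormal I u"
  moreover have "cnj (u' x y) * u' x z = cnj (u x y) * u x z" for x y z
  proof -
    have "cnj (\<theta> * u x y) * (\<theta> * u x z) = (cnj \<theta> * \<theta>) * (cnj (u x y) * u x z)" by (simp add: mult_ac)
    then show ?thesis using \<theta>\<theta> by (simp add: u'_def)
  qed
  ultimately show "col_orthonormal I u'" by (simp add: col_orthonormal_def)
qed

text \<open>The scheme of \<open>row_scale\<close> for a real rotation of two rows;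
  \<open>lin_map I u\<close> is recovered from the rotated matrix by the inverse rotation, whose
  sine is -s.\<close>

lemma row_rotate:
  fixes u :: "'i \<Rightarrow> 'i \<Rightarrow> complex"
  assumes I: "finite I" and kl: "k \<in> I" "l \<in> I" "k \<noteq> l" and cs: "c\<^sup>2 + s\<^sup>2 = (1::real)"
  defines "u' \<equiv> \<lambda>x y. if x = k then of_real c * u k y + of_real s * u l y
      else if x = l then of_real c * u l y - of_real s * u k y else u x y"
  shows "cgauss_invariant I u' \<Longrightarrow> cgauss_invariant I u" "col_orthonormal I u \<Longrightarrow> col_orthonormal I u'"
proof -
  have cs': "of_real c * of_real c + of_real s * of_real s = (1::complex)"
    using cs by (simp add: power2_eq_square flip: of_real_mult of_real_add)
  let ?R = "\<lambda>g. (g(l := complex_of_real c * g l - of_real (- s) * g k))(k := of_real c * g k + of_real (- s) * g l)"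
  assume inv: "cgauss_invariant I u'"
  have "lin_map I u g = ?R (lin_map I u' g)" for g
  proof
    fix i
    define A B where "A = (\<Sum>y\<in>I. u k y * g y)" and "B = (\<Sum>y\<in>I. u l y * g y)"
    have k': "lin_map I u' g k = of_real c * A + of_real s * B"
      using kl by (simp add: lin_map_def u'_def A_def B_def sum_distrib_left algebra_simps sum.distrib)
    have l': "lin_map I u' g l = of_real c * B - of_real s * A"
      using kl by (simp add: lin_map_def u'_def A_def B_def sum_distrib_left algebra_simps sum_subtractf)
    have 1: "of_real c * (of_real c * A + of_real s * B) - of_real s * (of_real c * B - of_real s * A) = A"
    proof -
      have "of_real c * (of_real c * A + of_real s * B) - of_real s * (of_real c * B - of_real s * A)
        = (of_real c * of_real c + of_real s * of_real s) * A" by (simp add: algebra_simps)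
      then show ?thesis using cs' by simp
    qed
    have 2: "of_real c * (of_real c * B - of_real s * A) + of_real s * (of_real c * A + of_real s * B) = B"
    proof -
      have "of_real c * (of_real c * B - of_real s * A) + of_real s * (of_real c * A + of_real s * B)
        = (of_real c * of_real c + of_real s * of_real s) * B" by (simp add: algebra_simps)
      then show ?thesis using cs' by simp
    qed
    show "lin_map I u g i = ?R (lin_map I u' g) i"
    proof (cases "i = k \<or> i = l")
      case True
      then show ?thesis using kl 1 2 by (auto simp: k' l') (auto simp: lin_map_def A_def B_def)
    next
      case False
      then show ?thesis by (auto simp: lin_map_def u'_def)
    qed
  qed
  then have "lin_map I u = (\<lambda>g. ?R (lin_map I u' g))" by blast
  then show "cgauss_invariant I u"
    using distr_comp_preserving[OF measurable_lin_map inv[unfolded cgauss_invariant_def] PiM_cgauss_rotate[OF I kl, of c "- s"]] cs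
    unfolding cgauss_invariant_def by simp
next
  have cs': "of_real c * of_real c + of_real s * of_real s = (1::complex)"
    using cs by (simp add: power2_eq_square flip: of_real_mult of_real_add)
  assume u: "col_orthonormal I u"
  have split: "sum f I = f k + f l + sum f (I - {k} - {l})" for f :: "'i \<Rightarrow> complex"
    using I kl by (simp add: sum.remove[of I k] sum.remove[of "I - {k}" l])
  show "col_orthonormal I u'" unfolding col_orthonormal_def
  proof (intro ballI)
    fix y z assume yz: "y \<in> I" "z \<in> I"
    have "cnj (u' k y) * u' k z + cnj (u' l y) * u' l z
      = (of_real c * of_real c + of_real s * of_real s) * (cnj (u k y) * u k z + cnj (u l y) * u l z)"
      using kl(3) by (simp add: u'_def algebra_simps)
    also have "\<dots> = cnj (u k y) * u k z + cnj (u l y) * u l z" by (simp add: cs')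
    finally have "(\<Sum>x\<in>I. cnj (u' x y) * u' x z) = (\<Sum>x\<in>I. cnj (u x y) * u x z)"
      unfolding split by (simp add: u'_def)
    then show "(\<Sum>x\<in>I. cnj (u' x y) * u' x z) = (if y = z then 1 else 0)"
      using u yz by (simp add: col_orthonormal_def)
  qed
qed

text \<open>
  Elimination: phases and real rotations of pairs of rows bring column \<open>k\<close> to a unit vector, and
  orthonormality of the columns then does the same to row \<open>k\<close>.
\<close>

lemma cgauss_invariant_supported:
  assumes "finite K" "finite I" "K \<subseteq> I" "col_orthonormal I u"
    and "\<And>x y. x \<in> I \<Longrightarrow> y \<in> I \<Longrightarrow> x \<notin> K \<or> y \<notin> K \<Longrightarrow> u x y = (if x = y then 1 else 0)"
  shows "cgauss_invariant I u"
  using assms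
proof (induction K arbitrary: u)
  case empty
  have "lin_map I u g = g" if "g \<in> space (cgaussP I)" for g
  proof
    fix x
    have "(\<Sum>y\<in>I. u x y * g y) = (\<Sum>y\<in>I. if x = y then g y else 0)" if "x \<in> I"
      using empty.prems(4) that by (intro sum.cong) auto
    then show "lin_map I u g x = g x"
      using that empty.prems(1) by (auto simp: lin_map_def space_PiM PiE_iff extensional_def)
  qed
  then have "distr (cgaussP I) (cgaussP I) (lin_map I u) = distr (cgaussP I) (cgaussP I) (\<lambda>g. g)"
    by (intro distr_cong) auto
  then show ?case by (simp add: cgauss_invariant_def distr_id2)
next
  case (insert k K)
  note I = insert.prems(1)
  have kI: "k \<in> I" using insert.prems by auto
  \<comment> \<open>Inner induction on the set \<open>L\<close> of rows of \<open>K\<close> whose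
    entry in column k may still be nonzero.\<close>
  have "cgauss_invariant I u"
    if "finite L" "L \<subseteq> K" "col_orthonormal I u"
      "\<And>x y. x \<in> I \<Longrightarrow> y \<in> I \<Longrightarrow> x \<notin> insert k K \<or> y \<notin> insert k K \<Longrightarrow> u x y = (if x = y then 1 else 0)"
      "\<And>x. x \<in> K - L \<Longrightarrow> u x k = 0" for L u
    using that
  proof (induction L arbitrary: u)
    case empty
    have xk: "u x k = 0" if "x \<in> I" "x \<noteq> k" for x
      using that empty.prems(3,4) kI by (cases "x \<in> K") auto
    have "(\<Sum>x\<in>I. cnj (u x k) * u x k) = (\<Sum>x\<in>I. if x = k then cnj (u k k) * u k k else 0)"
      using xk by (intro sum.cong) auto
    then have ukk: "cnj (u k k) * u k k = 1"
      using empty.prems(2) I kI by (simp add: col_orthonormal_def)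
    then have "complex_of_real ((cmod (u k k))\<^sup>2) = 1"
      by (simp only: complex_norm_square mult.commute)
    then have \<theta>: "cmod (cnj (u k k)) = 1"
      by (simp only: of_real_eq_1_iff complex_mod_cnj power2_eq_1_iff) (use norm_ge_zero[of "u k k"] in linarith)
    \<comment> \<open>Only the diagonal entry of column k is left. It has modulus one, and
      multiplying the row by its conjugate makes it 1.\<close>
    define u' where "u' = (\<lambda>x y. if x = k then cnj (u k k) * u x y else u x y)"
    have ortho: "col_orthonormal I u'"
      unfolding u'_def by (rule row_scale(2)[OF I kI \<theta> empty.prems(2)])
    have xk': "u' x k = (if x = k then 1 else 0)" if "x \<in> I" for x
      using that xk ukk by (auto simp: u'_def)
    have kx': "u' k z = 0" if "z \<in> I" "z \<noteq> k" for z
    proof -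
      have "(\<Sum>x\<in>I. cnj (u' x k) * u' x z) = (\<Sum>x\<in>I. if x = k then u' k z else 0)"
        using xk' by (intro sum.cong) auto
      then show ?thesis using ortho that I kI by (auto simp: col_orthonormal_def)
    qed
    have "cgauss_invariant I u'"
    proof (rule insert.IH[OF I _ ortho])
      show "K \<subseteq> I" using insert.prems by auto
      fix x y assume xy: "x \<in> I" "y \<in> I" "x \<notin> K \<or> y \<notin> K"
      consider "y = k" | "y \<noteq> k" "x = k" | "x \<noteq> k" "y \<noteq> k" by blast
      then show "u' x y = (if x = y then 1 else 0)"
      proof cases
        case 1 then show ?thesis using xk'[OF xy(1)] by simp
      next
        case 2 then show ?thesis using kx'[OF xy(2)] by simp
      next
        case 3 then show ?thesis using empty.prems(3)[of x y] xy by (auto simp: u'_def)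
      qed
    qed
    then show ?case unfolding u'_def by (rule row_scale(1)[OF I kI \<theta>])
  next
    case (insert l L)
    have kl: "k \<noteq> l" "l \<in> I" "l \<in> K" using insert.prems(1) \<open>k \<notin> K\<close> \<open>insert k K \<subseteq> I\<close> by auto
    \<comment> \<open>Makes the two entries of column k real and nonnegative, so that a real
      rotation can clear the one in row l. The value 1 at zero keeps the modulus equal to
      one.\<close>
    define phase where "phase = (\<lambda>a. if a = 0 then 1 else cnj a / of_real (cmod a))"
    have ph: "cmod (phase a) = 1" "phase a * a = of_real (cmod a)" for a
    proof -
      show "cmod (phase a) = 1" by (simp add: phase_def norm_divide)
      show "phase a * a = of_real (cmod a)"
        using complex_norm_square[of a] by (auto simp: phase_def field_simps power2_eq_square)
    qed
    define u1 where "u1 = (\<lambda>x y. if x = k then phase (u k k) * u x y else u x y)"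
    define u2 where "u2 = (\<lambda>x y. if x = l then phase (u l k) * u1 x y else u1 x y)"
    define a b where "a = cmod (u k k)" and "b = cmod (u l k)"
    have u2k: "u2 k k = of_real a" "u2 l k = of_real b"
      using kl ph by (auto simp: u2_def u1_def a_def b_def)
    \<comment> \<open>Cosine and sine of the angle of the vector (a, b). For b = 0 there is nothing
      to clear, and the identity avoids a division by zero when a = 0 as well.\<close>
    define c s where "c = (if b = 0 then 1 else a / sqrt (a\<^sup>2 + b\<^sup>2))" and "s = (if b = 0 then 0 else b / sqrt (a\<^sup>2 + b\<^sup>2))"
    have pos: "a\<^sup>2 + b\<^sup>2 > 0" if "b \<noteq> 0" using that by (simp add: add_nonneg_pos)
    have cs: "c\<^sup>2 + s\<^sup>2 = 1"
      using pos by (auto simp: c_def s_def power_divide simp flip: add_divide_distrib)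
    have csz: "c * b - s * a = 0" by (auto simp: c_def s_def)
    define u3 where "u3 = (\<lambda>x y. if x = k then of_real c * u2 k y + of_real s * u2 l y
      else if x = l then of_real c * u2 l y - of_real s * u2 k y else u2 x y)"
    have "cgauss_invariant I u3"
    proof (rule insert.IH)
      show "L \<subseteq> K" using insert.prems by auto
      show "col_orthonormal I u3"
        unfolding u3_def u2_def u1_def
        by (rule row_rotate(2)[OF I kI kl(2,1) cs] row_scale(2)[OF I kI ph(1)] row_scale(2)[OF I kl(2) ph(1)] insert.prems(2))+
      show "u3 x y = (if x = y then 1 else 0)" if "x \<in> I" "y \<in> I" "x \<notin> insert k K \<or> y \<notin> insert k K" for x y
      proof (cases "x = k \<or> x = l")
        case True
        then have "y \<notin> insert k K" using that kl by auto
        then have "u k y = 0" "u l y = 0" "x \<noteq> y"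
          using insert.prems(3)[of k y] insert.prems(3)[of l y] kI kl that True by auto
        then show ?thesis using kl True by (auto simp: u3_def u2_def u1_def)
      next
        case False
        then show ?thesis using insert.prems(3)[OF that] by (auto simp: u3_def u2_def u1_def)
      qed
      show "u3 x k = 0" if "x \<in> K - L" for x
      proof (cases "x = l")
        case True
        have "u3 l k = of_real (c * b - s * a)" using kl by (simp add: u3_def u2k)
        then show ?thesis using True csz by simp
      next
        case False
        then show ?thesis using that insert.prems(4)[of x] \<open>k \<notin> K\<close> by (auto simp: u3_def u2_def u1_def)
      qed
    qed
    then have "cgauss_invariant I u2"
      unfolding u3_def by (rule row_rotate(1)[OF I kI kl(2,1) cs])
    then have "cgauss_invariant I u1"
      unfolding u2_def by (rule row_scale(1)[OF I kl(2) ph(1)])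
    then show ?case
      unfolding u1_def by (rule row_scale(1)[OF I kI ph(1)])
  qed
  from this[of K u] show ?case
    using insert.prems insert.hyps by auto
qed

lemma cgauss_unitary_invariant:
  assumes "finite I" "col_orthonormal I u"
  shows "distr (cgaussP I) (cgaussP I) (lin_map I u) = cgaussP I"
  using cgauss_invariant_supported[of I I u] assms by (simp add: cgauss_invariant_def)

section \<open>From Gaussian families to Gaussian matrices\<close>

lemma measurable_eq_on:
  assumes "f \<in> measurable M N" "\<And>w. w \<in> space M \<Longrightarrow> g w = f w"
  shows "g \<in> measurable M N"
  using measurable_cong[of M g f N] assms by blast

lemma space_mat_borel [simp]: "space (mat_borel N) = carrier_mat N N"
  by (simp add: mat_borel_def)

lemma measurable_mat_entry:
  assumes "i < N" "l < N"
  shows "(\<lambda>A. A $$ (i, l)) \<in> borel_measurable (mat_borel N)"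
proof -
  let ?E = "{..<N} \<times> {..<N}"
  have "(\<lambda>A. \<lambda>il\<in>?E. A $$ il) \<in> measurable (mat_borel N) (\<Pi>\<^sub>M il\<in>?E. borel)"
    unfolding mat_borel_def by (rule measurable_vimage_algebra1) (auto simp: space_PiM)
  moreover have "(\<lambda>f. f (i, l)) \<in> measurable (\<Pi>\<^sub>M il\<in>?E. borel) borel"
    by (rule measurable_component_singleton) (use assms in auto)
  ultimately have "(\<lambda>A. (\<lambda>il\<in>?E. A $$ il) (i, l)) \<in> borel_measurable (mat_borel N)"
    by (rule measurable_compose)
  then show ?thesis using assms by simp
qed

lemma sets_gaussian_mat [simp, measurable_cong]: "sets (gaussian_mat N) = sets (mat_borel N)"
  by (simp add: gaussian_mat_def)

lemma space_gaussian_mat [simp]: "space (gaussian_mat N) = carrier_mat N N"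
  by (simp add: gaussian_mat_def)

lemma measurable_cgauss_component: "i \<in> I \<Longrightarrow> (\<lambda>g. g i) \<in> borel_measurable (cgaussP I)"
  using measurable_component_singleton[of i I "\<lambda>_. cgauss"] by (simp cong: measurable_cong_sets)

definition mat_of_gauss :: "nat \<Rightarrow> (nat \<times> nat \<Rightarrow> complex) \<Rightarrow> complex mat" where
  "mat_of_gauss N g = mat N N (\<lambda>il. complex_of_real (1 / sqrt (2 * real N)) * g il)"

lemma measurable_mat_of_gauss: "mat_of_gauss N \<in> measurable (cgaussP ({..<N} \<times> {..<N})) (mat_borel N)"
proof (rule measurable_mat_borelI)
  fix i l assume "i < N" "l < N"
  then have "(\<lambda>g. complex_of_real (1 / sqrt (2 * real N)) * g (i, l)) \<in> borel_measurable (cgaussP ({..<N} \<times> {..<N}))"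
    by (intro borel_measurable_times measurable_cgauss_component) auto
  then show "(\<lambda>g. mat_of_gauss N g $$ (i, l)) \<in> borel_measurable (cgaussP ({..<N} \<times> {..<N}))"
    using \<open>i < N\<close> \<open>l < N\<close> by (simp add: mat_of_gauss_def)
qed (simp add: mat_of_gauss_def)

text \<open>Merging the two real variables of each entry into one complex variable makes the unitary
  invariance of complex families available.\<close>

lemma gaussian_mat_eq: "gaussian_mat N = distr (cgaussP ({..<N} \<times> {..<N})) (mat_borel N) (mat_of_gauss N)"
proof -
  let ?E = "{..<N} \<times> {..<N}" and ?C = "\<lambda>(x, y). Complex x y"
  interpret std: prob_space std_normal by (rule prob_space_std_normal)
  interpret pp: pair_prob_space std_normal std_normal ..
  have C: "?C \<in> measurable (std_normal \<Otimes>\<^sub>M std_normal) cgauss"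
    unfolding measurable_cong_sets[OF refl sets_cgauss] by measurable
  have cg: "distr (std_normal \<Otimes>\<^sub>M std_normal) cgauss ?C = cgauss"
    by (simp add: cgauss_def cong: distr_cong)
  have PC: "distr (\<Pi>\<^sub>M il\<in>?E. std_normal \<Otimes>\<^sub>M std_normal) (cgaussP ?E) (compose ?E ?C) = cgaussP ?E"
    using distr_PiM_finite_prob_space'[of ?E "\<lambda>_. std_normal \<Otimes>\<^sub>M std_normal" "\<lambda>_. cgauss" ?C] C cg prob_space_cgauss pp.prob_space_axioms
    by simp
  have mC: "compose ?E ?C \<in> measurable (\<Pi>\<^sub>M il\<in>?E. std_normal \<Otimes>\<^sub>M std_normal) (cgaussP ?E)"
    unfolding compose_def
  proof (rule measurable_restrict)
    fix i assume "i \<in> ?E"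
    from measurable_compose[OF measurable_component_singleton[OF this] C]
    show "(\<lambda>x. ?C (x i)) \<in> measurable (\<Pi>\<^sub>M il\<in>?E. std_normal \<Otimes>\<^sub>M std_normal) cgauss" .
  qed
  have "distr (cgaussP ?E) (mat_borel N) (mat_of_gauss N)
      = distr (\<Pi>\<^sub>M il\<in>?E. std_normal \<Otimes>\<^sub>M std_normal) (mat_borel N) (mat_of_gauss N \<circ> compose ?E ?C)"
    by (subst PC[symmetric], rule distr_distr[OF measurable_mat_of_gauss mC])
  also have "mat_of_gauss N \<circ> compose ?E ?C = (\<lambda>g. mat N N (\<lambda>il. complex_of_real (1 / sqrt (2 * real N)) *
              (complex_of_real (fst (g il)) + \<i> * complex_of_real (snd (g il)))))"
    by (auto simp: fun_eq_iff mat_of_gauss_def compose_def Complex_eq case_prod_unfold intro!: eq_matI)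
  finally show ?thesis by (simp add: gaussian_mat_def)
qed

lemma mat_mult3_index:
  assumes "A \<in> carrier_mat N N" "Y \<in> carrier_mat N N" "R \<in> carrier_mat N N" "i < N" "l < N"
  shows "(A * Y * R) $$ (i, l) = (\<Sum>(a, b)\<in>{..<N} \<times> {..<N}. A $$ (i, a) * R $$ (b, l) * (Y $$ (a, b) :: complex))"
proof -
  have "(A * Y * R) $$ (i, l) = (\<Sum>b<N. (\<Sum>a<N. A $$ (i, a) * Y $$ (a, b)) * R $$ (b, l))"
    unfolding index_mult_mat_sum[OF mult_carrier_mat[OF assms(1,2)] assms(3-5)]
    by (intro sum.cong arg_cong2[where f = "(*)"] refl index_mult_mat_sum[OF assms(1,2,4)]) simp
  also have "\<dots> = (\<Sum>b<N. \<Sum>a<N. A $$ (i, a) * R $$ (b, l) * Y $$ (a, b))"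
    by (intro sum.cong refl) (subst sum_distrib_right, intro sum.cong refl, simp add: mult_ac)
  also have "\<dots> = (\<Sum>a<N. \<Sum>b<N. A $$ (i, a) * R $$ (b, l) * Y $$ (a, b))"
    by (rule sum.swap)
  finally show ?thesis by (simp add: sum.cartesian_product)
qed

lemma measurable_mult3_mat:
  assumes "A \<in> carrier_mat N N" "R \<in> carrier_mat N N"
  shows "(\<lambda>Y. A * Y * R) \<in> measurable (mat_borel N) (mat_borel N)"
proof (rule measurable_mat_borelI)
  fix i l assume il: "i < N" "l < N"
  have "(\<lambda>Y. \<Sum>ab\<in>{..<N} \<times> {..<N}. A $$ (i, fst ab) * R $$ (snd ab, l) * Y $$ (fst ab, snd ab)) \<in> borel_measurable (mat_borel N)"
    by (intro borel_measurable_sum borel_measurable_times measurable_mat_entry) auto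
  then show "(\<lambda>Y. (A * Y * R) $$ (i, l)) \<in> borel_measurable (mat_borel N)"
    using mat_mult3_index[OF assms(1) _ assms(2) il]
    by (subst measurable_cong[where g = "\<lambda>Y. \<Sum>ab\<in>{..<N} \<times> {..<N}. A $$ (i, fst ab) * R $$ (snd ab, l) * Y $$ (fst ab, snd ab)"])
      (auto simp: case_prod_unfold simp del: index_mult_mat(1))
qed (use assms in auto)

text \<open>On the N^2 entries the map Y -> A Y R acts by the matrix A(i,a) R(b,l). Its columns,
  indexed by (a, b), are orthonormal because the columns of A and the rows of R are.\<close>

lemma gaussian_mat_bi_invariant:
  assumes A: "A \<in> unitary_mats N" and R: "R \<in> unitary_mats N"
  shows "distr (gaussian_mat N) (gaussian_mat N) (\<lambda>Y. A * Y * R) = gaussian_mat N"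
proof -
  let ?E = "{..<N} \<times> {..<N}"
  note Ac = unitary_matsD(1)[OF A] and Rc = unitary_matsD(1)[OF R]
  define u where "u = (\<lambda>il ab. A $$ (fst il, fst ab) * R $$ (snd ab, snd il))"
  have ortho: "col_orthonormal ?E u"
    unfolding col_orthonormal_def
  proof (intro ballI)
    fix y z assume yz: "y \<in> ?E" "z \<in> ?E"
    have "(\<Sum>x\<in>?E. cnj (u x y) * u x z) = (\<Sum>(i, l)\<in>?E. (cnj (A $$ (i, fst y)) * A $$ (i, fst z)) * (R $$ (snd z, l) * cnj (R $$ (snd y, l))))"
      by (intro sum.cong) (auto simp: u_def)
    also have "\<dots> = (\<Sum>i<N. cnj (A $$ (i, fst y)) * A $$ (i, fst z)) * (\<Sum>l<N. R $$ (snd z, l) * cnj (R $$ (snd y, l)))"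
      by (simp add: sum_product sum.cartesian_product)
    also have "\<dots> = (if y = z then 1 else 0)"
      using yz unitary_mats_cols[OF A, of "fst y" "fst z"] unitary_mats_rows[OF R, of "snd z" "snd y"]
      by (auto simp: prod_eq_iff)
    finally show "(\<Sum>x\<in>?E. cnj (u x y) * u x z) = (if y = z then 1 else 0)" .
  qed
  have comm: "A * mat_of_gauss N g * R = mat_of_gauss N (lin_map ?E u g)" for g
  proof (rule eq_matI)
    fix i l assume "i < dim_row (mat_of_gauss N (lin_map ?E u g))" "l < dim_col (mat_of_gauss N (lin_map ?E u g))"
    then have il: "i < N" "l < N" by (auto simp: mat_of_gauss_def)
    have "(A * mat_of_gauss N g * R) $$ (i, l) = (\<Sum>(a, b)\<in>?E. A $$ (i, a) * R $$ (b, l) * mat_of_gauss N g $$ (a, b))"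
      by (rule mat_mult3_index[OF Ac _ Rc il]) (simp add: mat_of_gauss_def)
    also have "\<dots> = mat_of_gauss N (lin_map ?E u g) $$ (i, l)"
    proof -
      have "(\<Sum>(a, b)\<in>?E. A $$ (i, a) * R $$ (b, l) * mat_of_gauss N g $$ (a, b))
        = (\<Sum>ab\<in>?E. complex_of_real (1 / sqrt (2 * real N)) * (u (i, l) ab * g ab))"
        by (intro sum.cong refl) (auto simp: mat_of_gauss_def u_def)
      also have "\<dots> = mat_of_gauss N (lin_map ?E u g) $$ (i, l)"
        using il by (simp add: mat_of_gauss_def lin_map_def sum_divide_distrib)
      finally show ?thesis .
    qed
    finally show "(A * mat_of_gauss N g * R) $$ (i, l) = mat_of_gauss N (lin_map ?E u g) $$ (i, l)" .
  qed (use Ac Rc in \<open>auto simp: mat_of_gauss_def\<close>)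
  have "distr (gaussian_mat N) (gaussian_mat N) (\<lambda>Y. A * Y * R) = distr (gaussian_mat N) (mat_borel N) (\<lambda>Y. A * Y * R)"
    by (rule distr_cong) auto
  also have "\<dots> = distr (cgaussP ?E) (mat_borel N) ((\<lambda>Y. A * Y * R) \<circ> mat_of_gauss N)"
    unfolding gaussian_mat_eq by (rule distr_distr[OF measurable_mult3_mat[OF Ac Rc] measurable_mat_of_gauss])
  also have "(\<lambda>Y. A * Y * R) \<circ> mat_of_gauss N = mat_of_gauss N \<circ> lin_map ?E u"
    by (auto simp: fun_eq_iff comm)
  also have "distr (cgaussP ?E) (mat_borel N) (mat_of_gauss N \<circ> lin_map ?E u)
     = distr (distr (cgaussP ?E) (cgaussP ?E) (lin_map ?E u)) (mat_borel N) (mat_of_gauss N)"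
    by (rule distr_distr[symmetric, OF measurable_mat_of_gauss measurable_lin_map])
  also have "\<dots> = gaussian_mat N"
    by (simp add: cgauss_unitary_invariant[OF _ ortho] gaussian_mat_eq)
  finally show ?thesis .
qed

text \<open>The turn by 45 degrees is the one for which the squares cancel in
  \<open>tensor_bar_rotate\<close> and only the mixed products remain.\<close>

definition rotate_pair :: "complex mat \<times> complex mat \<Rightarrow> complex mat \<times> complex mat" where
  "rotate_pair Y = (complex_of_real (1 / sqrt 2) \<cdot>\<^sub>m (fst Y + snd Y), complex_of_real (1 / sqrt 2) \<cdot>\<^sub>m (snd Y - fst Y))"

lemma measurable_rotate_pair: "rotate_pair \<in> measurable (mat_borel N \<Otimes>\<^sub>M mat_borel N) (mat_borel N \<Otimes>\<^sub>M mat_borel N)"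
  unfolding rotate_pair_def
proof (intro measurable_Pair measurable_mat_borelI)
  let ?M = "mat_borel N \<Otimes>\<^sub>M mat_borel N"
  fix i l assume il: "i < N" "l < N"
  have f: "(\<lambda>Y. fst Y $$ (i, l)) \<in> borel_measurable ?M"
    by (rule measurable_compose[OF measurable_fst measurable_mat_entry[OF il]])
  have s: "(\<lambda>Y. snd Y $$ (i, l)) \<in> borel_measurable ?M"
    by (rule measurable_compose[OF measurable_snd measurable_mat_entry[OF il]])
  have "(\<lambda>Y. complex_of_real (1 / sqrt 2) * (fst Y $$ (i, l) + snd Y $$ (i, l))) \<in> borel_measurable ?M"
    by (intro borel_measurable_times borel_measurable_add borel_measurable_const f s)
  then show "(\<lambda>Y. (complex_of_real (1 / sqrt 2) \<cdot>\<^sub>m (fst Y + snd Y)) $$ (i, l)) \<in> borel_measurable ?M"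
  proof (rule measurable_eq_on)
    fix Y assume "Y \<in> space ?M"
    then have "fst Y \<in> carrier_mat N N" "snd Y \<in> carrier_mat N N"
      unfolding space_pair_measure space_mat_borel by (metis mem_Sigma_iff prod.collapse)+
    then show "(complex_of_real (1 / sqrt 2) \<cdot>\<^sub>m (fst Y + snd Y)) $$ (i, l) = complex_of_real (1 / sqrt 2) * (fst Y $$ (i, l) + snd Y $$ (i, l))"
      using il by simp
  qed
  have "(\<lambda>Y. complex_of_real (1 / sqrt 2) * (snd Y $$ (i, l) - fst Y $$ (i, l))) \<in> borel_measurable ?M"
    by (intro borel_measurable_times borel_measurable_diff borel_measurable_const f s)
  then show "(\<lambda>Y. (complex_of_real (1 / sqrt 2) \<cdot>\<^sub>m (snd Y - fst Y)) $$ (i, l)) \<in> borel_measurable ?M"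
  proof (rule measurable_eq_on)
    fix Y assume "Y \<in> space ?M"
    then have "fst Y \<in> carrier_mat N N" "snd Y \<in> carrier_mat N N"
      unfolding space_pair_measure space_mat_borel by (metis mem_Sigma_iff prod.collapse)+
    then show "(complex_of_real (1 / sqrt 2) \<cdot>\<^sub>m (snd Y - fst Y)) $$ (i, l) = complex_of_real (1 / sqrt 2) * (snd Y $$ (i, l) - fst Y $$ (i, l))"
      using il by simp
  qed
qed (auto simp: space_pair_measure)

text \<open>Entry by entry the map is a real rotation of two independent complex Gaussian variables;
  the common factor 1 / sqrt (2 N) commutes with it.\<close>

lemma gaussian_mat_pair_rotate:
  "distr (gaussian_mat N \<Otimes>\<^sub>M gaussian_mat N) (gaussian_mat N \<Otimes>\<^sub>M gaussian_mat N) rotate_pair = gaussian_mat N \<Otimes>\<^sub>M gaussian_mat N"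
proof (rule measure_preservingI)
  let ?E = "{..<N} \<times> {..<N}" and ?G = "gaussian_mat N" and ?r = "complex_of_real (1 / sqrt 2)"
  have sets: "sets (?G \<Otimes>\<^sub>M ?G) = sets (mat_borel N \<Otimes>\<^sub>M mat_borel N)"
    by (rule sets_pair_measure_cong) auto
  show rm: "rotate_pair \<in> measurable (?G \<Otimes>\<^sub>M ?G) (?G \<Otimes>\<^sub>M ?G)"
    using measurable_rotate_pair unfolding measurable_cong_sets[OF sets sets] .
  fix f :: "_ \<Rightarrow> ennreal" assume f0: "f \<in> borel_measurable (?G \<Otimes>\<^sub>M ?G)"
  then have f: "f \<in> borel_measurable (mat_borel N \<Otimes>\<^sub>M mat_borel N)"
    unfolding measurable_cong_sets[OF sets refl] .
  let ?h = "\<lambda>(x, y). (mat_of_gauss N x, mat_of_gauss N y)"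
  have G: "?G \<Otimes>\<^sub>M ?G = distr (cgaussP ?E \<Otimes>\<^sub>M cgaussP ?E) (mat_borel N \<Otimes>\<^sub>M mat_borel N) ?h"
    unfolding gaussian_mat_eq
    by (rule pair_measure_distr[OF measurable_mat_of_gauss measurable_mat_of_gauss])
      (simp add: prob_space_gaussian_mat prob_space_imp_sigma_finite flip: gaussian_mat_eq)
  have h: "?h \<in> measurable (cgaussP ?E \<Otimes>\<^sub>M cgaussP ?E) (mat_borel N \<Otimes>\<^sub>M mat_borel N)"
    unfolding case_prod_unfold
    by (intro measurable_Pair measurable_compose[OF measurable_fst measurable_mat_of_gauss] measurable_compose[OF measurable_snd measurable_mat_of_gauss])
  let ?\<rho> = "\<lambda>zw. (?r * fst zw + ?r * snd zw, ?r * snd zw - ?r * fst zw)"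
  have sets_cc: "sets (cgauss \<Otimes>\<^sub>M cgauss) = sets (borel \<Otimes>\<^sub>M borel)"
    by (rule sets_pair_measure_cong) auto
  have \<rho>: "?\<rho> \<in> measurable (cgauss \<Otimes>\<^sub>M cgauss) (cgauss \<Otimes>\<^sub>M cgauss)"
    unfolding measurable_cong_sets[OF sets_cc sets_cc] by measurable
  have \<rho>inv: "distr (cgauss \<Otimes>\<^sub>M cgauss) (cgauss \<Otimes>\<^sub>M cgauss) ?\<rho> = cgauss \<Otimes>\<^sub>M cgauss"
  proof (rule measure_preservingI[OF \<rho>])
    fix k :: "_ \<Rightarrow> ennreal" assume k: "k \<in> borel_measurable (cgauss \<Otimes>\<^sub>M cgauss)"
    interpret prob_space cgauss by (rule prob_space_cgauss)
    have "(\<lambda>(z, w). k (z, w)) \<in> borel_measurable (borel \<Otimes>\<^sub>M borel)"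
      using k unfolding measurable_cong_sets[OF sets_cc refl] by simp
    from nn_integral_rotate_cgauss[OF this, of "1 / sqrt 2" "1 / sqrt 2"]
    have "(\<integral>\<^sup>+z. \<integral>\<^sup>+w. k (?\<rho> (z, w)) \<partial>cgauss \<partial>cgauss) = (\<integral>\<^sup>+z. \<integral>\<^sup>+w. k (z, w) \<partial>cgauss \<partial>cgauss)"
      by (simp add: power_divide)
    then show "(\<integral>\<^sup>+x. k (?\<rho> x) \<partial>(cgauss \<Otimes>\<^sub>M cgauss)) = (\<integral>\<^sup>+x. k x \<partial>(cgauss \<Otimes>\<^sub>M cgauss))"
      unfolding nn_integral_fst[OF measurable_compose[OF \<rho> k]] nn_integral_fst[OF k] .
  qed
  have comm: "rotate_pair (?h xy) = ?h (\<lambda>i\<in>?E. fst (?\<rho> (fst xy i, snd xy i)), \<lambda>i\<in>?E. snd (?\<rho> (fst xy i, snd xy i)))" for xy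
    unfolding rotate_pair_def case_prod_unfold fst_conv snd_conv prod.inject
  proof (intro conjI eq_matI)
    fix i l
    assume "i < dim_row (mat_of_gauss N (\<lambda>i\<in>?E. ?r * fst xy i + ?r * snd xy i))"
      "l < dim_col (mat_of_gauss N (\<lambda>i\<in>?E. ?r * fst xy i + ?r * snd xy i))"
    then have "i < N" "l < N" by (simp_all add: mat_of_gauss_def)
    then show "(?r \<cdot>\<^sub>m (mat_of_gauss N (fst xy) + mat_of_gauss N (snd xy))) $$ (i, l) = mat_of_gauss N (\<lambda>i\<in>?E. ?r * fst xy i + ?r * snd xy i) $$ (i, l)"
      by (simp add: mat_of_gauss_def algebra_simps add_divide_distrib diff_divide_distrib)
  next
    fix i l
    assume "i < dim_row (mat_of_gauss N (\<lambda>i\<in>?E. ?r * snd xy i - ?r * fst xy i))"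
      "l < dim_col (mat_of_gauss N (\<lambda>i\<in>?E. ?r * snd xy i - ?r * fst xy i))"
    then have "i < N" "l < N" by (simp_all add: mat_of_gauss_def)
    then show "(?r \<cdot>\<^sub>m (mat_of_gauss N (snd xy) - mat_of_gauss N (fst xy))) $$ (i, l) = mat_of_gauss N (\<lambda>i\<in>?E. ?r * snd xy i - ?r * fst xy i) $$ (i, l)"
      by (simp add: mat_of_gauss_def algebra_simps add_divide_distrib diff_divide_distrib)
  qed (simp_all add: mat_of_gauss_def)
  have "(\<integral>\<^sup>+x. f (rotate_pair x) \<partial>(?G \<Otimes>\<^sub>M ?G)) = (\<integral>\<^sup>+xy. f (rotate_pair (?h xy)) \<partial>(cgaussP ?E \<Otimes>\<^sub>M cgaussP ?E))"
    unfolding G by (rule nn_integral_distr[OF h], unfold measurable_distr_eq1) (rule measurable_compose[OF measurable_rotate_pair f])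
  also have "\<dots> = (\<integral>\<^sup>+xy. f (?h (\<lambda>i\<in>?E. fst (?\<rho> (fst xy i, snd xy i)), \<lambda>i\<in>?E. snd (?\<rho> (fst xy i, snd xy i)))) \<partial>(cgaussP ?E \<Otimes>\<^sub>M cgaussP ?E))"
    by (intro nn_integral_cong arg_cong[of _ _ f]) (simp only: comm)
  also have "\<dots> = (\<integral>\<^sup>+xy. f (?h xy) \<partial>(cgaussP ?E \<Otimes>\<^sub>M cgaussP ?E))"
    by (rule pair_PiM_preserving[OF _ prob_space_cgauss \<rho> \<rho>inv measurable_compose[OF h f]]) simp
  also have "\<dots> = (\<integral>\<^sup>+x. f x \<partial>(?G \<Otimes>\<^sub>M ?G))"
    unfolding G by (rule nn_integral_distr[symmetric, OF h], unfold measurable_distr_eq1) (rule f)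
  finally show "(\<integral>\<^sup>+x. f (rotate_pair x) \<partial>(?G \<Otimes>\<^sub>M ?G)) = (\<integral>\<^sup>+x. f x \<partial>(?G \<Otimes>\<^sub>M ?G))" .
qed

section \<open>Moments of the Gaussian matrix\<close>

lemma borel_measurable_cnj:
  assumes "f \<in> borel_measurable M"
  shows "(\<lambda>x. cnj (f x)) \<in> borel_measurable M"
proof -
  have "cnj \<in> borel_measurable borel"
    by (intro borel_measurable_continuous_onI continuous_intros)
  then show ?thesis by (rule measurable_compose[OF assms])
qed

lemma std_normal_moments:
  "integrable std_normal (\<lambda>x. x\<^sup>2)" "(\<integral>x. x\<^sup>2 \<partial>std_normal) = 1" "integrable std_normal (\<lambda>x. x ^ 4)" "(\<integral>x. x ^ 4 \<partial>std_normal) = 3"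
proof -
  show "integrable std_normal (\<lambda>x. x\<^sup>2)" "(\<integral>x. x\<^sup>2 \<partial>std_normal) = 1"
    using std_normal_distribution_even_moments[of 1] by simp_all
  have "fact 4 = (24 :: real)" by (simp add: fact_numeral)
  then show "integrable std_normal (\<lambda>x. x ^ 4)" "(\<integral>x. x ^ 4 \<partial>std_normal) = 3"
    using std_normal_distribution_even_moments[of 2] by (simp_all add: power2_eq_square)
qed

lemma cgauss_norm2: "integrable cgauss (\<lambda>z. (cmod z)\<^sup>2)" "(\<integral>z. (cmod z)\<^sup>2 \<partial>cgauss) = 2"
proof -
  interpret prob_space std_normal by (rule prob_space_std_normal)
  note mom = std_normal_moments and one = prob_space
  have "(\<integral>\<^sup>+z. ennreal ((cmod z)\<^sup>2) \<partial>cgauss) = (\<integral>\<^sup>+x. \<integral>\<^sup>+y. ennreal (x\<^sup>2 + y\<^sup>2) \<partial>std_normal \<partial>std_normal)"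
    by (subst nn_integral_cgauss) (auto simp: cmod_power2)
  also have "\<dots> = (\<integral>\<^sup>+x. ennreal (x\<^sup>2 + 1) \<partial>std_normal)"
    using mom one by (intro nn_integral_cong) (subst nn_integral_eq_integral, auto)
  also have "\<dots> = ennreal 2"
    using mom one by (subst nn_integral_eq_integral) auto
  finally have "(\<integral>\<^sup>+z. ennreal ((cmod z)\<^sup>2) \<partial>cgauss) = ennreal 2" .
  then show "integrable cgauss (\<lambda>z. (cmod z)\<^sup>2)" "(\<integral>z. (cmod z)\<^sup>2 \<partial>cgauss) = 2"
    by (subst (asm) nn_integral_eq_integrable; simp cong: measurable_cong_sets)+
qed

lemma cgauss_norm4: "integrable cgauss (\<lambda>z. (cmod z) ^ 4)" "(\<integral>z. (cmod z) ^ 4 \<partial>cgauss) = 8"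
proof -
  interpret prob_space std_normal by (rule prob_space_std_normal)
  note mom = std_normal_moments and one = prob_space
  have pw: "(cmod (Complex x y)) ^ 4 = x ^ 4 + 2 * x\<^sup>2 * y\<^sup>2 + y ^ 4" for x y
  proof -
    have "(cmod (Complex x y)) ^ 4 = ((cmod (Complex x y))\<^sup>2)\<^sup>2" by simp
    also have "\<dots> = x ^ 4 + 2 * x\<^sup>2 * y\<^sup>2 + y ^ 4"
      unfolding cmod_power2 by (simp add: power2_sum algebra_simps)
    finally show ?thesis .
  qed
  have "(\<integral>\<^sup>+z. ennreal ((cmod z) ^ 4) \<partial>cgauss) = (\<integral>\<^sup>+x. \<integral>\<^sup>+y. ennreal (x ^ 4 + 2 * x\<^sup>2 * y\<^sup>2 + y ^ 4) \<partial>std_normal \<partial>std_normal)"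
    by (subst nn_integral_cgauss) (auto simp: pw)
  also have "\<dots> = (\<integral>\<^sup>+x. ennreal (x ^ 4 + 2 * x\<^sup>2 + 3) \<partial>std_normal)"
    using mom one by (intro nn_integral_cong) (subst nn_integral_eq_integral, auto)
  also have "\<dots> = ennreal 8"
    using mom one by (subst nn_integral_eq_integral) auto
  finally have "(\<integral>\<^sup>+z. ennreal ((cmod z) ^ 4) \<partial>cgauss) = ennreal 8" .
  then show "integrable cgauss (\<lambda>z. (cmod z) ^ 4)" "(\<integral>z. (cmod z) ^ 4 \<partial>cgauss) = 8"
    by (subst (asm) nn_integral_eq_integrable; simp cong: measurable_cong_sets)+
qed

lemma cgaussP_component:
  fixes f :: "complex \<Rightarrow> real"
  assumes i: "i \<in> I" and f: "f \<in> borel_measurable borel"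
  shows "integrable (cgaussP I) (\<lambda>g. f (g i)) \<longleftrightarrow> integrable cgauss f"
    and "(\<integral>g. f (g i) \<partial>cgaussP I) = (\<integral>z. f z \<partial>cgauss)"
proof -
  have d: "distr (cgaussP I) cgauss (\<lambda>g. g i) = cgauss"
    by (rule distr_PiM_component[OF prob_space_cgauss i])
  have m: "(\<lambda>g. g i) \<in> measurable (cgaussP I) cgauss" using i by measurable
  have f': "f \<in> borel_measurable cgauss" using f by (simp cong: measurable_cong_sets)
  show "integrable (cgaussP I) (\<lambda>g. f (g i)) \<longleftrightarrow> integrable cgauss f"
    using integrable_distr_eq[OF m f'] unfolding d by simp
  show "(\<integral>g. f (g i) \<partial>cgaussP I) = (\<integral>z. f z \<partial>cgauss)"
    using integral_distr[OF m f'] unfolding d by simp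
qed

text \<open>By the arithmetic-geometric mean, applied to two pairs and then once more, a product of
  four moduli is at most the sum of their fourth powers.\<close>

lemma cgaussP_quartic_integrable:
  assumes "a \<in> I" "b \<in> I" "c \<in> I" "d \<in> I"
  shows "integrable (cgaussP I) (\<lambda>g. g a * cnj (g b) * g c * cnj (g d))"
proof (rule Bochner_Integration.integrable_bound)
  have "integrable (cgaussP I) (\<lambda>g. (cmod (g i)) ^ 4)" if "i \<in> I" for i
    using cgaussP_component(1)[OF that, of "\<lambda>z. (cmod z) ^ 4"] cgauss_norm4(1) by simp
  then show "integrable (cgaussP I) (\<lambda>g. (cmod (g a)) ^ 4 + (cmod (g b)) ^ 4 + (cmod (g c)) ^ 4 + (cmod (g d)) ^ 4)"
    using assms by (intro Bochner_Integration.integrable_add)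
  show "(\<lambda>g. g a * cnj (g b) * g c * cnj (g d)) \<in> borel_measurable (cgaussP I)"
    by (intro borel_measurable_times borel_measurable_cnj measurable_cgauss_component assms)
  have amgm: "w * x * y * z \<le> w ^ 4 + x ^ 4 + y ^ 4 + z ^ 4" for w x y z :: real
  proof -
    have "2 * ((w * x) * (y * z)) \<le> (w * x)\<^sup>2 + (y * z)\<^sup>2" using sum_squares_bound[of "w * x" "y * z"] by simp
    moreover have "2 * (w * x)\<^sup>2 \<le> w ^ 4 + x ^ 4" using sum_squares_bound[of "w\<^sup>2" "x\<^sup>2"] by (simp add: power_mult_distrib)
    moreover have "2 * (y * z)\<^sup>2 \<le> y ^ 4 + z ^ 4" using sum_squares_bound[of "y\<^sup>2" "z\<^sup>2"] by (simp add: power_mult_distrib)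
    moreover have "0 \<le> w ^ 4 + x ^ 4" "0 \<le> y ^ 4 + z ^ 4" by simp_all
    moreover have "w * x * y * z = (w * x) * (y * z)" by simp
    ultimately show ?thesis by linarith
  qed
  show "AE g in cgaussP I. norm (g a * cnj (g b) * g c * cnj (g d)) \<le> norm ((cmod (g a)) ^ 4 + (cmod (g b)) ^ 4 + (cmod (g c)) ^ 4 + (cmod (g d)) ^ 4)"
    using amgm by (intro AE_I2) (simp add: norm_mult)
qed

lemma cgaussP_quadratic_integrable:
  assumes "a \<in> I" "b \<in> I"
  shows "integrable (cgaussP I) (\<lambda>g. g a * cnj (g b))"
proof (rule Bochner_Integration.integrable_bound)
  have "integrable (cgaussP I) (\<lambda>g. (cmod (g i))\<^sup>2)" if "i \<in> I" for i
    using cgaussP_component(1)[OF that, of "\<lambda>z. (cmod z)\<^sup>2"] cgauss_norm2(1) by simp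
  then show "integrable (cgaussP I) (\<lambda>g. (cmod (g a))\<^sup>2 + (cmod (g b))\<^sup>2)"
    using assms by (intro Bochner_Integration.integrable_add)
  show "(\<lambda>g. g a * cnj (g b)) \<in> borel_measurable (cgaussP I)"
    by (intro borel_measurable_times borel_measurable_cnj measurable_cgauss_component assms)
  have amgm: "w * x \<le> w\<^sup>2 + x\<^sup>2" for w x :: real
  proof -
    have "0 \<le> w\<^sup>2 + x\<^sup>2" by simp
    then show ?thesis using sum_squares_bound[of w x] by linarith
  qed
  show "AE g in cgaussP I. norm (g a * cnj (g b)) \<le> norm ((cmod (g a))\<^sup>2 + (cmod (g b))\<^sup>2)"
    using amgm by (intro AE_I2) (simp add: norm_mult)
qed

text \<open>Changing the sign of one coordinate preserves the law and reverses the integrand. This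
  removes the moments in which some entry stands unpaired.\<close>

lemma cgaussP_phase_zero:
  fixes f :: "('i \<Rightarrow> complex) \<Rightarrow> complex"
  assumes I: "finite I" and x: "x \<in> I" and f: "f \<in> borel_measurable (cgaussP I)"
    and neg: "\<And>g. f (g(x := - g x)) = - f g"
  shows "(\<integral>g. f g \<partial>cgaussP I) = 0"
proof -
  note T = PiM_cgauss_phase[OF I x, of "-1"]
  have "(\<integral>g. f g \<partial>cgaussP I) = (\<integral>g. f (g(x := -1 * g x)) \<partial>cgaussP I)"
    using integral_distr[OF T(1), of f] T(2) f by simp
  also have "\<dots> = - (\<integral>g. f g \<partial>cgaussP I)" by (simp add: neg)
  finally show ?thesis by simp
qed

lemma cgaussP_pair:
  assumes I: "finite I" and ab: "a \<in> I" "b \<in> I" "a \<noteq> b"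
  shows "(\<integral>g. (cmod (g a))\<^sup>2 * (cmod (g b))\<^sup>2 \<partial>cgaussP I) = 4"
proof -
  interpret cg: prob_space cgauss by (rule prob_space_cgauss)
  interpret product_prob_space "\<lambda>_. cgauss" I by unfold_locales
  \<comment> \<open>The constant 1 in all other coordinates brings the integrand to product form,
    and independence factorises its mean into 2 times 2.\<close>
  define f where "f = (\<lambda>i z. if i \<in> {a, b} then (cmod z)\<^sup>2 else (1::real))"
  have fp: "(\<Prod>i\<in>I. f i (g i)) = (cmod (g a))\<^sup>2 * (cmod (g b))\<^sup>2" for g
  proof -
    have "(\<Prod>i\<in>I. f i (g i)) = (\<Prod>i\<in>{a, b}. f i (g i))"
      using I ab by (intro prod.mono_neutral_right) (auto simp: f_def)
    then show ?thesis using ab by (simp add: f_def)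
  qed
  have "(\<integral>g. (\<Prod>i\<in>I. f i (g i)) \<partial>cgaussP I) = (\<Prod>i\<in>I. \<integral>z. f i z \<partial>cgauss)"
  proof (rule product_integral_prod[OF I])
    fix i show "integrable cgauss (f i)" by (cases "i \<in> {a, b}") (simp_all add: f_def cgauss_norm2)
  qed
  also have "(\<Prod>i\<in>I. \<integral>z. f i z \<partial>cgauss) = (\<Prod>i\<in>{a, b}. \<integral>z. f i z \<partial>cgauss)"
    using I ab cg.prob_space by (intro prod.mono_neutral_right) (auto simp: f_def)
  also have "\<dots> = 4" using ab by (simp add: f_def cgauss_norm2)
  finally show ?thesis by (simp only: fp)
qed

lemma cnj_mult_self: "z * cnj z = of_real ((cmod z)\<^sup>2)"
  by (simp add: complex_norm_square del: of_real_power)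

lemma gaussian_integral:
  fixes f :: "complex mat \<Rightarrow> 'b :: {banach, second_countable_topology}"
  assumes "f \<in> borel_measurable (mat_borel N)"
  shows "integrable (gaussian_mat N) f \<longleftrightarrow> integrable (cgaussP ({..<N} \<times> {..<N})) (\<lambda>g. f (mat_of_gauss N g))"
    and "(\<integral>Y. f Y \<partial>gaussian_mat N) = (\<integral>g. f (mat_of_gauss N g) \<partial>cgaussP ({..<N} \<times> {..<N}))"
  unfolding gaussian_mat_eq using assms
  by (simp_all add: integrable_distr_eq[OF measurable_mat_of_gauss] integral_distr[OF measurable_mat_of_gauss])

lemma gaussian_second_moment:
  assumes "i < N" "l < N" "k < N" "m < N"
  shows "integrable (gaussian_mat N) (\<lambda>Y. Y $$ (i, l) * cnj (Y $$ (k, m)))"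
    and "(\<integral>Y. Y $$ (i, l) * cnj (Y $$ (k, m)) \<partial>gaussian_mat N) = (if i = k \<and> l = m then 1 / of_nat N else 0)"
proof -
  let ?E = "{..<N} \<times> {..<N}" and ?r = "complex_of_real (1 / sqrt (2 * real N))"
  have E: "(i, l) \<in> ?E" "(k, m) \<in> ?E" "finite ?E" using assms by auto
  have m: "(\<lambda>Y. Y $$ (i, l) * cnj (Y $$ (k, m))) \<in> borel_measurable (mat_borel N)"
    by (intro borel_measurable_times borel_measurable_cnj measurable_mat_entry assms)
  have ent: "mat_of_gauss N g $$ (i, l) * cnj (mat_of_gauss N g $$ (k, m)) = of_real (1 / (2 * real N)) * (g (i, l) * cnj (g (k, m)))" for g
  proof -
    have "?r * cnj ?r = of_real (1 / (2 * real N))" by (simp flip: of_real_mult)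
    then show ?thesis using assms by (simp add: mat_of_gauss_def mult_ac)
  qed
  show "integrable (gaussian_mat N) (\<lambda>Y. Y $$ (i, l) * cnj (Y $$ (k, m)))"
    unfolding gaussian_integral(1)[OF m] ent by (intro integrable_mult_right cgaussP_quadratic_integrable E)
  have "(\<integral>Y. Y $$ (i, l) * cnj (Y $$ (k, m)) \<partial>gaussian_mat N) = of_real (1 / (2 * real N)) * (\<integral>g. g (i, l) * cnj (g (k, m)) \<partial>cgaussP ?E)"
    unfolding gaussian_integral(2)[OF m] ent by simp
  also have "(\<integral>g. g (i, l) * cnj (g (k, m)) \<partial>cgaussP ?E) = (if i = k \<and> l = m then 2 else 0)"
  proof (cases "i = k \<and> l = m")
    case True
    then have "(\<integral>g. g (i, l) * cnj (g (k, m)) \<partial>cgaussP ?E) = of_real (\<integral>g. (cmod (g (i, l)))\<^sup>2 \<partial>cgaussP ?E)"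
      unfolding integral_complex_of_real[symmetric] by (simp add: cnj_mult_self)
    then show ?thesis using True cgaussP_component(2)[OF E(1), of "\<lambda>z. (cmod z)\<^sup>2"] cgauss_norm2(2) by simp
  next
    case False
    then have ne: "(k, m) \<noteq> (i, l)" by auto
    have "(\<integral>g. g (i, l) * cnj (g (k, m)) \<partial>cgaussP ?E) = 0"
      by (rule cgaussP_phase_zero[OF E(3,1)]) (use ne E in \<open>auto intro!: borel_measurable_integrable cgaussP_quadratic_integrable\<close>)
    then show ?thesis using False by simp
  qed
  finally show "(\<integral>Y. Y $$ (i, l) * cnj (Y $$ (k, m)) \<partial>gaussian_mat N) = (if i = k \<and> l = m then 1 / of_nat N else 0)" by simp
qed

text \<open>The index pattern is that of the trace of the square of Y Y^*. The factors pair up in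
  two ways, i = k and l = m. For a complex Gaussian entry the mean of |g|^4 is 8 = 4 + 4, the sum of
  the values of both pairings, so the indicators add up also where the pairings coincide.\<close>

lemma gaussian_fourth_moment:
  assumes "i < N" "l < N" "k < N" "m < N"
  shows "integrable (gaussian_mat N) (\<lambda>Y. Y $$ (i, l) * cnj (Y $$ (k, l)) * Y $$ (k, m) * cnj (Y $$ (i, m)))"
    and "(\<integral>Y. Y $$ (i, l) * cnj (Y $$ (k, l)) * Y $$ (k, m) * cnj (Y $$ (i, m)) \<partial>gaussian_mat N)
       = of_real (((if i = k then 1 else 0) + (if l = m then 1 else 0)) / (real N)\<^sup>2)"
proof -
  let ?E = "{..<N} \<times> {..<N}" and ?r = "complex_of_real (1 / sqrt (2 * real N))"
  have E: "(i, l) \<in> ?E" "(k, l) \<in> ?E" "(k, m) \<in> ?E" "(i, m) \<in> ?E" "finite ?E" using assms by auto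
  have m: "(\<lambda>Y. Y $$ (i, l) * cnj (Y $$ (k, l)) * Y $$ (k, m) * cnj (Y $$ (i, m))) \<in> borel_measurable (mat_borel N)"
    by (intro borel_measurable_times borel_measurable_cnj measurable_mat_entry assms)
  let ?q = "\<lambda>g :: nat \<times> nat \<Rightarrow> complex. g (i, l) * cnj (g (k, l)) * g (k, m) * cnj (g (i, m))"
  have ent: "mat_of_gauss N g $$ (i, l) * cnj (mat_of_gauss N g $$ (k, l)) * mat_of_gauss N g $$ (k, m) * cnj (mat_of_gauss N g $$ (i, m))
     = of_real (1 / (4 * (real N)\<^sup>2)) * ?q g" for g
  proof -
    have "?r * cnj ?r = of_real (1 / (2 * real N))" by (simp flip: of_real_mult)
    then have "?r * cnj ?r * (?r * cnj ?r) = of_real (1 / (4 * (real N)\<^sup>2))" by (simp add: power2_eq_square)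
    moreover have "mat_of_gauss N g $$ (i, l) * cnj (mat_of_gauss N g $$ (k, l)) * mat_of_gauss N g $$ (k, m) * cnj (mat_of_gauss N g $$ (i, m))
      = (?r * cnj ?r * (?r * cnj ?r)) * ?q g"
      using assms by (simp add: mat_of_gauss_def mult_ac)
    ultimately show ?thesis by simp
  qed
  have int: "integrable (cgaussP ?E) ?q" by (intro cgaussP_quartic_integrable E)
  show "integrable (gaussian_mat N) (\<lambda>Y. Y $$ (i, l) * cnj (Y $$ (k, l)) * Y $$ (k, m) * cnj (Y $$ (i, m)))"
    unfolding gaussian_integral(1)[OF m] ent by (intro integrable_mult_right int)
  have "(\<integral>Y. Y $$ (i, l) * cnj (Y $$ (k, l)) * Y $$ (k, m) * cnj (Y $$ (i, m)) \<partial>gaussian_mat N) = of_real (1 / (4 * (real N)\<^sup>2)) * (\<integral>g. ?q g \<partial>cgaussP ?E)"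
    unfolding gaussian_integral(2)[OF m] ent by simp
  also have "(\<integral>g. ?q g \<partial>cgaussP ?E) = of_real (4 * ((if i = k then 1 else 0) + (if l = m then 1 else 0)))"
  proof -
    consider "i = k" "l = m" | "i = k" "l \<noteq> m" | "i \<noteq> k" "l = m" | "i \<noteq> k" "l \<noteq> m" by blast
    then show ?thesis
    proof cases
      case 1
      have "?q g = of_real ((cmod (g (i, l))) ^ 4)" for g
      proof -
        have "?q g = (g (i, l) * cnj (g (i, l))) * (g (i, l) * cnj (g (i, l)))" using 1 by (simp add: mult_ac)
        also have "\<dots> = of_real ((cmod (g (i, l))) ^ 4)" unfolding cnj_mult_self by (simp flip: power_add)
        finally show ?thesis .
      qed
      then have "(\<integral>g. ?q g \<partial>cgaussP ?E) = of_real (\<integral>g. (cmod (g (i, l))) ^ 4 \<partial>cgaussP ?E)"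
        by (simp only: integral_complex_of_real)
      then show ?thesis using 1 cgaussP_component(2)[OF E(1), of "\<lambda>z. (cmod z) ^ 4"] cgauss_norm4(2) by simp
    next
      case 2
      have "?q g = of_real ((cmod (g (i, l)))\<^sup>2 * (cmod (g (i, m)))\<^sup>2)" for g
        unfolding of_real_mult cnj_mult_self[symmetric] using 2 by (simp add: mult_ac)
      then show ?thesis using 2 cgaussP_pair[OF E(5,1,4)] by (simp del: of_real_mult of_real_power)
    next
      case 3
      have "?q g = of_real ((cmod (g (i, l)))\<^sup>2 * (cmod (g (k, l)))\<^sup>2)" for g
        unfolding of_real_mult cnj_mult_self[symmetric] using 3 by (simp add: mult_ac)
      then show ?thesis using 3 cgaussP_pair[OF E(5,1,2)] by (simp del: of_real_mult of_real_power)
    next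
      case 4
      have "(\<integral>g. ?q g \<partial>cgaussP ?E) = 0"
        by (rule cgaussP_phase_zero[OF E(5,1) borel_measurable_integrable[OF int]]) (use 4 in auto)
      then show ?thesis using 4 by simp
    qed
  qed
  finally show "(\<integral>Y. Y $$ (i, l) * cnj (Y $$ (k, l)) * Y $$ (k, m) * cnj (Y $$ (i, m)) \<partial>gaussian_mat N)
       = of_real (((if i = k then 1 else 0) + (if l = m then 1 else 0)) / (real N)\<^sup>2)"
    by (simp add: field_simps)
qed

definition hs_sq :: "nat \<Rightarrow> complex mat \<Rightarrow> real" where
  "hs_sq N Y = Re (\<Sum>l<N. \<Sum>i<N. Y $$ (i, l) * cnj (Y $$ (i, l)))"

text \<open>The fourth power of the Schatten norm of order 4. Like \<open>hs_sq\<close>, the square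
  of the Hilbert-Schmidt norm, it is written as a polynomial in the entries, so that its Gaussian
  mean is a finite sum of moments.\<close>

definition schatten4 :: "nat \<Rightarrow> complex mat \<Rightarrow> real" where
  "schatten4 N Y = Re (\<Sum>l<N. \<Sum>m<N. \<Sum>i<N. \<Sum>k<N. Y $$ (i, l) * cnj (Y $$ (k, l)) * Y $$ (k, m) * cnj (Y $$ (i, m)))"

lemma hs_sq_expectation:
  assumes "N \<ge> 1"
  shows "integrable (gaussian_mat N) (hs_sq N)" "(\<integral>Y. hs_sq N Y \<partial>gaussian_mat N) = real N"
proof -
  have i: "integrable (gaussian_mat N) (\<lambda>Y. \<Sum>l<N. \<Sum>i<N. Y $$ (i, l) * cnj (Y $$ (i, l)))"
    by (intro Bochner_Integration.integrable_sum gaussian_second_moment(1)) auto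
  then show "integrable (gaussian_mat N) (hs_sq N)"
    unfolding hs_sq_def by (rule integrable_Re)
  have "(\<integral>Y. hs_sq N Y \<partial>gaussian_mat N) = Re (\<integral>Y. (\<Sum>l<N. \<Sum>i<N. Y $$ (i, l) * cnj (Y $$ (i, l))) \<partial>gaussian_mat N)"
    unfolding hs_sq_def by (rule integral_Re[OF i])
  also have "(\<integral>Y. (\<Sum>l<N. \<Sum>i<N. Y $$ (i, l) * cnj (Y $$ (i, l))) \<partial>gaussian_mat N) = (\<Sum>l<N. \<integral>Y. (\<Sum>i<N. Y $$ (i, l) * cnj (Y $$ (i, l))) \<partial>gaussian_mat N)"
    by (intro Bochner_Integration.integral_sum Bochner_Integration.integrable_sum gaussian_second_moment(1)) auto
  also have "\<dots> = (\<Sum>l<N. \<Sum>i<N. \<integral>Y. Y $$ (i, l) * cnj (Y $$ (i, l)) \<partial>gaussian_mat N)"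
    by (intro sum.cong refl Bochner_Integration.integral_sum gaussian_second_moment(1)) auto
  also have "\<dots> = (\<Sum>l<N. \<Sum>i<N. 1 / of_nat N)"
    by (intro sum.cong refl) (simp add: gaussian_second_moment(2))
  also have "\<dots> = of_nat N" using assms by simp
  finally show "(\<integral>Y. hs_sq N Y \<partial>gaussian_mat N) = real N" by simp
qed

text \<open>Each of the two pairings leaves N^3 of the N^4 index quadruples, with weight 1 / N^2
  each.\<close>

lemma schatten4_expectation:
  assumes "N \<ge> 1"
  shows "integrable (gaussian_mat N) (schatten4 N)" "(\<integral>Y. schatten4 N Y \<partial>gaussian_mat N) = 2 * real N"
proof -
  let ?f = "\<lambda>i l k m (Y :: complex mat). Y $$ (i, l) * cnj (Y $$ (k, l)) * Y $$ (k, m) * cnj (Y $$ (i, m))"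
  have i: "integrable (gaussian_mat N) (\<lambda>Y. \<Sum>l<N. \<Sum>m<N. \<Sum>i<N. \<Sum>k<N. ?f i l k m Y)"
    by (intro Bochner_Integration.integrable_sum gaussian_fourth_moment(1)) auto
  then show "integrable (gaussian_mat N) (schatten4 N)"
    unfolding schatten4_def by (rule integrable_Re)
  have "(\<integral>Y. schatten4 N Y \<partial>gaussian_mat N) = Re (\<integral>Y. (\<Sum>l<N. \<Sum>m<N. \<Sum>i<N. \<Sum>k<N. ?f i l k m Y) \<partial>gaussian_mat N)"
    unfolding schatten4_def by (rule integral_Re[OF i])
  also have "(\<integral>Y. (\<Sum>l<N. \<Sum>m<N. \<Sum>i<N. \<Sum>k<N. ?f i l k m Y) \<partial>gaussian_mat N)
     = (\<Sum>l<N. \<integral>Y. (\<Sum>m<N. \<Sum>i<N. \<Sum>k<N. ?f i l k m Y) \<partial>gaussian_mat N)"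
    by (intro Bochner_Integration.integral_sum Bochner_Integration.integrable_sum gaussian_fourth_moment(1)) auto
  also have "\<dots> = (\<Sum>l<N. \<Sum>m<N. \<integral>Y. (\<Sum>i<N. \<Sum>k<N. ?f i l k m Y) \<partial>gaussian_mat N)"
    by (intro sum.cong refl Bochner_Integration.integral_sum Bochner_Integration.integrable_sum gaussian_fourth_moment(1)) auto
  also have "\<dots> = (\<Sum>l<N. \<Sum>m<N. \<Sum>i<N. \<integral>Y. (\<Sum>k<N. ?f i l k m Y) \<partial>gaussian_mat N)"
    by (intro sum.cong refl Bochner_Integration.integral_sum Bochner_Integration.integrable_sum gaussian_fourth_moment(1)) auto
  also have "\<dots> = (\<Sum>l<N. \<Sum>m<N. \<Sum>i<N. \<Sum>k<N. \<integral>Y. ?f i l k m Y \<partial>gaussian_mat N)"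
    by (intro sum.cong refl Bochner_Integration.integral_sum gaussian_fourth_moment(1)) auto
  also have "\<dots> = (\<Sum>l<N. \<Sum>m<N. \<Sum>i<N. \<Sum>k<N. of_real (((if i = k then 1 else 0) + (if l = m then 1 else 0)) / (real N)\<^sup>2))"
    by (intro sum.cong refl gaussian_fourth_moment(2)) auto
  also have "\<dots> = of_real (\<Sum>l<N. \<Sum>m<N. \<Sum>i<N. \<Sum>k<N. ((if i = k then 1 else 0) + (if l = m then 1 else 0)) / (real N)\<^sup>2)"
    by (simp only: of_real_sum)
  also have "(\<Sum>l<N. \<Sum>m<N. \<Sum>i<N. \<Sum>k<N. ((if i = k then 1 else 0) + (if l = m then 1 else 0)) / (real N)\<^sup>2) = 2 * real N"
  proof -
    have "(\<Sum>l<N. \<Sum>m<N. \<Sum>i<N. \<Sum>k<N. (if i = k then 1 else 0) + (if l = m then 1 else (0::real)))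
      = (\<Sum>l<N. \<Sum>m<N. real N + real N * real N * (if l = m then 1 else 0))"
      by (intro sum.cong refl) (auto simp: sum.distrib algebra_simps)
    also have "\<dots> = (\<Sum>l<N. real N * real N + real N * real N)"
      by (intro sum.cong refl) (simp add: sum.distrib flip: sum_distrib_left)
    also have "\<dots> = 2 * real N * (real N)\<^sup>2" by (simp add: power2_eq_square)
    finally show ?thesis using assms by (simp flip: sum_divide_distrib)
  qed
  finally show "(\<integral>Y. schatten4 N Y \<partial>gaussian_mat N) = 2 * real N" by simp
qed

section \<open>Lower bound for the mean of the averaging coefficient\<close>

lemma svd_power_sums:
  assumes U: "U \<in> unitary_mats n" and V: "V \<in> unitary_mats n" and s: "\<And>i. s i \<ge> 0"
    and A: "A = U * mat_diag n (\<lambda>i. complex_of_real (s i)) * mat_adjoint V"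
  shows "hs_sq n A = (\<Sum>i<n. (s i)\<^sup>2)" "schatten4 n A = (\<Sum>i<n. (s i) ^ 4)" "schatten_norm 1 A = (\<Sum>i<n. s i)"
proof -
  note Uc = unitary_matsD[OF U] and Vc = unitary_matsD[OF V]
  have Ac: "A \<in> carrier_mat n n" using Uc Vc by (auto simp: A mat_diag_def)
  define B where "B = mat_adjoint A * A"
  have B: "B \<in> carrier_mat n n" using Ac by (auto simp: B_def)
  have Bind: "B $$ (l, m) = (\<Sum>i<n. cnj (A $$ (i, l)) * A $$ (i, m))" if "l < n" "m < n" for l m
    unfolding B_def by (rule index_adjoint_mult[OF Ac Ac that])
  note Beq = gram_svd[OF U V A, folded B_def]
  have "mat_trace B = (\<Sum>l<n. \<Sum>i<n. A $$ (i, l) * cnj (A $$ (i, l)))"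
    unfolding mat_trace_def using B Bind by (auto simp: mult.commute intro!: sum.cong)
  then show "hs_sq n A = (\<Sum>i<n. (s i)\<^sup>2)"
    unfolding hs_sq_def by (metis Beq mat_trace_diag_conj[OF V] of_real_sum Re_complex_of_real)
  have D: "mat_diag n f \<in> carrier_mat n n" for f :: "nat \<Rightarrow> complex" by (simp add: mat_diag_def)
  have "B * B = V * (mat_diag n (\<lambda>i. of_real ((s i)\<^sup>2)) * (mat_adjoint V * V) * mat_diag n (\<lambda>i. of_real ((s i)\<^sup>2))) * mat_adjoint V"
    using Vc(1,2) D by (simp add: Beq assoc_mult_mat[of _ n n _ n _ n] mult_carrier_mat[of _ n n _ n])
  also have "\<dots> = V * mat_diag n (\<lambda>i. of_real ((s i) ^ 4)) * mat_adjoint V"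
    using D by (simp add: Vc(4) right_mult_one_mat[OF D] mat_diag_diag flip: power_add)
  finally have "mat_trace (B * B) = (\<Sum>i<n. of_real ((s i) ^ 4))"
    by (simp only: mat_trace_diag_conj[OF V])
  moreover have "mat_trace (B * B) = (\<Sum>l<n. \<Sum>m<n. \<Sum>i<n. \<Sum>k<n. A $$ (i, l) * cnj (A $$ (k, l)) * A $$ (k, m) * cnj (A $$ (i, m)))"
  proof -
    have "mat_trace (B * B) = (\<Sum>l<n. \<Sum>m<n. B $$ (l, m) * B $$ (m, l))"
      unfolding mat_trace_def using B by (auto simp: index_mult_mat_sum[OF B B] simp del: index_mult_mat(1) intro!: sum.cong)
    also have "\<dots> = (\<Sum>l<n. \<Sum>m<n. \<Sum>k<n. \<Sum>i<n. A $$ (i, l) * cnj (A $$ (k, l)) * A $$ (k, m) * cnj (A $$ (i, m)))"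
    proof (intro sum.cong refl)
      fix l m assume "l \<in> {..<n}" "m \<in> {..<n}"
      then show "B $$ (l, m) * B $$ (m, l) = (\<Sum>k<n. \<Sum>i<n. A $$ (i, l) * cnj (A $$ (k, l)) * A $$ (k, m) * cnj (A $$ (i, m)))"
        unfolding lessThan_iff by (subst (1 2) Bind) (auto simp: sum_product intro!: sum.cong)
    qed
    also have "\<dots> = (\<Sum>l<n. \<Sum>m<n. \<Sum>i<n. \<Sum>k<n. A $$ (i, l) * cnj (A $$ (k, l)) * A $$ (k, m) * cnj (A $$ (i, m)))"
      by (intro sum.cong refl sum.swap)
    finally show ?thesis .
  qed
  ultimately show "schatten4 n A = (\<Sum>i<n. (s i) ^ 4)"
    by (simp add: schatten4_def)
  show "schatten_norm 1 A = (\<Sum>i<n. s i)"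
    using schatten_norm_svd[OF U V s A, of 1] s by (simp add: sum_nonneg)
qed

text \<open>
  The first bound is \<open>s (s - \<surd>2)\<^sup>2 (s + 2\<surd>2) \<ge> 0\<close>, summed over the singular values; it is a linearised Hoelder
  inequality between the Schatten norms of order 1, 2 and 4, optimal where \<open>s\<^sup>4 = 2 s\<^sup>2\<close> (the expected ratio).
\<close>

lemma nuclear_norm_bounds:
  assumes Y: "Y \<in> carrier_mat N N"
  shows "6 * hs_sq N Y \<le> 4 * sqrt 2 * schatten_norm 1 Y + schatten4 N Y"
    and "0 \<le> schatten_norm 1 Y" "(schatten_norm 1 Y)\<^sup>2 \<le> real N * hs_sq N Y"
proof -
  obtain U V s where U: "U \<in> unitary_mats N" and V: "V \<in> unitary_mats N" and s: "\<And>i. s i \<ge> 0"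
    and Yeq: "Y = U * mat_diag N (\<lambda>i. of_real (s i)) * mat_adjoint V"
    using singular_value_decomposition[OF Y] by metis
  note ps = svd_power_sums[OF U V s Yeq]
  have "6 * (s i)\<^sup>2 \<le> 4 * sqrt 2 * s i + (s i) ^ 4" for i
  proof -
    have "0 \<le> s i * ((s i - sqrt 2)\<^sup>2 * (s i + 2 * sqrt 2))" using s by simp
    also have "(s i - sqrt 2)\<^sup>2 * (s i + 2 * sqrt 2) = s i ^ 3 - 6 * s i + 4 * sqrt 2"
    proof -
      have "(s i - sqrt 2)\<^sup>2 * (s i + 2 * sqrt 2) = s i ^ 3 - 3 * s i * (sqrt 2 * sqrt 2) + 2 * sqrt 2 * (sqrt 2 * sqrt 2)"
        by (simp only: power2_eq_square power3_eq_cube) (simp add: algebra_simps)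
      then show ?thesis by simp
    qed
    finally show ?thesis by (simp add: algebra_simps power2_eq_square power3_eq_cube power4_eq_xxxx)
  qed
  then have "(\<Sum>i<N. 6 * (s i)\<^sup>2) \<le> (\<Sum>i<N. 4 * sqrt 2 * s i + (s i) ^ 4)" by (intro sum_mono)
  then show "6 * hs_sq N Y \<le> 4 * sqrt 2 * schatten_norm 1 Y + schatten4 N Y"
    by (simp add: ps sum.distrib sum_distrib_left)
  show "0 \<le> schatten_norm 1 Y" by (simp add: ps sum_nonneg s)
  show "(schatten_norm 1 Y)\<^sup>2 \<le> real N * hs_sq N Y"
    using sum_squared_le_sum_of_squares[of s "{..<N}"] by (simp add: ps mult.commute)
qed

text \<open>For X = R^* |Y| R with a Haar unitary R, the mean of the tensor square of X is a
  combination of the identity operator and P, see \<open>haar_conj_moment\<close>. This is the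
  coefficient of the identity; the nuclear norm enters as the trace of |Y|.\<close>

definition haar_coeff :: "nat \<Rightarrow> complex mat \<Rightarrow> real" where
  "haar_coeff N Y = ((schatten_norm 1 Y)\<^sup>2 - hs_sq N Y / real N) / ((real N)\<^sup>2 - 1)"

lemma haar_coeff_expectation:
  assumes N: "N \<ge> 2"
  shows "integrable (gaussian_mat N) (haar_coeff N)" "(\<integral>Y. haar_coeff N Y \<partial>gaussian_mat N) \<ge> 1 / 3"
proof -
  interpret prob_space "gaussian_mat N" by (rule prob_space_gaussian_mat)
  have N1: "N \<ge> 1" using N by simp
  note hs = hs_sq_expectation[OF N1] and s4 = schatten4_expectation[OF N1]
  let ?n = "schatten_norm 1"
  have nm[measurable]: "?n \<in> borel_measurable (gaussian_mat N)"
  proof -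
    have "(\<lambda>Y. ?n Y) \<in> borel_measurable (mat_borel N)"
      by (rule borel_measurable_supported_norm[OF schatten_supported, where d = N]) (auto intro: measurable_mat_entry)
    then show ?thesis by (simp cong: measurable_cong_sets)
  qed
  \<comment> \<open>The square is integrable because |Y|_1^2 \<le> N |Y|_2^2; the nuclear norm
    itself then follows from x \<le> 1 + x^2.\<close>
  have n2: "integrable (gaussian_mat N) (\<lambda>Y. (?n Y)\<^sup>2)"
  proof (rule Bochner_Integration.integrable_bound)
    show "integrable (gaussian_mat N) (\<lambda>Y. real N * hs_sq N Y)" using hs by simp
    show "AE Y in gaussian_mat N. norm ((?n Y)\<^sup>2) \<le> norm (real N * hs_sq N Y)"
    proof (rule AE_I2)
      fix Y assume "Y \<in> space (gaussian_mat N)"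
      then have Y: "Y \<in> carrier_mat N N" by simp
      have "0 \<le> (?n Y)\<^sup>2" by simp
      also note nuclear_norm_bounds(3)[OF Y]
      finally show "norm ((?n Y)\<^sup>2) \<le> norm (real N * hs_sq N Y)" using nuclear_norm_bounds(3)[OF Y] by simp
    qed
  qed measurable
  have n1: "integrable (gaussian_mat N) ?n"
  proof (rule Bochner_Integration.integrable_bound)
    show "integrable (gaussian_mat N) (\<lambda>Y. 1 + (?n Y)\<^sup>2)" using n2 by simp
    have "x \<le> 1 + x\<^sup>2" for x :: real
      using zero_le_power2[of "x - 1 / 2"] by (simp add: power2_diff field_simps)
    then show "AE Y in gaussian_mat N. norm (?n Y) \<le> norm (1 + (?n Y)\<^sup>2)"
      using nuclear_norm_bounds(2) by (intro AE_I2) (auto simp: abs_of_nonneg)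
  qed measurable
  \<comment> \<open>The means of \<open>hs_sq\<close> and \<open>schatten4\<close> are N and 2 N, so
    the linearised inequality gives 4 N \<le> 4 sqrt 2 times the mean nuclear norm.\<close>
  have "(\<integral>Y. 6 * hs_sq N Y \<partial>gaussian_mat N) \<le> (\<integral>Y. 4 * sqrt 2 * ?n Y + schatten4 N Y \<partial>gaussian_mat N)"
    using hs s4 n1 nuclear_norm_bounds(1) by (intro integral_mono) auto
  then have "6 * real N \<le> 4 * sqrt 2 * (\<integral>Y. ?n Y \<partial>gaussian_mat N) + 2 * real N"
    using hs s4 n1 by simp
  then have "real N \<le> sqrt 2 * (\<integral>Y. ?n Y \<partial>gaussian_mat N)" by simp
  then have "(real N)\<^sup>2 \<le> (sqrt 2 * (\<integral>Y. ?n Y \<partial>gaussian_mat N))\<^sup>2" by (intro power_mono) auto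
  then have E1: "(real N)\<^sup>2 \<le> 2 * (\<integral>Y. ?n Y \<partial>gaussian_mat N)\<^sup>2" by (simp add: power_mult_distrib)
  \<comment> \<open>Nonnegativity of the variance passes from the square of the mean to the mean of
    the square.\<close>
  have "0 \<le> variance ?n" by simp
  also have "\<dots> = (\<integral>Y. (?n Y)\<^sup>2 \<partial>gaussian_mat N) - (\<integral>Y. ?n Y \<partial>gaussian_mat N)\<^sup>2"
    by (rule variance_eq[OF n1 n2])
  finally have E2: "(real N)\<^sup>2 \<le> 2 * (\<integral>Y. (?n Y)\<^sup>2 \<partial>gaussian_mat N)" using E1 by simp
  show "integrable (gaussian_mat N) (haar_coeff N)"
    unfolding haar_coeff_def using hs n2 by simp
  have "(\<integral>Y. haar_coeff N Y \<partial>gaussian_mat N) = ((\<integral>Y. (?n Y)\<^sup>2 \<partial>gaussian_mat N) - 1) / ((real N)\<^sup>2 - 1)"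
    unfolding haar_coeff_def using hs n2 N1 by simp
  \<comment> \<open>The bound (N^2/2 - 1) / (N^2 - 1) \<ge> 1/3 amounts to N^2 \<ge> 4.\<close>
  moreover have "(real N)\<^sup>2 \<ge> 2\<^sup>2" using N by (intro power_mono) auto
  ultimately show "(\<integral>Y. haar_coeff N Y \<partial>gaussian_mat N) \<ge> 1 / 3"
    using E2 by (simp add: le_divide_eq)
qed

section \<open>Haar measure on the unitary group\<close>

lemma integral_double_sum:
  fixes f :: "'i \<Rightarrow> 'j \<Rightarrow> 'a \<Rightarrow> complex"
  assumes "\<And>i j. i \<in> A \<Longrightarrow> j \<in> B \<Longrightarrow> integrable M (f i j)"
  shows "integrable M (\<lambda>x. \<Sum>i\<in>A. \<Sum>j\<in>B. f i j x)"
    and "(\<integral>x. (\<Sum>i\<in>A. \<Sum>j\<in>B. f i j x) \<partial>M) = (\<Sum>i\<in>A. \<Sum>j\<in>B. \<integral>x. f i j x \<partial>M)"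
proof -
  show "integrable M (\<lambda>x. \<Sum>i\<in>A. \<Sum>j\<in>B. f i j x)"
    by (intro Bochner_Integration.integrable_sum assms)
  have "(\<integral>x. (\<Sum>i\<in>A. \<Sum>j\<in>B. f i j x) \<partial>M) = (\<Sum>i\<in>A. \<integral>x. (\<Sum>j\<in>B. f i j x) \<partial>M)"
    by (intro Bochner_Integration.integral_sum Bochner_Integration.integrable_sum assms)
  also have "\<dots> = (\<Sum>i\<in>A. \<Sum>j\<in>B. \<integral>x. f i j x \<partial>M)"
    by (intro sum.cong refl Bochner_Integration.integral_sum assms)
  finally show "(\<integral>x. (\<Sum>i\<in>A. \<Sum>j\<in>B. f i j x) \<partial>M) = (\<Sum>i\<in>A. \<Sum>j\<in>B. \<integral>x. f i j x \<partial>M)" .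
qed

lemma haar_unitaryD:
  assumes "is_haar_unitary N \<mu>"
  shows "prob_space \<mu>" "space \<mu> = unitary_mats N"
    "sets \<mu> = sets (restrict_space (mat_borel N) (unitary_mats N))"
    "V \<in> unitary_mats N \<Longrightarrow> distr \<mu> \<mu> (\<lambda>A. V * A) = \<mu>"
  using assms by (auto simp: is_haar_unitary_def)

lemma measurable_haarI:
  assumes \<mu>: "is_haar_unitary N \<mu>"
    and F: "\<And>x. x \<in> space M \<Longrightarrow> F x \<in> unitary_mats N"
    and ent: "\<And>i l. i < N \<Longrightarrow> l < N \<Longrightarrow> (\<lambda>x. F x $$ (i, l)) \<in> borel_measurable M"
  shows "F \<in> measurable M \<mu>"
  unfolding measurable_cong_sets[OF refl haar_unitaryD(3)[OF \<mu>]]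
  using F by (intro measurable_restrict_space2 measurable_mat_borelI ent) (auto dest: unitary_matsD)

lemma measurable_haar_entry:
  assumes \<mu>: "is_haar_unitary N \<mu>" and "i < N" "l < N"
  shows "(\<lambda>A. A $$ (i, l)) \<in> borel_measurable \<mu>"
  unfolding measurable_cong_sets[OF haar_unitaryD(3)[OF \<mu>] refl]
  using assms by (intro measurable_restrict_space1 measurable_mat_entry)

lemma measurable_mult_entry:
  assumes "\<And>x. x \<in> space M \<Longrightarrow> F x \<in> carrier_mat N N" "\<And>x. x \<in> space M \<Longrightarrow> G x \<in> carrier_mat N N"
    and "\<And>i l. i < N \<Longrightarrow> l < N \<Longrightarrow> (\<lambda>x. F x $$ (i, l)) \<in> borel_measurable M"
    and "\<And>i l. i < N \<Longrightarrow> l < N \<Longrightarrow> (\<lambda>x. G x $$ (i, l)) \<in> borel_measurable M"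
    and "i < N" "l < N"
  shows "(\<lambda>x. (F x * G x) $$ (i, l) :: complex) \<in> borel_measurable M"
proof (rule measurable_eq_on)
  show "(\<lambda>x. \<Sum>k<N. F x $$ (i, k) * G x $$ (k, l)) \<in> borel_measurable M"
    using assms by (intro borel_measurable_sum borel_measurable_times) auto
  show "(F x * G x) $$ (i, l) = (\<Sum>k<N. F x $$ (i, k) * G x $$ (k, l))" if "x \<in> space M" for x
    using assms(1,2)[OF that] assms(5,6) by (rule index_mult_mat_sum)
qed

lemma measurable_adjoint_entry:
  fixes F :: "'a \<Rightarrow> complex mat"
  assumes "\<And>x. x \<in> space M \<Longrightarrow> F x \<in> carrier_mat N N"
    and "\<And>i l. i < N \<Longrightarrow> l < N \<Longrightarrow> (\<lambda>x. F x $$ (i, l)) \<in> borel_measurable M"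
    and "i < N" "l < N"
  shows "(\<lambda>x. mat_adjoint (F x) $$ (i, l)) \<in> borel_measurable M"
proof (rule measurable_eq_on)
  show "(\<lambda>x. cnj (F x $$ (l, i))) \<in> borel_measurable M"
    using assms by (intro borel_measurable_cnj) auto
  show "mat_adjoint (F x) $$ (i, l) = cnj (F x $$ (l, i))" if "x \<in> space M" for x
    using assms(1)[OF that] assms(3,4) by simp
qed

lemma haar_left:
  assumes \<mu>: "is_haar_unitary N \<mu>" and V: "V \<in> unitary_mats N" and f: "f \<in> borel_measurable \<mu>"
  shows "(\<integral>\<^sup>+A. f (V * A) \<partial>\<mu>) = (\<integral>\<^sup>+A. f A \<partial>\<mu>)"
proof (rule measure_preserving_nn_integral[OF _ haar_unitaryD(4)[OF \<mu> V] f])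
  note sp = haar_unitaryD(2)[OF \<mu>]
  show "(\<lambda>A. V * A) \<in> measurable \<mu> \<mu>"
    using unitary_matsD(1)[OF V]
    by (intro measurable_haarI[OF \<mu>] measurable_mult_entry measurable_haar_entry[OF \<mu>])
      (auto simp: sp intro: unitary_mats_mult[OF V] unitary_matsD(1))
qed

text \<open>Both orders of integration of \<open>f (U\<^sup>* W)\<close>; no uniqueness of Haar measure is assumed.\<close>

lemma haar_adjoint:
  assumes \<mu>: "is_haar_unitary N \<mu>" and f: "f \<in> borel_measurable \<mu>"
  shows "(\<integral>\<^sup>+A. f (mat_adjoint A) \<partial>\<mu>) = (\<integral>\<^sup>+A. f A \<partial>\<mu>)"
proof -
  interpret prob_space \<mu> by (rule haar_unitaryD(1)[OF \<mu>])
  note total = emeasure_space_1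
  interpret pair_prob_space \<mu> \<mu> ..
  note sp = haar_unitaryD(2)[OF \<mu>]
  have adj: "mat_adjoint \<in> measurable \<mu> \<mu>"
    by (intro measurable_haarI[OF \<mu>] measurable_adjoint_entry measurable_haar_entry[OF \<mu>])
      (auto simp: sp intro: unitary_mats_adjoint unitary_matsD(1))
  have mult: "(\<lambda>UW. mat_adjoint (fst UW) * snd UW) \<in> measurable (\<mu> \<Otimes>\<^sub>M \<mu>) \<mu>"
  proof (intro measurable_haarI[OF \<mu>] measurable_mult_entry measurable_adjoint_entry)
    fix i l assume il: "i < N" "l < N"
    show "(\<lambda>x. fst x $$ (i, l)) \<in> borel_measurable (\<mu> \<Otimes>\<^sub>M \<mu>)"
      by (rule measurable_compose[OF measurable_fst measurable_haar_entry[OF \<mu> il]])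
    show "(\<lambda>x. snd x $$ (i, l)) \<in> borel_measurable (\<mu> \<Otimes>\<^sub>M \<mu>)"
      by (rule measurable_compose[OF measurable_snd measurable_haar_entry[OF \<mu> il]])
  qed (auto simp: space_pair_measure sp intro!: unitary_mats_mult unitary_mats_adjoint mat_adjoint_carrier intro: unitary_matsD(1))
  have fm: "(\<lambda>(U, W). f (mat_adjoint U * W)) \<in> borel_measurable (\<mu> \<Otimes>\<^sub>M \<mu>)"
    using measurable_compose[OF mult f] by (simp add: case_prod_unfold)
  have "(\<integral>\<^sup>+A. f A \<partial>\<mu>) = (\<integral>\<^sup>+U. \<integral>\<^sup>+W. f (mat_adjoint U * W) \<partial>\<mu> \<partial>\<mu>)"
  proof -
    have "(\<integral>\<^sup>+U. \<integral>\<^sup>+W. f (mat_adjoint U * W) \<partial>\<mu> \<partial>\<mu>) = (\<integral>\<^sup>+U. \<integral>\<^sup>+W. f W \<partial>\<mu> \<partial>\<mu>)"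
      by (intro nn_integral_cong haar_left[OF \<mu> _ f]) (auto simp: sp intro: unitary_mats_adjoint)
    then show ?thesis by (simp add: total)
  qed
  also have "\<dots> = (\<integral>\<^sup>+W. \<integral>\<^sup>+U. f (mat_adjoint U * W) \<partial>\<mu> \<partial>\<mu>)"
    by (rule Fubini'[OF fm, symmetric])
  also have "\<dots> = (\<integral>\<^sup>+W. \<integral>\<^sup>+U. f (mat_adjoint (mat_adjoint W * U)) \<partial>\<mu> \<partial>\<mu>)"
    by (intro nn_integral_cong arg_cong[of _ _ f], subst mat_adjoint_mult[of _ N N _ N])
      (auto simp: sp dest: unitary_matsD)
  also have "\<dots> = (\<integral>\<^sup>+W. \<integral>\<^sup>+U. f (mat_adjoint U) \<partial>\<mu> \<partial>\<mu>)"
    by (intro nn_integral_cong haar_left[OF \<mu> _ measurable_compose[OF adj f]]) (auto simp: sp intro: unitary_mats_adjoint)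
  finally show ?thesis by (simp add: total)
qed

text \<open>Right multiplication by V is left multiplication by V^* seen through the adjoint, and
  the adjoint preserves the measure by \<open>haar_adjoint\<close>.\<close>

lemma haar_right:
  assumes \<mu>: "is_haar_unitary N \<mu>" and V: "V \<in> unitary_mats N"
  shows "(\<lambda>A. A * V) \<in> measurable \<mu> \<mu>" "distr \<mu> \<mu> (\<lambda>A. A * V) = \<mu>"
proof -
  note sp = haar_unitaryD(2)[OF \<mu>]
  have adj: "mat_adjoint \<in> measurable \<mu> \<mu>"
    by (intro measurable_haarI[OF \<mu>] measurable_adjoint_entry measurable_haar_entry[OF \<mu>])
      (auto simp: sp intro: unitary_mats_adjoint unitary_matsD(1))
  show r: "(\<lambda>A. A * V) \<in> measurable \<mu> \<mu>"
    using unitary_matsD(1)[OF V]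
    by (intro measurable_haarI[OF \<mu>] measurable_mult_entry measurable_haar_entry[OF \<mu>])
      (auto simp: sp intro: unitary_mats_mult[OF _ V] unitary_matsD(1))
  show "distr \<mu> \<mu> (\<lambda>A. A * V) = \<mu>"
  proof (rule measure_preservingI[OF r])
    fix f :: "_ \<Rightarrow> ennreal" assume f: "f \<in> borel_measurable \<mu>"
    have "(\<integral>\<^sup>+A. f (A * V) \<partial>\<mu>) = (\<integral>\<^sup>+A. f (mat_adjoint A * V) \<partial>\<mu>)"
      by (rule haar_adjoint[OF \<mu> measurable_compose[OF r f], symmetric])
    also have "\<dots> = (\<integral>\<^sup>+A. f (mat_adjoint (mat_adjoint V * A)) \<partial>\<mu>)"
      using unitary_matsD(1,2)[OF V]
      by (intro nn_integral_cong arg_cong[of _ _ f], subst mat_adjoint_mult[of _ N N _ N])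
        (auto simp: sp dest: unitary_matsD)
    also have "\<dots> = (\<integral>\<^sup>+A. f (mat_adjoint A) \<partial>\<mu>)"
      by (rule haar_left[OF \<mu> unitary_mats_adjoint[OF V] measurable_compose[OF adj f]])
    also have "\<dots> = (\<integral>\<^sup>+A. f A \<partial>\<mu>)" by (rule haar_adjoint[OF \<mu> f])
    finally show "(\<integral>\<^sup>+A. f (A * V) \<partial>\<mu>) = (\<integral>\<^sup>+A. f A \<partial>\<mu>)" .
  qed
qed

section \<open>Second moments of a randomly conjugated matrix\<close>

lemma conj_index:
  assumes "V \<in> carrier_mat n n" "X \<in> carrier_mat n n" "a < n" "b < n"
  shows "(mat_adjoint V * X * V) $$ (a, b) = (\<Sum>r<n. \<Sum>s<n. cnj (V $$ (r, a)) * X $$ (r, s) * V $$ (s, b))"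
proof -
  have "(mat_adjoint V * X * V) $$ (a, b) = (mat_adjoint V * (X * V)) $$ (a, b)"
    using assms by (simp add: assoc_mult_mat[of _ n n _ n _ n])
  also have "\<dots> = (\<Sum>r<n. cnj (V $$ (r, a)) * (X * V) $$ (r, b))"
    by (rule index_adjoint_mult[OF assms(1) mult_carrier_mat[OF assms(2,1)] assms(3,4)])
  also have "\<dots> = (\<Sum>r<n. cnj (V $$ (r, a)) * (\<Sum>s<n. X $$ (r, s) * V $$ (s, b)))"
    by (intro sum.cong arg_cong2[where f = "(*)"] refl index_mult_mat_sum[OF assms(2,1)]) (use assms in auto)
  finally show ?thesis by (simp add: sum_distrib_left mult.assoc)
qed

lemma mat_trace_conj:
  assumes R: "R \<in> unitary_mats n" and A: "A \<in> carrier_mat n n"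
  shows "mat_trace (mat_adjoint R * A * R) = mat_trace A"
proof -
  note Rc = unitary_matsD[OF R]
  have "mat_trace (mat_adjoint R * A * R) = (\<Sum>a<n. \<Sum>r<n. \<Sum>s<n. cnj (R $$ (r, a)) * A $$ (r, s) * R $$ (s, a))"
    unfolding mat_trace_def using Rc A by (auto simp: conj_index[OF Rc(1) A] simp del: index_mult_mat(1) intro!: sum.cong)
  also have "\<dots> = (\<Sum>r<n. \<Sum>s<n. \<Sum>a<n. cnj (R $$ (r, a)) * A $$ (r, s) * R $$ (s, a))"
    by (subst sum.swap, subst (2) sum.swap) (rule refl)
  also have "\<dots> = (\<Sum>r<n. \<Sum>s<n. A $$ (r, s) * (\<Sum>a<n. R $$ (s, a) * cnj (R $$ (r, a))))"
    by (simp add: sum_distrib_left mult_ac)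
  also have "\<dots> = (\<Sum>r<n. A $$ (r, r))"
    by (intro sum.cong refl) (simp add: unitary_mats_rows[OF R] if_distrib[of "\<lambda>x. _ * x"] cong: if_cong)
  finally show ?thesis using A by (simp add: mat_trace_def)
qed

lemma hs_sq_trace: "A \<in> carrier_mat n n \<Longrightarrow> hs_sq n A = Re (mat_trace (mat_adjoint A * A))"
  unfolding hs_sq_def mat_trace_def
  by (auto simp: index_adjoint_mult[of A n n A n] mult.commute simp del: index_mult_mat(1) intro!: arg_cong[of _ _ Re] sum.cong)

context
  fixes N :: nat and \<mu> :: "complex mat measure" and H :: "complex mat"
  assumes \<mu>: "is_haar_unitary N \<mu>" and H: "H \<in> carrier_mat N N" and N: "N \<ge> 2"
begin

definition conj_moment :: "nat \<Rightarrow> nat \<Rightarrow> nat \<Rightarrow> nat \<Rightarrow> complex" where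
  "conj_moment a b c d = (\<integral>R. (mat_adjoint R * H * R) $$ (a, b) * cnj ((mat_adjoint R * H * R) $$ (c, d)) \<partial>\<mu>)"

lemma conj_entry_measurable:
  assumes "a < N" "b < N"
  shows "(\<lambda>R. (mat_adjoint R * H * R) $$ (a, b)) \<in> borel_measurable \<mu>"
  using assms
  by (intro measurable_mult_entry measurable_adjoint_entry measurable_haar_entry[OF \<mu>] borel_measurable_const)
    (auto simp: haar_unitaryD(2)[OF \<mu>] H intro: unitary_matsD mult_carrier_mat)

text \<open>Entries of a unitary have modulus at most one, so the integrand is bounded and the
  measure is finite.\<close>

lemma conj_moment_integrable:
  assumes "a < N" "b < N" "c < N" "d < N"
  shows "integrable \<mu> (\<lambda>R. (mat_adjoint R * H * R) $$ (a, b) * cnj ((mat_adjoint R * H * R) $$ (c, d)))"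
proof -
  interpret prob_space \<mu> by (rule haar_unitaryD(1)[OF \<mu>])
  define B where "B = (\<Sum>r<N. \<Sum>s<N. cmod (H $$ (r, s)))"
  have B: "B \<ge> 0" by (simp add: B_def sum_nonneg)
  have bound: "cmod ((mat_adjoint R * H * R) $$ (a, b)) \<le> B" if R: "R \<in> unitary_mats N" and "a < N" "b < N" for R a b
  proof -
    have "cmod ((mat_adjoint R * H * R) $$ (a, b)) \<le> (\<Sum>r<N. \<Sum>s<N. cmod (cnj (R $$ (r, a)) * H $$ (r, s) * R $$ (s, b)))"
      unfolding conj_index[OF unitary_matsD(1)[OF R] H that(2,3)]
      by (rule order_trans[OF norm_sum], intro sum_mono norm_sum)
    also have "\<dots> \<le> B"
      unfolding B_def
    proof (intro sum_mono)
      fix r s assume "r \<in> {..<N}" "s \<in> {..<N}"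
      then have "cmod (R $$ (r, a)) \<le> 1" "cmod (R $$ (s, b)) \<le> 1"
        using unitary_mats_entry_le[OF R] that by auto
      then have "cmod (R $$ (r, a)) * cmod (H $$ (r, s)) * cmod (R $$ (s, b)) \<le> 1 * cmod (H $$ (r, s)) * 1"
        by (intro mult_mono) auto
      then show "cmod (cnj (R $$ (r, a)) * H $$ (r, s) * R $$ (s, b)) \<le> cmod (H $$ (r, s))"
        by (simp add: norm_mult)
    qed
    finally show ?thesis .
  qed
  show ?thesis
  proof (rule integrable_const_bound[where B = "B * B"])
    show "AE R in \<mu>. norm ((mat_adjoint R * H * R) $$ (a, b) * cnj ((mat_adjoint R * H * R) $$ (c, d))) \<le> B * B"
    proof (rule AE_I2)
      fix R assume "R \<in> space \<mu>"
      then have R: "R \<in> unitary_mats N" by (simp add: haar_unitaryD(2)[OF \<mu>])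
      show "norm ((mat_adjoint R * H * R) $$ (a, b) * cnj ((mat_adjoint R * H * R) $$ (c, d))) \<le> B * B"
        unfolding norm_mult complex_mod_cnj
        by (intro mult_mono bound[OF R] B assms norm_ge_zero)
    qed
    show "(\<lambda>R. (mat_adjoint R * H * R) $$ (a, b) * cnj ((mat_adjoint R * H * R) $$ (c, d))) \<in> borel_measurable \<mu>"
      by (intro borel_measurable_times borel_measurable_cnj conj_entry_measurable assms)
  qed
qed

text \<open>Replacing R by R V turns X into V^* X V, so every unitary V yields a linear relation
  between the moments. Permutation matrices, diagonal phases and one rotation are the choices made
  for V.\<close>

lemma conj_moment_invariant:
  assumes V: "V \<in> unitary_mats N" and abcd: "a < N" "b < N" "c < N" "d < N"
  shows "conj_moment a b c d = (\<integral>R. (\<Sum>r<N. \<Sum>s<N. cnj (V $$ (r, a)) * (mat_adjoint R * H * R) $$ (r, s) * V $$ (s, b)) *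
      cnj (\<Sum>r<N. \<Sum>s<N. cnj (V $$ (r, c)) * (mat_adjoint R * H * R) $$ (r, s) * V $$ (s, d)) \<partial>\<mu>)"
proof -
  let ?f = "\<lambda>R. (mat_adjoint R * H * R) $$ (a, b) * cnj ((mat_adjoint R * H * R) $$ (c, d))"
  note Vc = unitary_matsD(1,2)[OF V]
  have "conj_moment a b c d = (\<integral>R. ?f (R * V) \<partial>\<mu>)"
    using integral_distr[OF haar_right(1)[OF \<mu> V], of ?f] haar_right(2)[OF \<mu> V]
      borel_measurable_integrable[OF conj_moment_integrable[OF abcd]]
    by (simp add: conj_moment_def)
  also have "\<dots> = (\<integral>R. (\<Sum>r<N. \<Sum>s<N. cnj (V $$ (r, a)) * (mat_adjoint R * H * R) $$ (r, s) * V $$ (s, b)) *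
      cnj (\<Sum>r<N. \<Sum>s<N. cnj (V $$ (r, c)) * (mat_adjoint R * H * R) $$ (r, s) * V $$ (s, d)) \<partial>\<mu>)"
  proof (rule Bochner_Integration.integral_cong[OF refl])
    fix R assume "R \<in> space \<mu>"
    then have Rc: "R \<in> carrier_mat N N" "mat_adjoint R \<in> carrier_mat N N"
      using unitary_matsD by (auto simp: haar_unitaryD(2)[OF \<mu>])
    have X: "mat_adjoint R * H * R \<in> carrier_mat N N" using Rc H by auto
    have "mat_adjoint (R * V) * H * (R * V) = mat_adjoint V * (mat_adjoint R * H * R) * V"
      using Rc H Vc by (simp add: mat_adjoint_mult[of _ N N _ N] assoc_mult_mat[of _ N N _ N _ N] mult_carrier_mat[of _ N N _ N])
    then show "?f (R * V) = (\<Sum>r<N. \<Sum>s<N. cnj (V $$ (r, a)) * (mat_adjoint R * H * R) $$ (r, s) * V $$ (s, b)) *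
      cnj (\<Sum>r<N. \<Sum>s<N. cnj (V $$ (r, c)) * (mat_adjoint R * H * R) $$ (r, s) * V $$ (s, d))"
      by (simp only: conj_index[OF Vc(1) X] abcd)
  qed
  finally show ?thesis .
qed

lemma conj_moment_permute:
  assumes \<pi>: "\<pi> permutes {..<N}" and abcd: "a < N" "b < N" "c < N" "d < N"
  shows "conj_moment a b c d = conj_moment (\<pi> a) (\<pi> b) (\<pi> c) (\<pi> d)"
proof -
  have \<pi>N: "\<pi> i < N" if "i < N" for i using permutes_in_image[OF \<pi>, of i] that by simp
  define V where "V = mat N N (\<lambda>(r, s). if r = \<pi> s then 1 else (0::complex))"
  have V: "V \<in> unitary_mats N"
  proof (rule unitary_matsI)
    fix i j assume ij: "i < N" "j < N"
    have "(\<Sum>r<N. cnj (V $$ (r, i)) * V $$ (r, j)) = (\<Sum>r<N. if r = \<pi> i then (if \<pi> i = \<pi> j then 1 else 0) else 0)"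
      using ij by (intro sum.cong) (auto simp: V_def)
    also have "\<dots> = (if i = j then 1 else 0)"
      using \<pi>N[OF ij(1)] permutes_inj[OF \<pi>] by (auto dest: injD)
    finally show "(\<Sum>r<N. cnj (V $$ (r, i)) * V $$ (r, j)) = (if i = j then 1 else 0)" .
  qed (simp add: V_def)
  have "(\<Sum>r<N. \<Sum>s<N. cnj (V $$ (r, i)) * X $$ (r, s) * V $$ (s, j)) = X $$ (\<pi> i, \<pi> j)" if "i < N" "j < N" for i j and X :: "complex mat"
  proof -
    have "(\<Sum>r<N. \<Sum>s<N. cnj (V $$ (r, i)) * X $$ (r, s) * V $$ (s, j)) = (\<Sum>r<N. \<Sum>s<N. if s = \<pi> j then (if r = \<pi> i then X $$ (r, \<pi> j) else 0) else 0)"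
      using that by (intro sum.cong) (auto simp: V_def)
    then show ?thesis using \<pi>N that by (simp add: sum.delta)
  qed
  then show ?thesis
    unfolding conj_moment_invariant[OF V abcd] by (simp add: abcd conj_moment_def)
qed

text \<open>A diagonal unitary with a single entry different from 1 multiplies the moment by a
  scalar. That entry is the imaginary unit rather than -1, because for a = d, b = c, a \<noteq> b
  the index a enters twice: -1 would give the factor 1, whereas (-i)^2 = -1.\<close>

lemma conj_moment_phase:
  assumes abcd: "a < N" "b < N" "c < N" "d < N" and ne: "\<not> (a = b \<and> c = d)" "\<not> (a = c \<and> b = d)"
  shows "conj_moment a b c d = 0"
proof -
  define v where "v = (\<lambda>(e::nat) x. if x = e then \<i> else (1::complex))"
  have vv: "cnj (v e x) * v e x = 1" for e x by (simp add: v_def)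
  have fac: "conj_moment a b c d = cnj (v e a) * v e b * v e c * cnj (v e d) * conj_moment a b c d" for e
  proof -
    define V where "V = mat N N (\<lambda>(r, s). if r = s then v e s else 0)"
    have V: "V \<in> unitary_mats N"
    proof (rule unitary_matsI)
      fix i j assume ij: "i < N" "j < N"
      have "(\<Sum>r<N. cnj (V $$ (r, i)) * V $$ (r, j)) = (\<Sum>r<N. if r = i then (if i = j then 1 else 0) else 0)"
        using ij vv by (intro sum.cong) (auto simp: V_def)
      then show "(\<Sum>r<N. cnj (V $$ (r, i)) * V $$ (r, j)) = (if i = j then 1 else 0)"
        using ij by simp
    qed (simp add: V_def)
    have sm: "(\<Sum>r<N. \<Sum>s<N. cnj (V $$ (r, i)) * X $$ (r, s) * V $$ (s, j)) = cnj (v e i) * X $$ (i, j) * v e j" if "i < N" "j < N" for i j and X :: "complex mat"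
    proof -
      have "(\<Sum>r<N. \<Sum>s<N. cnj (V $$ (r, i)) * X $$ (r, s) * V $$ (s, j)) = (\<Sum>r<N. \<Sum>s<N. if s = j then (if r = i then cnj (v e i) * X $$ (r, j) * v e j else 0) else 0)"
        using that by (intro sum.cong) (auto simp: V_def)
      then show ?thesis using that by (simp add: sum.delta)
    qed
    have "conj_moment a b c d = (\<integral>R. (cnj (v e a) * v e b * v e c * cnj (v e d)) * ((mat_adjoint R * H * R) $$ (a, b) * cnj ((mat_adjoint R * H * R) $$ (c, d))) \<partial>\<mu>)"
      unfolding conj_moment_invariant[OF V abcd] by (intro Bochner_Integration.integral_cong refl) (simp add: sm abcd)
    then show ?thesis by (simp add: conj_moment_def)
  qed
  have "\<exists>e. cnj (v e a) * v e b * v e c * cnj (v e d) \<noteq> 1"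
  proof -
    \<comment> \<open>Excluding the two pairings leaves a or d outside {b, c}, or else c or b
      outside {a, d}; this index takes the role of e.\<close>
    consider "a \<noteq> b" "a \<noteq> c" | "d \<noteq> b" "d \<noteq> c" | "a = b" "d = b" "c \<noteq> d" | "a = c" "d = c" "b \<noteq> d"
      using ne by metis
    then show ?thesis
    proof cases
      case 1 then show ?thesis by (intro exI[of _ a]) (auto simp: v_def complex_eq_iff)
    next
      case 2 then show ?thesis by (intro exI[of _ d]) (auto simp: v_def complex_eq_iff)
    next
      case 3 then show ?thesis by (intro exI[of _ c]) (auto simp: v_def complex_eq_iff)
    next
      case 4 then show ?thesis by (intro exI[of _ b]) (auto simp: v_def complex_eq_iff)
    qed
  qed
  then obtain e where "cnj (v e a) * v e b * v e c * cnj (v e d) \<noteq> 1" by blast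
  then show ?thesis using fac[of e] by simp
qed

lemma permutes_pair:
  assumes "a < N" "c < N" "a \<noteq> c"
  obtains \<pi> where "\<pi> permutes {..<N}" "\<pi> 0 = a" "\<pi> (Suc 0) = c"
proof -
  \<comment> \<open>The transposition of 0 and a may move 1; \<open>u\<close> is where 1 goes, and a
    second transposition sends it on to c without touching a.\<close>
  define u where "u = Transposition.transpose 0 a (Suc 0)"
  have u: "u < N" "u \<noteq> a" using assms N by (auto simp: u_def Transposition.transpose_def)
  have "Transposition.transpose u c \<circ> Transposition.transpose 0 a permutes {..<N}"
    using assms N u by (intro permutes_compose permutes_swap_id) auto
  moreover have "(Transposition.transpose u c \<circ> Transposition.transpose 0 a) 0 = a"
    using u assms by (simp add: Transposition.transpose_def)
  moreover have "(Transposition.transpose u c \<circ> Transposition.transpose 0 a) (Suc 0) = c"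
    by (simp flip: u_def)
  ultimately show ?thesis using that by blast
qed

text \<open>
  Phases leave only the two pairings, permutations make the coefficients constant, and one rotation by
  45 degrees identifies the coefficient of the coincidence of both pairings.
\<close>

lemma conj_moment_form:
  obtains x y where "\<And>a b c d. a < N \<Longrightarrow> b < N \<Longrightarrow> c < N \<Longrightarrow> d < N \<Longrightarrow>
    conj_moment a b c d = (if a = b \<and> c = d then x else 0) + (if a = c \<and> b = d then y else 0)"
proof -
  \<comment> \<open>The values of the two pairings where they do not coincide, and the value where
    they do. \<open>z\<close> counts as a third unknown until the rotation shows z = x + y.\<close>
  define x y z where "x = conj_moment 0 0 1 1" and "y = conj_moment 0 1 0 1" and "z = conj_moment 0 0 0 0"
  have N01: "0 < N" "Suc 0 < N" using N by auto
  have x: "conj_moment a a c c = x" if "a < N" "c < N" "a \<noteq> c" for a c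
  proof -
    note ac = that
    obtain \<pi> where "\<pi> permutes {..<N}" "\<pi> 0 = a" "\<pi> (Suc 0) = c" by (rule permutes_pair[OF ac])
    then show ?thesis using conj_moment_permute[of \<pi> 0 0 1 1] N01 by (simp add: x_def)
  qed
  have y: "conj_moment a c a c = y" if "a < N" "c < N" "a \<noteq> c" for a c
  proof -
    note ac = that
    obtain \<pi> where "\<pi> permutes {..<N}" "\<pi> 0 = a" "\<pi> (Suc 0) = c" by (rule permutes_pair[OF ac])
    then show ?thesis using conj_moment_permute[of \<pi> 0 1 0 1] N01 by (simp add: y_def)
  qed
  have z: "conj_moment a a a a = z" if "a < N" for a
  proof -
    have "Transposition.transpose 0 a permutes {..<N}" using that by (intro permutes_swap_id) auto
    then show ?thesis using conj_moment_permute[of "Transposition.transpose 0 a" 0 0 0 0] N01 by (simp add: z_def)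
  qed
  define h where "h = complex_of_real (1 / sqrt 2)"
  have hh: "h * h = 1 / 2" "cnj h = h" by (simp_all add: h_def flip: of_real_mult)
  have lt2: "{..<N} \<inter> {i. i < 2} = {0, 1}" using N by auto
  define f where "f = (\<lambda>(r::nat) (i::nat). if r < 2 then h else 0)"
  have red: "(\<Sum>r<N. g r * (if r < 2 then h else 0)) = h * (g 0 + g 1)" for g :: "nat \<Rightarrow> complex"
  proof -
    have "(\<Sum>r<N. g r * (if r < 2 then h else 0)) = (\<Sum>r<N. if r < 2 then g r * h else 0)"
      by (intro sum.cong) auto
    also have "\<dots> = (\<Sum>r\<in>{0, 1}. g r * h)" unfolding lt2[symmetric] by (subst sum.inter_restrict) auto
    finally show ?thesis by (simp add: algebra_simps)
  qed
  \<comment> \<open>Only the first column of the rotation matters, the unit vector (1, 1, 0, ...) /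
    sqrt 2; any unitary with this column will do.\<close>
  have "\<exists>W\<in>unitary_mats N. \<forall>i\<in>{0}. \<forall>r<N. W $$ (r, i) = f r i"
  proof (rule unitary_mats_extend)
    fix i j :: nat assume "i \<in> {0}" "j \<in> {0}"
    then show "(\<Sum>r<N. cnj (f r i) * f r j) = (if i = j then 1 else 0)"
      using red[of "\<lambda>r. cnj (f r 0)"] hh by (simp add: f_def algebra_simps)
  qed (use N in auto)
  then obtain V where V: "V \<in> unitary_mats N" and V0: "\<And>r. r < N \<Longrightarrow> V $$ (r, 0) = (if r < 2 then h else 0)"
    by (auto simp: f_def)
  have VX: "(\<Sum>r<N. \<Sum>s<N. cnj (V $$ (r, 0)) * X $$ (r, s) * V $$ (s, 0)) = (1 / 2) * (\<Sum>r<2. \<Sum>s<2. X $$ (r, s))" for X :: "complex mat"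
  proof -
    have "(\<Sum>r<N. \<Sum>s<N. cnj (V $$ (r, 0)) * X $$ (r, s) * V $$ (s, 0)) = (\<Sum>r<N. (\<Sum>s<N. X $$ (r, s) * (if s < 2 then h else 0)) * (if r < 2 then h else 0))"
      unfolding sum_distrib_right by (intro sum.cong refl) (auto simp: V0 hh)
    also have "\<dots> = (h * h) * (X $$ (0, 0) + X $$ (0, 1) + X $$ (1, 0) + X $$ (1, 1))"
      unfolding red by (simp add: algebra_simps)
    finally show ?thesis by (simp add: hh numeral_2_eq_2)
  qed
  have "z = (\<integral>R. (1 / 4) * (\<Sum>r<2. \<Sum>s<2. \<Sum>t<2. \<Sum>w<2. (mat_adjoint R * H * R) $$ (r, s) * cnj ((mat_adjoint R * H * R) $$ (t, w))) \<partial>\<mu>)"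
    unfolding z_def conj_moment_invariant[OF V N01(1) N01(1) N01(1) N01(1)] VX
    by (intro Bochner_Integration.integral_cong refl) (simp only: sum_distrib_left sum_distrib_right cnj_sum complex_cnj_mult, simp add: sum_product algebra_simps numeral_2_eq_2)
  also have "\<dots> = (1 / 4) * (\<Sum>r<2. \<Sum>s<2. \<Sum>t<2. \<Sum>w<2. conj_moment r s t w)"
  proof -
    have "(\<integral>R. (\<Sum>r<2. \<Sum>s<2. \<Sum>t<2. \<Sum>w<2. (mat_adjoint R * H * R) $$ (r, s) * cnj ((mat_adjoint R * H * R) $$ (t, w))) \<partial>\<mu>)
      = (\<Sum>r<2. \<Sum>s<2. \<integral>R. (\<Sum>t<2. \<Sum>w<2. (mat_adjoint R * H * R) $$ (r, s) * cnj ((mat_adjoint R * H * R) $$ (t, w))) \<partial>\<mu>)"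
      using N by (intro integral_double_sum conj_moment_integrable) auto
    also have "\<dots> = (\<Sum>r<2. \<Sum>s<2. \<Sum>t<2. \<Sum>w<2. conj_moment r s t w)"
      unfolding conj_moment_def using N by (intro sum.cong refl integral_double_sum conj_moment_integrable) auto
    finally show ?thesis by simp
  qed
  also have "\<dots> = (1 / 4) * (2 * z + 2 * x + 2 * y)"
    using N01 by (simp add: numeral_2_eq_2 x y z conj_moment_phase)
  \<comment> \<open>Of the 16 moments with indices below 2, two equal z, two equal x, two equal y,
    and the rest vanish; so z = (z + x + y) / 2.\<close>
  finally have zxy: "z = x + y" by (auto simp: complex_eq_iff)
  have "conj_moment a b c d = (if a = b \<and> c = d then x else 0) + (if a = c \<and> b = d then y else 0)"
    if "a < N" "b < N" "c < N" "d < N" for a b c d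
  proof (cases "(a = b \<and> c = d) \<or> (a = c \<and> b = d)")
    case False then show ?thesis using conj_moment_phase[OF that] by auto
  next
    case True
    then show ?thesis using that x[of a c] y[of a b] z[of a] zxy by (cases "a = b"; cases "a = c") auto
  qed
  then show ?thesis using that by blast
qed

text \<open>Trace and Hilbert-Schmidt norm do not change under conjugation, so summing the moments
  over the two pairings gives |tr H|^2 = N^2 x + N y and |H|_2^2 = N x + N^2 y. These equations
  determine x; y stays anonymous because it multiplies P, which 1 - P kills.\<close>

lemma haar_conj_moment:
  obtains y where "\<And>a b c d. a < N \<Longrightarrow> b < N \<Longrightarrow> c < N \<Longrightarrow> d < N \<Longrightarrow>
    (\<integral>R. (mat_adjoint R * H * R) $$ (a, b) * cnj ((mat_adjoint R * H * R) $$ (c, d)) \<partial>\<mu>)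
    = (if a = b \<and> c = d then of_real (((cmod (mat_trace H))\<^sup>2 - hs_sq N H / real N) / ((real N)\<^sup>2 - 1)) else 0) + (if a = c \<and> b = d then y else 0)"
proof -
  interpret prob_space \<mu> by (rule haar_unitaryD(1)[OF \<mu>])
  obtain x y where xy: "\<And>a b c d. a < N \<Longrightarrow> b < N \<Longrightarrow> c < N \<Longrightarrow> d < N \<Longrightarrow>
    conj_moment a b c d = (if a = b \<and> c = d then x else 0) + (if a = c \<and> b = d then y else 0)"
    using conj_moment_form by blast
  let ?X = "\<lambda>R. mat_adjoint R * H * R" and ?n = "of_nat N :: complex"
  have X: "?X R \<in> carrier_mat N N" "R \<in> unitary_mats N" if "R \<in> space \<mu>" for R
    using that H unitary_matsD(1,2)[of R N] by (auto simp: haar_unitaryD(2)[OF \<mu>] intro!: mult_carrier_mat)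
  have tr: "mat_trace H * cnj (mat_trace H) = (\<Sum>a<N. \<Sum>c<N. conj_moment a a c c)"
  proof -
    have "(\<Sum>a<N. \<Sum>c<N. conj_moment a a c c) = (\<integral>R. (\<Sum>a<N. \<Sum>c<N. ?X R $$ (a, a) * cnj (?X R $$ (c, c))) \<partial>\<mu>)"
      unfolding conj_moment_def by (intro integral_double_sum(2)[symmetric] conj_moment_integrable) auto
    also have "\<dots> = (\<integral>R. mat_trace H * cnj (mat_trace H) \<partial>\<mu>)"
    proof (rule Bochner_Integration.integral_cong[OF refl])
      fix R assume R: "R \<in> space \<mu>"
      have "mat_trace (?X R) = (\<Sum>a<N. ?X R $$ (a, a))"
        by (simp only: mat_trace_def carrier_matD(1)[OF X(1)[OF R]])
      then have "mat_trace H = (\<Sum>a<N. ?X R $$ (a, a))"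
        by (simp only: mat_trace_conj[OF X(2)[OF R] H])
      then show "(\<Sum>a<N. \<Sum>c<N. ?X R $$ (a, a) * cnj (?X R $$ (c, c))) = mat_trace H * cnj (mat_trace H)"
        by (simp add: sum_product del: index_mult_mat(1))
    qed
    finally show ?thesis by (simp add: prob_space)
  qed
  have "(\<Sum>a<N. \<Sum>c<N. conj_moment a a c c) = (\<Sum>a<N. \<Sum>c<N. x + (if a = c then y else 0))"
    by (intro sum.cong refl) (simp add: xy)
  also have "\<dots> = ?n * ?n * x + ?n * y" by (simp add: sum.distrib algebra_simps)
  finally have e1: "of_real ((cmod (mat_trace H))\<^sup>2) = ?n * ?n * x + ?n * y"
    using tr by (simp only: cnj_mult_self)
  have hs: "of_real (hs_sq N H) = (\<Sum>b<N. \<Sum>a<N. conj_moment a b a b)"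
  proof -
    have real: "(\<Sum>l<N. \<Sum>i<N. A $$ (i, l) * cnj (A $$ (i, l))) = of_real (hs_sq N A)" for A :: "complex mat"
      by (simp add: hs_sq_def complex_eq_iff)
    have "(\<Sum>b<N. \<Sum>a<N. conj_moment a b a b) = (\<integral>R. (\<Sum>b<N. \<Sum>a<N. ?X R $$ (a, b) * cnj (?X R $$ (a, b))) \<partial>\<mu>)"
      unfolding conj_moment_def by (intro integral_double_sum(2)[symmetric] conj_moment_integrable) auto
    also have "\<dots> = (\<integral>R. of_real (hs_sq N H) \<partial>\<mu>)"
    proof (rule Bochner_Integration.integral_cong[OF refl])
      fix R assume R: "R \<in> space \<mu>"
      note Rc = unitary_matsD[OF X(2)[OF R]]
      have HH: "mat_adjoint H * H \<in> carrier_mat N N" using H by auto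
      have "mat_adjoint (?X R) * ?X R = mat_adjoint R * (mat_adjoint H * (R * mat_adjoint R) * H) * R"
        using Rc(1,2) H by (simp add: mat_adjoint_mult[of _ N N _ N] assoc_mult_mat[of _ N N _ N _ N] mult_carrier_mat[of _ N N _ N])
      also have "\<dots> = mat_adjoint R * (mat_adjoint H * H) * R"
        using H Rc(3) by simp
      finally have "hs_sq N (?X R) = hs_sq N H"
        using mat_trace_conj[OF X(2)[OF R] HH] by (simp add: hs_sq_trace[OF X(1)[OF R]] hs_sq_trace[OF H])
      then show "(\<Sum>b<N. \<Sum>a<N. ?X R $$ (a, b) * cnj (?X R $$ (a, b))) = of_real (hs_sq N H)"
        by (simp only: real)
    qed
    finally show ?thesis by (simp add: prob_space)
  qed
  have "(\<Sum>b<N. \<Sum>a<N. conj_moment a b a b) = (\<Sum>b<N. \<Sum>a<N. (if a = b then x else 0) + y)"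
    by (intro sum.cong refl) (simp add: xy)
  also have "\<dots> = ?n * x + ?n * ?n * y" by (simp add: sum.distrib algebra_simps)
  finally have e2: "of_real (hs_sq N H) = ?n * x + ?n * ?n * y" using hs by simp
  have n0: "?n \<noteq> 0" using N by auto
  have "2 * 2 \<le> N * N" using N by (intro mult_mono) auto
  then have "(of_nat (N * N) :: complex) \<noteq> of_nat 1" unfolding of_nat_eq_iff by linarith
  then have n1: "?n * ?n - 1 \<noteq> 0" by simp
  have "of_real ((cmod (mat_trace H))\<^sup>2) - of_real (hs_sq N H) / ?n = (?n * ?n - 1) * x"
    unfolding e1 e2 using n0 by (simp add: field_simps)
  then have "x = (of_real ((cmod (mat_trace H))\<^sup>2) - of_real (hs_sq N H) / ?n) / (?n * ?n - 1)"
    using n1 by (simp add: field_simps)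
  then have "x = of_real (((cmod (mat_trace H))\<^sup>2 - hs_sq N H / real N) / ((real N)\<^sup>2 - 1))"
    by (simp add: power2_eq_square)
  then show ?thesis using that[of y] xy unfolding conj_moment_def by blast
qed

end

section \<open>Operators on the Hilbert--Schmidt space\<close>

lemma sum_div_mod:
  fixes f :: "nat \<Rightarrow> nat \<Rightarrow> 'a :: comm_monoid_add"
  shows "(\<Sum>i<k * d. f (i div d) (i mod d)) = (\<Sum>a<k. \<Sum>b<d. f a b)"
proof (cases "d = 0")
  case False
  have "(\<Sum>i<k * d. f (i div d) (i mod d)) = (\<Sum>a<k. \<Sum>i\<in>{a * d..<a * d + d}. f (i div d) (i mod d))"
    by (rule sum.nat_group[symmetric])
  also have "\<dots> = (\<Sum>a<k. \<Sum>b<d. f a b)"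
  proof (rule sum.cong[OF refl])
    fix a
    have "(\<Sum>i\<in>{a * d..<a * d + d}. f (i div d) (i mod d)) = (\<Sum>b\<in>{0..<d}. f ((b + a * d) div d) ((b + a * d) mod d))"
      using sum.shift_bounds_nat_ivl[of "\<lambda>i. f (i div d) (i mod d)" 0 "a * d" d] by (simp add: add.commute)
    then show "(\<Sum>i\<in>{a * d..<a * d + d}. f (i div d) (i mod d)) = (\<Sum>b<d. f a b)"
      using False by (simp add: lessThan_atLeast0)
  qed
  finally show ?thesis .
qed simp

lemma div_mod_bounds:
  assumes "(r :: nat) < k * d"
  shows "r div d < k" "r mod d < d"
proof -
  have "d > 0" using assms by (cases d) auto
  then show "r div d < k" "r mod d < d" using assms by (auto simp: less_mult_imp_div_less)
qed

lemma div_mod_eq_iff: "(r :: nat) div d = c div d \<and> r mod d = c mod d \<longleftrightarrow> r = c"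
  by (metis div_mult_mod_eq)

lemma tensor_bar_carrier [simp]: "tensor_bar N x y \<in> carrier_mat (N * N) (N * N)"
  by (simp add: tensor_bar_def hs_op_def)

lemma tensor_bar_index:
  assumes "x \<in> carrier_mat N N" "y \<in> carrier_mat N N" "r < N * N" "c < N * N"
  shows "tensor_bar N x y $$ (r, c) = x $$ (r div N, c div N) * cnj (y $$ (r mod N, c mod N))"
proof -
  note rb = div_mod_bounds[OF assms(3)] and cb = div_mod_bounds[OF assms(4)]
  have "tensor_bar N x y $$ (r, c) = (x * mat_unit N c * mat_adjoint y) $$ (r div N, r mod N)"
    using assms by (simp add: tensor_bar_def hs_op_def)
  also have "\<dots> = (\<Sum>(a, b)\<in>{..<N} \<times> {..<N}. x $$ (r div N, a) * mat_adjoint y $$ (b, r mod N) * mat_unit N c $$ (a, b))"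
    by (rule mat_mult3_index) (use assms rb in \<open>auto simp: mat_unit_def\<close>)
  also have "\<dots> = (\<Sum>ab\<in>{..<N} \<times> {..<N}. if ab = (c div N, c mod N) then x $$ (r div N, c div N) * cnj (y $$ (r mod N, c mod N)) else 0)"
  proof (intro sum.cong refl)
    fix ab assume "ab \<in> {..<N} \<times> {..<N}"
    then obtain a b where "ab = (a, b)" "a < N" "b < N" by auto
    then show "(case ab of (a, b) \<Rightarrow> x $$ (r div N, a) * mat_adjoint y $$ (b, r mod N) * mat_unit N c $$ (a, b))
        = (if ab = (c div N, c mod N) then x $$ (r div N, c div N) * cnj (y $$ (r mod N, c mod N)) else 0)"
      using assms(2) rb by (cases "a = c div N \<and> b = c mod N") (auto simp: mat_unit_def)
  qed
  also have "\<dots> = x $$ (r div N, c div N) * cnj (y $$ (r mod N, c mod N))"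
    using cb by simp
  finally show ?thesis .
qed

lemma proj_id_carrier [simp]: "proj_id N \<in> carrier_mat (N * N) (N * N)"
  by (simp add: proj_id_def hs_op_def)

text \<open>The unit vector spanning the line is the identity matrix divided by sqrt N, whence the
  value 1/N on pairs of diagonal positions.\<close>

lemma proj_id_index:
  assumes "r < N * N" "c < N * N"
  shows "proj_id N $$ (r, c) = (if r div N = r mod N \<and> c div N = c mod N then 1 / of_nat N else 0)"
proof -
  note rb = div_mod_bounds[OF assms(1)] and cb = div_mod_bounds[OF assms(2)]
  have 1: "hs_inner (1\<^sub>m N) (1\<^sub>m N) = of_nat N"
    by (simp add: hs_inner_def mat_trace_def)
  have E: "mat_unit N c \<in> carrier_mat N N" by (simp add: mat_unit_def)
  have "hs_inner (mat_unit N c) (1\<^sub>m N) = (\<Sum>i<N. if i = c div N then (if c div N = c mod N then 1 else 0) else 0)"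
    using E by (auto simp: hs_inner_def mat_trace_def right_mult_one_mat[OF E]) (auto simp: mat_unit_def intro!: sum.cong)
  then have 2: "hs_inner (mat_unit N c) (1\<^sub>m N) = (if c div N = c mod N then 1 else 0)"
    using cb by simp
  show ?thesis
    using assms rb by (simp add: proj_id_def hs_op_def 1 2)
qed

lemma proj_id_square: "proj_id N * proj_id N = proj_id N"
proof (rule eq_matI)
  let ?P = "proj_id N"
  fix r c assume "r < dim_row ?P" "c < dim_col ?P"
  then have rc: "r < N * N" "c < N * N" by (simp_all add: carrier_matD[OF proj_id_carrier])
  then have N: "N > 0" by (cases N) auto
  have "(?P * ?P) $$ (r, c) = (\<Sum>m<N * N. ?P $$ (r, m) * ?P $$ (m, c))"
    by (rule index_mult_mat_sum[OF proj_id_carrier proj_id_carrier rc])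
  also have "\<dots> = (\<Sum>m<N * N. (\<lambda>a b. if a = b then ?P $$ (r, c) / of_nat N else 0) (m div N) (m mod N))"
    using rc by (intro sum.cong) (auto simp: proj_id_index)
  also have "\<dots> = (\<Sum>a<N. \<Sum>b<N. if a = b then ?P $$ (r, c) / of_nat N else 0)"
    by (rule sum_div_mod)
  also have "\<dots> = ?P $$ (r, c)" using N by simp
  finally show "(?P * ?P) $$ (r, c) = ?P $$ (r, c)" .
qed (simp_all add: carrier_matD[OF proj_id_carrier])

abbreviation (input) compl_proj :: "nat \<Rightarrow> complex mat" where
  "compl_proj N \<equiv> 1\<^sub>m (N * N) - proj_id N"

lemma compl_proj_carrier [simp]: "compl_proj N \<in> carrier_mat (N * N) (N * N)"
  by (rule minus_carrier_mat) simp

lemma proj_compl_proj: "proj_id N * compl_proj N = 0\<^sub>m (N * N) (N * N)"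
proof -
  have "proj_id N * compl_proj N = proj_id N * 1\<^sub>m (N * N) - proj_id N * proj_id N"
    by (rule mult_minus_distrib_mat[OF proj_id_carrier one_carrier_mat proj_id_carrier])
  also have "\<dots> = 0\<^sub>m (N * N) (N * N)"
    unfolding proj_id_square right_mult_one_mat[OF proj_id_carrier] by (intro eq_matI) (auto simp: carrier_matD[OF proj_id_carrier])
  finally show ?thesis .
qed

text \<open>The projection \<open>1 - P\<close> is the mean of the identity and this unitary, hence does not increase the norm.\<close>

definition reflection :: "nat \<Rightarrow> complex mat" where
  "reflection N = compl_proj N - proj_id N"

lemma reflection_carrier [simp]: "reflection N \<in> carrier_mat (N * N) (N * N)"
  unfolding reflection_def by (rule minus_carrier_mat) simp

lemma reflection_unitary: "reflection N \<in> unitary_mats (N * N)"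
proof -
  let ?P = "proj_id N" and ?Q = "compl_proj N" and ?d = "N * N"
  have PQ: "?Q * ?P = 0\<^sub>m ?d ?d"
  proof -
    have "?Q * ?P = 1\<^sub>m ?d * ?P - ?P * ?P"
      by (rule minus_mult_distrib_mat[OF one_carrier_mat proj_id_carrier proj_id_carrier])
    also have "\<dots> = 0\<^sub>m ?d ?d"
      unfolding proj_id_square left_mult_one_mat[OF proj_id_carrier] by (intro eq_matI) (auto simp: carrier_matD[OF proj_id_carrier])
    finally show ?thesis .
  qed
  have QQ: "?Q * ?Q = ?Q"
  proof -
    have "?Q * ?Q = 1\<^sub>m ?d * ?Q - ?P * ?Q"
      by (rule minus_mult_distrib_mat[OF one_carrier_mat proj_id_carrier compl_proj_carrier])
    also have "\<dots> = ?Q" unfolding proj_compl_proj left_mult_one_mat[OF compl_proj_carrier]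
      by (intro eq_matI) (auto simp: carrier_matD[OF proj_id_carrier])
    finally show ?thesis .
  qed
  have "reflection N * reflection N = (?Q - ?P) * ?Q - (?Q - ?P) * ?P"
    unfolding reflection_def
    by (rule mult_minus_distrib_mat[OF reflection_carrier[unfolded reflection_def] compl_proj_carrier proj_id_carrier])
  also have "(?Q - ?P) * ?Q = ?Q * ?Q - ?P * ?Q"
    by (rule minus_mult_distrib_mat[OF compl_proj_carrier proj_id_carrier compl_proj_carrier])
  also have "(?Q - ?P) * ?P = ?Q * ?P - ?P * ?P"
    by (rule minus_mult_distrib_mat[OF compl_proj_carrier proj_id_carrier proj_id_carrier])
  finally have sq: "reflection N * reflection N = 1\<^sub>m ?d"
    unfolding QQ PQ proj_compl_proj proj_id_square by (intro eq_matI) (auto simp: carrier_matD[OF proj_id_carrier])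
  have "mat_adjoint (reflection N) = reflection N"
    by (rule eq_matI) (auto simp: reflection_def carrier_matD[OF proj_id_carrier] proj_id_index)
  then show ?thesis using sq by (simp add: unitary_mats_def)
qed

lemma tensor_bar_mult:
  assumes "x \<in> carrier_mat N N" "x' \<in> carrier_mat N N" "y \<in> carrier_mat N N" "y' \<in> carrier_mat N N"
  shows "tensor_bar N (x * x') (y * y') = tensor_bar N x y * tensor_bar N x' y'"
proof (rule eq_matI)
  let ?T = "tensor_bar N x y * tensor_bar N x' y'"
  fix r c assume "r < dim_row ?T" "c < dim_col ?T"
  then have rc: "r < N * N" "c < N * N" by (simp_all add: carrier_matD[OF tensor_bar_carrier])
  note rb = div_mod_bounds[OF rc(1)] and cb = div_mod_bounds[OF rc(2)]
  have "?T $$ (r, c) = (\<Sum>m<N * N. tensor_bar N x y $$ (r, m) * tensor_bar N x' y' $$ (m, c))"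
    by (rule index_mult_mat_sum[OF tensor_bar_carrier tensor_bar_carrier rc])
  also have "\<dots> = (\<Sum>m<N * N. (\<lambda>a b. x $$ (r div N, a) * cnj (y $$ (r mod N, b)) * (x' $$ (a, c div N) * cnj (y' $$ (b, c mod N)))) (m div N) (m mod N))"
    using rc assms by (intro sum.cong) (auto simp: tensor_bar_index)
  also have "\<dots> = (\<Sum>a<N. \<Sum>b<N. x $$ (r div N, a) * cnj (y $$ (r mod N, b)) * (x' $$ (a, c div N) * cnj (y' $$ (b, c mod N))))"
    by (rule sum_div_mod)
  also have "\<dots> = (\<Sum>a<N. x $$ (r div N, a) * x' $$ (a, c div N)) * cnj (\<Sum>b<N. y $$ (r mod N, b) * y' $$ (b, c mod N))"
    by (simp add: sum_product mult_ac)
  also have "\<dots> = tensor_bar N (x * x') (y * y') $$ (r, c)"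
    using assms rb cb rc
    by (simp add: tensor_bar_index[OF mult_carrier_mat[OF assms(1,2)] mult_carrier_mat[OF assms(3,4)]]
      index_mult_mat_sum[OF assms(1,2)] index_mult_mat_sum[OF assms(3,4)] del: index_mult_mat(1))
  finally show "tensor_bar N (x * x') (y * y') $$ (r, c) = ?T $$ (r, c)" by simp
qed (simp_all add: carrier_matD[OF tensor_bar_carrier])

section \<open>Measurable random matrices and their means\<close>

definition mat_meas :: "nat \<Rightarrow> 'a measure \<Rightarrow> ('a \<Rightarrow> complex mat) \<Rightarrow> bool" where
  "mat_meas d M F \<longleftrightarrow> (\<forall>x\<in>space M. F x \<in> carrier_mat d d) \<and>
     (\<forall>r<d. \<forall>c<d. (\<lambda>x. F x $$ (r, c)) \<in> borel_measurable M)"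

lemma mat_meas_const: "A \<in> carrier_mat d d \<Longrightarrow> mat_meas d M (\<lambda>_. A)"
  by (simp add: mat_meas_def)

lemma mat_meas_mult: "mat_meas d M F \<Longrightarrow> mat_meas d M G \<Longrightarrow> mat_meas d M (\<lambda>x. F x * G x)"
  by (auto simp: mat_meas_def simp del: index_mult_mat(1) intro!: measurable_mult_entry)

lemma mat_meas_adjoint: "mat_meas d M F \<Longrightarrow> mat_meas d M (\<lambda>x. mat_adjoint (F x))"
  unfolding mat_meas_def by (auto intro!: measurable_adjoint_entry)

lemma mat_meas_minus:
  assumes "mat_meas d M F" "mat_meas d M G" shows "mat_meas d M (\<lambda>x. F x - G x)"
  unfolding mat_meas_def
proof (intro conjI allI impI ballI)
  fix r c assume rc: "r < d" "c < d"
  show "(\<lambda>x. (F x - G x) $$ (r, c)) \<in> borel_measurable M"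
  proof (rule measurable_eq_on)
    show "(\<lambda>x. F x $$ (r, c) - G x $$ (r, c)) \<in> borel_measurable M"
      using assms rc by (intro borel_measurable_diff) (auto simp: mat_meas_def)
    fix x assume "x \<in> space M"
    then have "G x \<in> carrier_mat d d" using assms by (auto simp: mat_meas_def)
    then show "(F x - G x) $$ (r, c) = F x $$ (r, c) - G x $$ (r, c)" using rc by simp
  qed
qed (use assms in \<open>auto simp: mat_meas_def intro: minus_carrier_mat\<close>)

lemma mat_meas_smult:
  assumes "mat_meas d M F" "g \<in> borel_measurable M" shows "mat_meas d M (\<lambda>x. complex_of_real (g x) \<cdot>\<^sub>m F x)"
  unfolding mat_meas_def
proof (intro conjI allI impI ballI)
  fix r c assume rc: "r < d" "c < d"
  show "(\<lambda>x. (complex_of_real (g x) \<cdot>\<^sub>m F x) $$ (r, c)) \<in> borel_measurable M"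
  proof (rule measurable_eq_on)
    show "(\<lambda>x. complex_of_real (g x) * F x $$ (r, c)) \<in> borel_measurable M"
      using assms rc by (intro borel_measurable_times borel_measurable_of_real) (auto simp: mat_meas_def)
    fix x assume "x \<in> space M"
    then have "F x \<in> carrier_mat d d" using assms by (auto simp: mat_meas_def)
    then show "(complex_of_real (g x) \<cdot>\<^sub>m F x) $$ (r, c) = complex_of_real (g x) * F x $$ (r, c)" using rc by simp
  qed
qed (use assms in \<open>auto simp: mat_meas_def\<close>)

lemma mat_meas_compose:
  assumes "mat_meas d M F" "g \<in> measurable M' M" shows "mat_meas d M' (\<lambda>x. F (g x))"
  using assms measurable_space[OF assms(2)] by (auto simp: mat_meas_def intro: measurable_compose[OF assms(2)])

lemma mat_meas_tensor_bar:
  assumes "mat_meas N M F" "mat_meas N M G" shows "mat_meas (N * N) M (\<lambda>x. tensor_bar N (F x) (G x))"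
  unfolding mat_meas_def
proof (intro conjI allI impI ballI)
  fix r c assume rc: "r < N * N" "c < N * N"
  note rb = div_mod_bounds[OF rc(1)] and cb = div_mod_bounds[OF rc(2)]
  show "(\<lambda>x. tensor_bar N (F x) (G x) $$ (r, c)) \<in> borel_measurable M"
  proof (rule measurable_eq_on)
    show "(\<lambda>x. F x $$ (r div N, c div N) * cnj (G x $$ (r mod N, c mod N))) \<in> borel_measurable M"
      using assms rb cb by (intro borel_measurable_times borel_measurable_cnj) (auto simp: mat_meas_def)
    fix x assume "x \<in> space M"
    then have "F x \<in> carrier_mat N N" "G x \<in> carrier_mat N N" using assms by (auto simp: mat_meas_def)
    then show "tensor_bar N (F x) (G x) $$ (r, c) = F x $$ (r div N, c div N) * cnj (G x $$ (r mod N, c mod N))"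
      using rc by (rule tensor_bar_index)
  qed
qed simp

text \<open>The mean is taken entry by entry. The carrier conditions are part of the relation so
  that it is closed under differences and under products with constant matrices.\<close>

definition has_mat_expectation :: "nat \<Rightarrow> 'a measure \<Rightarrow> ('a \<Rightarrow> complex mat) \<Rightarrow> complex mat \<Rightarrow> bool" where
  "has_mat_expectation d M Z E \<longleftrightarrow> E \<in> carrier_mat d d \<and> (\<forall>x\<in>space M. Z x \<in> carrier_mat d d) \<and>
     (\<forall>r<d. \<forall>c<d. has_bochner_integral M (\<lambda>x. Z x $$ (r, c)) (E $$ (r, c)))"

lemma has_bochner_integral_eq_on:
  assumes "has_bochner_integral M f x" "\<And>w. w \<in> space M \<Longrightarrow> g w = f w"
  shows "has_bochner_integral M g x"
  using has_bochner_integral_cong[of M M g f x x] assms by auto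

lemma has_mat_expectation_const:
  assumes "prob_space M" "A \<in> carrier_mat d d"
  shows "has_mat_expectation d M (\<lambda>_. A) A"
proof -
  interpret prob_space M by fact
  show ?thesis using assms(2) by (simp add: has_mat_expectation_def has_bochner_integral_iff prob_space)
qed

lemma has_mat_expectation_diff:
  assumes "has_mat_expectation d M Z E" "has_mat_expectation d M Z' E'"
  shows "has_mat_expectation d M (\<lambda>x. Z x - Z' x) (E - E')"
  unfolding has_mat_expectation_def
proof (intro conjI allI impI ballI)
  fix r c assume rc: "r < d" "c < d"
  have "(E - E') $$ (r, c) = E $$ (r, c) - E' $$ (r, c)" using assms rc by (auto simp: has_mat_expectation_def)
  moreover have "has_bochner_integral M (\<lambda>x. (Z x - Z' x) $$ (r, c)) (E $$ (r, c) - E' $$ (r, c))"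
  proof (rule has_bochner_integral_eq_on)
    show "has_bochner_integral M (\<lambda>x. Z x $$ (r, c) - Z' x $$ (r, c)) (E $$ (r, c) - E' $$ (r, c))"
      using assms rc by (intro has_bochner_integral_diff) (auto simp: has_mat_expectation_def)
    fix x assume "x \<in> space M"
    then have "Z' x \<in> carrier_mat d d" using assms by (auto simp: has_mat_expectation_def)
    then show "(Z x - Z' x) $$ (r, c) = Z x $$ (r, c) - Z' x $$ (r, c)" using rc by simp
  qed
  ultimately show "has_bochner_integral M (\<lambda>x. (Z x - Z' x) $$ (r, c)) ((E - E') $$ (r, c))" by simp
qed (use assms in \<open>auto simp: has_mat_expectation_def intro: minus_carrier_mat\<close>)

lemma has_mat_expectation_left:
  assumes "has_mat_expectation d M Z E" and A: "A \<in> carrier_mat d d"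
  shows "has_mat_expectation d M (\<lambda>x. A * Z x) (A * E)"
  unfolding has_mat_expectation_def
proof (intro conjI allI impI ballI)
  fix r c assume rc: "r < d" "c < d"
  have E: "E \<in> carrier_mat d d" using assms by (simp add: has_mat_expectation_def)
  show "has_bochner_integral M (\<lambda>x. (A * Z x) $$ (r, c)) ((A * E) $$ (r, c))"
    unfolding index_mult_mat_sum[OF A E rc]
  proof (rule has_bochner_integral_eq_on)
    show "has_bochner_integral M (\<lambda>x. \<Sum>k<d. A $$ (r, k) * Z x $$ (k, c)) (\<Sum>k<d. A $$ (r, k) * E $$ (k, c))"
      using assms rc by (intro has_bochner_integral_sum has_bochner_integral_mult_right) (auto simp: has_mat_expectation_def)
    fix x assume "x \<in> space M"
    then have "Z x \<in> carrier_mat d d" using assms by (auto simp: has_mat_expectation_def)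
    then show "(A * Z x) $$ (r, c) = (\<Sum>k<d. A $$ (r, k) * Z x $$ (k, c))" by (rule index_mult_mat_sum[OF A _ rc])
  qed
qed (use assms in \<open>auto simp: has_mat_expectation_def\<close>)

lemma has_mat_expectation_right:
  assumes "has_mat_expectation d M Z E" and A: "A \<in> carrier_mat d d"
  shows "has_mat_expectation d M (\<lambda>x. Z x * A) (E * A)"
  unfolding has_mat_expectation_def
proof (intro conjI allI impI ballI)
  fix r c assume rc: "r < d" "c < d"
  have E: "E \<in> carrier_mat d d" using assms by (simp add: has_mat_expectation_def)
  show "has_bochner_integral M (\<lambda>x. (Z x * A) $$ (r, c)) ((E * A) $$ (r, c))"
    unfolding index_mult_mat_sum[OF E A rc]
  proof (rule has_bochner_integral_eq_on)
    show "has_bochner_integral M (\<lambda>x. \<Sum>k<d. Z x $$ (r, k) * A $$ (k, c)) (\<Sum>k<d. E $$ (r, k) * A $$ (k, c))"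
      using assms rc by (intro has_bochner_integral_sum has_bochner_integral_mult_left) (auto simp: has_mat_expectation_def)
    fix x assume "x \<in> space M"
    then have "Z x \<in> carrier_mat d d" using assms by (auto simp: has_mat_expectation_def)
    then show "(Z x * A) $$ (r, c) = (\<Sum>k<d. Z x $$ (r, k) * A $$ (k, c))" by (rule index_mult_mat_sum[OF _ A rc])
  qed
qed (use assms in \<open>auto simp: has_mat_expectation_def\<close>)

lemma has_mat_expectation_smult:
  assumes g: "has_bochner_integral M g b" and A: "A \<in> carrier_mat d d"
  shows "has_mat_expectation d M (\<lambda>x. complex_of_real (g x) \<cdot>\<^sub>m A) (complex_of_real b \<cdot>\<^sub>m A)"
  using A by (auto simp: has_mat_expectation_def intro!: has_bochner_integral_mult_left has_bochner_integral_of_real g)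

lemma has_mat_expectation_component:
  assumes \<mu>: "prob_space \<mu>" and j: "j \<in> I" and Z: "has_mat_expectation d \<mu> Z E"
  shows "has_mat_expectation d (PiM I (\<lambda>_. \<mu>)) (\<lambda>U. Z (U j)) E"
proof -
  have d: "distr (PiM I (\<lambda>_. \<mu>)) \<mu> (\<lambda>U. U j) = \<mu>"
    by (rule distr_PiM_component[OF \<mu> j])
  have m: "(\<lambda>U. U j) \<in> measurable (PiM I (\<lambda>_. \<mu>)) \<mu>" using j by measurable
  have comp: "has_bochner_integral (PiM I (\<lambda>_. \<mu>)) (\<lambda>U. f (U j)) x" if "has_bochner_integral \<mu> f x" for f :: "_ \<Rightarrow> complex" and x
  proof -
    have f: "f \<in> borel_measurable \<mu>" using that by (simp add: has_bochner_integral_iff borel_measurable_integrable)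
    show ?thesis
      using that integrable_distr_eq[OF m f] integral_distr[OF m f] unfolding d has_bochner_integral_iff by simp
  qed
  have "has_bochner_integral (PiM I (\<lambda>_. \<mu>)) (\<lambda>U. Z (U j) $$ (r, c)) (E $$ (r, c))" if "r < d" "c < d" for r c
    by (rule comp[of "\<lambda>x. Z x $$ (r, c)"]) (use Z that in \<open>simp add: has_mat_expectation_def\<close>)
  then show ?thesis using Z measurable_space[OF m] by (auto simp: has_mat_expectation_def)
qed

lemma kron_carrier: "A \<in> carrier_mat k k \<Longrightarrow> B \<in> carrier_mat d d \<Longrightarrow> kron A B \<in> carrier_mat (k * d) (k * d)"
  by (simp add: kron_def)

lemma kron_index:
  assumes "A \<in> carrier_mat k k" "B \<in> carrier_mat d d" "r < k * d" "c < k * d"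
  shows "kron A B $$ (r, c) = A $$ (r div d, c div d) * B $$ (r mod d, c mod d)"
  using assms by (simp add: kron_def)

lemma kron_one_unitary:
  assumes W: "W \<in> unitary_mats d"
  shows "kron (1\<^sub>m k) W \<in> unitary_mats (k * d)"
proof (rule unitary_matsI)
  note Wc = unitary_matsD(1)[OF W]
  show "kron (1\<^sub>m k) W \<in> carrier_mat (k * d) (k * d)" using Wc by (intro kron_carrier) auto
  fix i j assume ij: "i < k * d" "j < k * d"
  note ib = div_mod_bounds[OF ij(1)] and jb = div_mod_bounds[OF ij(2)]
  have "(\<Sum>r<k * d. cnj (kron (1\<^sub>m k) W $$ (r, i)) * kron (1\<^sub>m k) W $$ (r, j))
     = (\<Sum>r<k * d. (\<lambda>a b. (if a = i div d \<and> a = j div d then cnj (W $$ (b, i mod d)) * W $$ (b, j mod d) else 0)) (r div d) (r mod d))"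
    using ij ib jb div_mod_bounds by (intro sum.cong) (auto simp: kron_index[OF one_carrier_mat Wc])
  also have "\<dots> = (\<Sum>a<k. \<Sum>b<d. if a = i div d \<and> a = j div d then cnj (W $$ (b, i mod d)) * W $$ (b, j mod d) else 0)"
    by (rule sum_div_mod)
  also have "\<dots> = (\<Sum>a<k. if a = i div d then (if i div d = j div d \<and> i mod d = j mod d then 1 else 0) else 0)"
    using unitary_mats_cols[OF W ib(2) jb(2)]
    by (intro sum.cong) (cases "i div d = j div d"; cases "i mod d = j mod d"; auto)+
  also have "\<dots> = (if i = j then 1 else 0)"
    unfolding div_mod_eq_iff using ib by simp
  finally show "(\<Sum>r<k * d. cnj (kron (1\<^sub>m k) W $$ (r, i)) * kron (1\<^sub>m k) W $$ (r, j)) = (if i = j then 1 else 0)" .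
qed

text \<open>The two tangent inequalities at the midpoint are added; their linear terms
  cancel.\<close>

lemma powr_sum_le:
  fixes x y p :: real
  assumes "p \<ge> 1" "x \<ge> 0" "y \<ge> 0"
  shows "(x + y) powr p \<le> 2 powr (p - 1) * (x powr p + y powr p)"
proof (cases "x + y = 0")
  case False
  define c where "c = (x + y) / 2"
  have c: "c > 0" using False assms by (simp add: c_def)
  have "x - c + (y - c) = 0" by (simp add: c_def)
  then have "p * c powr (p - 1) * (x - c) + p * c powr (p - 1) * (y - c) = 0"
    by (simp flip: distrib_left)
  then have "2 * c powr p \<le> x powr p + y powr p"
    using powr_tangent[OF assms(1) c assms(2)] powr_tangent[OF assms(1) c assms(3)] by linarith
  moreover have "(x + y) powr p = 2 powr (p - 1) * (2 * c powr p)"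
  proof -
    have "x + y = 2 * c" by (simp add: c_def)
    then have "(x + y) powr p = (2 * c) powr p" by (simp only:)
    also have "\<dots> = 2 powr p * c powr p" using c by (simp add: powr_mult)
    finally show ?thesis by (simp add: powr_diff)
  qed
  ultimately show ?thesis by simp
qed (use assms in simp)

text \<open>From Y = U s V^* one takes the unitary U V^* and H = V s V^*. The Haar average sees H
  only through its trace and its Hilbert-Schmidt norm, and these are the two quantities in
  \<open>haar_coeff\<close>.\<close>

lemma polar_decomposition:
  assumes "Y \<in> carrier_mat n n"
  obtains V H where "V \<in> unitary_mats n" "H \<in> carrier_mat n n" "Y = V * H"
    "mat_trace H = of_real (schatten_norm 1 Y)" "hs_sq n H = hs_sq n Y" "0 \<le> schatten_norm 1 Y"
proof -
  obtain U V s where U: "U \<in> unitary_mats n" and V: "V \<in> unitary_mats n" and s: "\<And>i. s i \<ge> 0"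
    and Yeq: "Y = U * mat_diag n (\<lambda>i. of_real (s i)) * mat_adjoint V"
    using singular_value_decomposition[OF assms] by metis
  note Uc = unitary_matsD[OF U] and Vc = unitary_matsD[OF V]
  let ?D = "mat_diag n (\<lambda>i. complex_of_real (s i))"
  have D: "?D \<in> carrier_mat n n" by (simp add: mat_diag_def)
  define W H where "W = U * mat_adjoint V" and "H = V * ?D * mat_adjoint V"
  have "W * H = U * (mat_adjoint V * V) * ?D * mat_adjoint V"
    using Uc(1) Vc(1,2) D by (simp add: W_def H_def assoc_mult_mat[of _ n n _ n _ n] mult_carrier_mat[of _ n n _ n])
  then have 1: "Y = W * H" using Uc(1) Vc(4) by (simp add: Yeq)
  have 2: "W \<in> unitary_mats n" unfolding W_def by (intro unitary_mats_mult unitary_mats_adjoint U V)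
  have 3: "H \<in> carrier_mat n n" using Vc D by (auto simp: H_def intro!: mult_carrier_mat)
  show ?thesis
    using that[OF 2 3 1] svd_power_sums[OF V V s H_def] svd_power_sums[OF U V s Yeq] mat_trace_diag_conj[OF V, of "\<lambda>i. of_real (s i)"] s
    by (simp add: H_def sum_nonneg)
qed

text \<open>The only nonzero second moments are those of an entry with itself, equal to 1/N, and
  they sit exactly where the matrix of P has the entry 1/N.\<close>

lemma gaussian_tensor_expectation:
  assumes "N \<ge> 1"
  shows "has_mat_expectation (N * N) (gaussian_mat N) (\<lambda>Y. tensor_bar N Y Y) (proj_id N)"
  unfolding has_mat_expectation_def
proof (intro conjI allI impI ballI)
  fix r c assume rc: "r < N * N" "c < N * N"
  note rb = div_mod_bounds[OF rc(1)] and cb = div_mod_bounds[OF rc(2)]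
  show "has_bochner_integral (gaussian_mat N) (\<lambda>Y. tensor_bar N Y Y $$ (r, c)) (proj_id N $$ (r, c))"
  proof (rule has_bochner_integral_eq_on)
    show "has_bochner_integral (gaussian_mat N) (\<lambda>Y. Y $$ (r div N, c div N) * cnj (Y $$ (r mod N, c mod N))) (proj_id N $$ (r, c))"
      using gaussian_second_moment[OF rb(1) cb(1) rb(2) cb(2)] rc by (simp add: has_bochner_integral_iff proj_id_index)
    fix Y assume "Y \<in> space (gaussian_mat N)"
    then show "tensor_bar N Y Y $$ (r, c) = Y $$ (r div N, c div N) * cnj (Y $$ (r mod N, c mod N))"
      using rc by (intro tensor_bar_index) auto
  qed
qed auto

text \<open>Multiplicativity of \<open>tensor_bar\<close> pulls the factor A out of the average; the
  rest is a combination of the identity operator and P, and P disappears against 1 - P.\<close>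

lemma haar_tensor_expectation:
  assumes \<mu>: "is_haar_unitary N \<mu>" and N: "N \<ge> 2" and H: "H \<in> carrier_mat N N"
    and A: "A \<in> unitary_mats N" and tr: "mat_trace H = of_real (schatten_norm 1 Y)" and hs: "hs_sq N H = hs_sq N Y"
  shows "has_mat_expectation (N * N) \<mu>
     (\<lambda>R. tensor_bar N (A * (mat_adjoint R * H * R)) (A * (mat_adjoint R * H * R)) * compl_proj N)
     (of_real (haar_coeff N Y) \<cdot>\<^sub>m (tensor_bar N A A * compl_proj N))"
proof -
  let ?d = "N * N" and ?X = "\<lambda>R. mat_adjoint R * H * R" and ?Q = "compl_proj N" and ?P = "proj_id N"
  let ?x = "complex_of_real (haar_coeff N Y)"
  note Ac = unitary_matsD(1)[OF A]
  have X: "?X R \<in> carrier_mat N N" if "R \<in> space \<mu>" for R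
    using that H unitary_matsD(1,2)[of R N] by (auto simp: haar_unitaryD(2)[OF \<mu>] intro!: mult_carrier_mat)
  have coeff: "((cmod (mat_trace H))\<^sup>2 - hs_sq N H / real N) / ((real N)\<^sup>2 - 1) = haar_coeff N Y"
    by (simp add: haar_coeff_def tr hs)
  obtain y where y: "\<And>a b c d. a < N \<Longrightarrow> b < N \<Longrightarrow> c < N \<Longrightarrow> d < N \<Longrightarrow>
    (\<integral>R. ?X R $$ (a, b) * cnj (?X R $$ (c, d)) \<partial>\<mu>) = (if a = b \<and> c = d then ?x else 0) + (if a = c \<and> b = d then y else 0)"
    using haar_conj_moment[OF \<mu> H N, unfolded coeff] by blast
  \<comment> \<open>The factor \<open>of_nat N\<close> compensates the entries 1/N of P.\<close>
  define E where "E = ?x \<cdot>\<^sub>m 1\<^sub>m ?d + (y * of_nat N) \<cdot>\<^sub>m ?P"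
  have E: "E \<in> carrier_mat ?d ?d" by (simp add: E_def)
  have exp: "has_mat_expectation ?d \<mu> (\<lambda>R. tensor_bar N (?X R) (?X R)) E"
    unfolding has_mat_expectation_def
  proof (intro conjI allI impI ballI E)
    fix r c assume rc: "r < ?d" "c < ?d"
    note rb = div_mod_bounds[OF rc(1)] and cb = div_mod_bounds[OF rc(2)]
    show "has_bochner_integral \<mu> (\<lambda>R. tensor_bar N (?X R) (?X R) $$ (r, c)) (E $$ (r, c))"
    proof (rule has_bochner_integral_eq_on)
      have "E $$ (r, c) = (if r div N = c div N \<and> r mod N = c mod N then ?x else 0) + (if r div N = r mod N \<and> c div N = c mod N then y else 0)"
        unfolding div_mod_eq_iff using rc N by (simp add: E_def proj_id_index carrier_matD[OF proj_id_carrier])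
      then show "has_bochner_integral \<mu> (\<lambda>R. ?X R $$ (r div N, c div N) * cnj (?X R $$ (r mod N, c mod N))) (E $$ (r, c))"
        unfolding has_bochner_integral_iff
        using conj_moment_integrable[OF \<mu> H N rb(1) cb(1) rb(2) cb(2)] y[OF rb(1) cb(1) rb(2) cb(2)] by (simp del: index_mult_mat(1))
      fix R assume "R \<in> space \<mu>"
      from X[OF this] show "tensor_bar N (?X R) (?X R) $$ (r, c) = ?X R $$ (r div N, c div N) * cnj (?X R $$ (r mod N, c mod N))"
        using rc by (intro tensor_bar_index)
    qed
  qed auto
  have EQ: "E * ?Q = ?x \<cdot>\<^sub>m ?Q"
  proof -
    have "E * ?Q = ?x \<cdot>\<^sub>m 1\<^sub>m ?d * ?Q + (y * of_nat N) \<cdot>\<^sub>m ?P * ?Q"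
      unfolding E_def by (rule add_mult_distrib_mat[where nr = ?d and n = ?d and nc = ?d]) simp_all
    also have "?x \<cdot>\<^sub>m 1\<^sub>m ?d * ?Q = ?x \<cdot>\<^sub>m (1\<^sub>m ?d * ?Q)"
      by (rule mult_smult_assoc_mat[where nr = ?d and n = ?d and nc = ?d]) simp_all
    also have "(y * of_nat N) \<cdot>\<^sub>m ?P * ?Q = (y * of_nat N) \<cdot>\<^sub>m (?P * ?Q)"
      by (rule mult_smult_assoc_mat[where nr = ?d and n = ?d and nc = ?d]) simp_all
    finally show ?thesis
      unfolding proj_compl_proj left_mult_one_mat[OF compl_proj_carrier]
      by (intro eq_matI) (auto simp: carrier_matD[OF proj_id_carrier])
  qed
  have "has_mat_expectation ?d \<mu> (\<lambda>R. tensor_bar N A A * (tensor_bar N (?X R) (?X R) * ?Q)) (tensor_bar N A A * (E * ?Q))"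
    by (intro has_mat_expectation_left has_mat_expectation_right exp) simp_all
  moreover have "tensor_bar N A A * (E * ?Q) = ?x \<cdot>\<^sub>m (tensor_bar N A A * ?Q)"
    unfolding EQ by (rule mult_smult_distrib[where nr = ?d and n = ?d and nc = ?d]) simp_all
  moreover have "tensor_bar N A A * (tensor_bar N (?X R) (?X R) * ?Q) = tensor_bar N (A * ?X R) (A * ?X R) * ?Q" if "R \<in> space \<mu>" for R
    unfolding tensor_bar_mult[OF Ac X[OF that] Ac X[OF that]]
    by (rule assoc_mult_mat[symmetric]) (rule tensor_bar_carrier compl_proj_carrier)+
  ultimately show ?thesis
    by (simp add: has_mat_expectation_def cong: has_bochner_integral_cong)
qed

section \<open>Sums with matrix coefficients and the moments of their norms\<close>

locale tensor_family =
  fixes k N :: nat and I :: "nat set" and a :: "nat \<Rightarrow> complex mat" and q :: ennreal and p :: real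
  assumes fin: "finite I" and a: "\<And>j. j \<in> I \<Longrightarrow> a j \<in> carrier_mat k k" and q: "q \<ge> 1" and p: "p \<ge> 1" and N: "N \<ge> 1"
begin

abbreviation "D \<equiv> N * N"
abbreviation "Q \<equiv> compl_proj N"
abbreviation "tb \<equiv> tensor_bar N"

definition family_sum :: "(nat \<Rightarrow> complex mat) \<Rightarrow> complex mat" where
  "family_sum T = mat_sum (k * D) (\<lambda>j. kron (a j) (T j)) I"

definition cost :: "(nat \<Rightarrow> complex mat) \<Rightarrow> real" where
  "cost T = schatten_norm q (family_sum T) powr p"

lemma family_sum_carrier [simp]: "family_sum T \<in> carrier_mat (k * D) (k * D)"
  by (simp add: family_sum_def mat_sum_def)

lemma family_sum_index:
  assumes "\<And>j. j \<in> I \<Longrightarrow> T j \<in> carrier_mat D D" "r < k * D" "c < k * D"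
  shows "family_sum T $$ (r, c) = (\<Sum>j\<in>I. a j $$ (r div D, c div D) * T j $$ (r mod D, c mod D))"
  using assms(2,3) by (simp add: family_sum_def mat_sum_def kron_index[OF a assms(1)])

lemma cost_cong: "(\<And>j. j \<in> I \<Longrightarrow> T j = S j) \<Longrightarrow> cost T = cost S"
  unfolding cost_def family_sum_def mat_sum_def by (auto intro!: arg_cong[of _ _ "schatten_norm q"] sum.cong arg_cong2[where f = "(powr)"])

lemma norm_supported: "supported_norm (k * D) (schatten_norm q)"
  by (rule schatten_supported[OF q])

lemma norm_nonneg: "0 \<le> schatten_norm q (family_sum T)"
  by (rule supported_normD(1)[OF norm_supported family_sum_carrier])

lemma family_sum_mult:
  assumes T: "\<And>j. j \<in> I \<Longrightarrow> T j \<in> carrier_mat D D" and W: "W \<in> carrier_mat D D"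
  shows "family_sum (\<lambda>j. T j * W) = family_sum T * kron (1\<^sub>m k) W"
proof (rule eq_matI)
  let ?K = "kron (1\<^sub>m k) W"
  have K: "?K \<in> carrier_mat (k * D) (k * D)" by (rule kron_carrier[OF one_carrier_mat W])
  fix r c assume "r < dim_row (family_sum T * ?K)" "c < dim_col (family_sum T * ?K)"
  then have rc: "r < k * D" "c < k * D" using K carrier_matD[OF family_sum_carrier[of T]] by auto
  note rb = div_mod_bounds[OF rc(1)] and cb = div_mod_bounds[OF rc(2)]
  have "(family_sum T * ?K) $$ (r, c) = (\<Sum>m<k * D. family_sum T $$ (r, m) * ?K $$ (m, c))"
    by (rule index_mult_mat_sum[OF family_sum_carrier K rc])
  also have "\<dots> = (\<Sum>m<k * D. (\<lambda>x y. (\<Sum>j\<in>I. a j $$ (r div D, x) * T j $$ (r mod D, y)) * (if x = c div D then W $$ (y, c mod D) else 0)) (m div D) (m mod D))"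
  proof (intro sum.cong refl)
    fix m assume "m \<in> {..<k * D}"
    then have m: "m < k * D" by simp
    have "?K $$ (m, c) = (if m div D = c div D then W $$ (m mod D, c mod D) else 0)"
      using cb div_mod_bounds[OF m] by (simp add: kron_index[OF one_carrier_mat W m rc(2)])
    then show "family_sum T $$ (r, m) * ?K $$ (m, c) = (\<lambda>x y. (\<Sum>j\<in>I. a j $$ (r div D, x) * T j $$ (r mod D, y)) * (if x = c div D then W $$ (y, c mod D) else 0)) (m div D) (m mod D)"
      by (simp only: family_sum_index[OF T rc(1) m])
  qed
  also have "\<dots> = (\<Sum>x<k. \<Sum>y<D. (\<Sum>j\<in>I. a j $$ (r div D, x) * T j $$ (r mod D, y)) * (if x = c div D then W $$ (y, c mod D) else 0))"
    by (rule sum_div_mod)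
  also have "\<dots> = (\<Sum>x<k. if x = c div D then (\<Sum>y<D. (\<Sum>j\<in>I. a j $$ (r div D, c div D) * T j $$ (r mod D, y)) * W $$ (y, c mod D)) else 0)"
    by (intro sum.cong refl) auto
  also have "\<dots> = (\<Sum>y<D. (\<Sum>j\<in>I. a j $$ (r div D, c div D) * T j $$ (r mod D, y)) * W $$ (y, c mod D))"
    using cb by simp
  also have "\<dots> = (\<Sum>j\<in>I. a j $$ (r div D, c div D) * (\<Sum>y<D. T j $$ (r mod D, y) * W $$ (y, c mod D)))"
    unfolding sum_distrib_right by (subst sum.swap) (simp add: sum_distrib_left mult_ac)
  also have "\<dots> = (\<Sum>j\<in>I. a j $$ (r div D, c div D) * (T j * W) $$ (r mod D, c mod D))"
    by (intro sum.cong arg_cong2[where f = "(*)"] refl index_mult_mat_sum[OF T W rb(2) cb(2), symmetric])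
  also have "\<dots> = family_sum (\<lambda>j. T j * W) $$ (r, c)"
    by (rule family_sum_index[OF mult_carrier_mat[OF T W] rc, symmetric])
  finally show "family_sum (\<lambda>j. T j * W) $$ (r, c) = (family_sum T * ?K) $$ (r, c)" by simp
qed (use kron_carrier[OF one_carrier_mat W, of k] carrier_matD[OF family_sum_carrier] in auto)

lemma cost_compl_proj:
  assumes T: "\<And>j. j \<in> I \<Longrightarrow> T j \<in> carrier_mat D D"
  shows "cost (\<lambda>j. T j * Q) \<le> cost T"
proof -
  let ?K = "kron (1\<^sub>m k) (reflection N)" and ?d = "k * D" and ?P = "proj_id N"
  have K: "?K \<in> unitary_mats ?d" by (rule kron_one_unitary[OF reflection_unitary])
  note Kc = unitary_matsD(1)[OF K]
  have TR: "family_sum T * ?K = family_sum (\<lambda>j. T j * reflection N)"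
    using T by (rule family_sum_mult[symmetric]) simp_all
  have QP: "Q + ?P = 1\<^sub>m D" by (rule eq_matI) (auto simp: carrier_matD[OF proj_id_carrier])
  have "family_sum (\<lambda>j. T j * Q) = complex_of_real (1 / 2) \<cdot>\<^sub>m (family_sum T + family_sum T * ?K)"
  proof (rule eq_matI)
    fix r c assume "r < dim_row (complex_of_real (1 / 2) \<cdot>\<^sub>m (family_sum T + family_sum T * ?K))"
      "c < dim_col (complex_of_real (1 / 2) \<cdot>\<^sub>m (family_sum T + family_sum T * ?K))"
    then have rc: "r < ?d" "c < ?d" using Kc carrier_matD[OF family_sum_carrier[of T]] by auto
    note rb = div_mod_bounds[OF rc(1)] and cb = div_mod_bounds[OF rc(2)]
    \<comment> \<open>T is the sum of T (1 - P) and T P, and T times the reflection is their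
      difference; together they make 2 T (1 - P).\<close>
    have ent: "T j $$ (r mod D, c mod D) + (T j * reflection N) $$ (r mod D, c mod D) = 2 * (T j * Q) $$ (r mod D, c mod D)" if j: "j \<in> I" for j
    proof -
      have TPc: "T j * ?P \<in> carrier_mat D D" by (rule mult_carrier_mat[OF T[OF j] proj_id_carrier])
      have "T j = T j * (Q + ?P)" unfolding QP using T[OF j] by simp
      also have "\<dots> = T j * Q + T j * ?P"
        by (rule mult_add_distrib_mat[OF T[OF j] compl_proj_carrier proj_id_carrier])
      finally have 1: "T j $$ (r mod D, c mod D) = (T j * Q + T j * ?P) $$ (r mod D, c mod D)" by (rule arg_cong)
      have 2: "T j * reflection N = T j * Q - T j * ?P"
        unfolding reflection_def by (rule mult_minus_distrib_mat[OF T[OF j] compl_proj_carrier proj_id_carrier])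
      show ?thesis unfolding 1 2
        using rb cb carrier_matD[OF TPc] by (subst index_add_mat(1), simp, simp, subst index_minus_mat(1)) simp_all
    qed
    have "(complex_of_real (1 / 2) \<cdot>\<^sub>m (family_sum T + family_sum T * ?K)) $$ (r, c)
      = 1 / 2 * (family_sum T $$ (r, c) + family_sum (\<lambda>j. T j * reflection N) $$ (r, c))"
      unfolding TR using rc carrier_matD[OF family_sum_carrier] by simp
    also have "\<dots> = 1 / 2 * (\<Sum>j\<in>I. a j $$ (r div D, c div D) * (T j $$ (r mod D, c mod D) + (T j * reflection N) $$ (r mod D, c mod D)))"
      using T by (simp add: family_sum_index[OF _ rc] mult_carrier_mat[OF T reflection_carrier] distrib_left sum.distrib del: index_mult_mat(1))
    also have "\<dots> = (\<Sum>j\<in>I. a j $$ (r div D, c div D) * (T j * Q) $$ (r mod D, c mod D))"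
      unfolding sum_distrib_left by (intro sum.cong refl) (simp only: ent, simp)
    also have "\<dots> = family_sum (\<lambda>j. T j * Q) $$ (r, c)"
      by (rule family_sum_index[OF mult_carrier_mat[OF T compl_proj_carrier] rc, symmetric])
    finally show "family_sum (\<lambda>j. T j * Q) $$ (r, c) = (complex_of_real (1 / 2) \<cdot>\<^sub>m (family_sum T + family_sum T * ?K)) $$ (r, c)" by simp
  qed (use Kc carrier_matD[OF family_sum_carrier] in auto)
  then have "schatten_norm q (family_sum (\<lambda>j. T j * Q)) = 1 / 2 * schatten_norm q (family_sum T + family_sum T * ?K)"
    using supported_norm_smult[OF norm_supported add_carrier_mat[OF mult_carrier_mat[OF family_sum_carrier Kc]], of "1 / 2" "family_sum T" T]
    by simp
  also have "\<dots> \<le> 1 / 2 * (schatten_norm q (family_sum T) + schatten_norm q (family_sum T * ?K))"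
    using supported_norm_add[OF norm_supported family_sum_carrier mult_carrier_mat[OF family_sum_carrier Kc], of T T] by simp
  also have "schatten_norm q (family_sum T * ?K) = schatten_norm q (family_sum T)"
    by (rule schatten_norm_mult_unitary[OF family_sum_carrier K])
  finally show ?thesis
    unfolding cost_def using p by (intro powr_mono2 norm_nonneg) auto
qed

lemma cost_jensen:
  assumes M: "prob_space M" and T: "\<And>j. j \<in> I \<Longrightarrow> has_mat_expectation D M (\<lambda>\<omega>. T \<omega> j) (E j)"
  shows "ennreal (cost E) \<le> (\<integral>\<^sup>+\<omega>. ennreal (cost (T \<omega>)) \<partial>M)"
proof -
  have Tc: "T \<omega> j \<in> carrier_mat D D" if "\<omega> \<in> space M" "j \<in> I" for \<omega> j
    using T[OF that(2)] that(1) by (auto simp: has_mat_expectation_def)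
  have Ec: "E j \<in> carrier_mat D D" if "j \<in> I" for j
    using T[OF that] by (auto simp: has_mat_expectation_def)
  have hbi: "has_bochner_integral M (\<lambda>\<omega>. family_sum (T \<omega>) $$ (r, c)) (family_sum E $$ (r, c))" if rc: "r < k * D" "c < k * D" for r c
  proof -
    have 1: "has_bochner_integral M (\<lambda>\<omega>. \<Sum>j\<in>I. a j $$ (r div D, c div D) * T \<omega> j $$ (r mod D, c mod D))
      (\<Sum>j\<in>I. a j $$ (r div D, c div D) * E j $$ (r mod D, c mod D))"
      using T div_mod_bounds[OF rc(1)] div_mod_bounds[OF rc(2)]
      by (intro has_bochner_integral_sum has_bochner_integral_mult_right) (auto simp: has_mat_expectation_def)
    have 2: "family_sum E $$ (r, c) = (\<Sum>j\<in>I. a j $$ (r div D, c div D) * E j $$ (r mod D, c mod D))"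
      by (rule family_sum_index[OF Ec rc])
    have 3: "family_sum (T \<omega>) $$ (r, c) = (\<Sum>j\<in>I. a j $$ (r div D, c div D) * T \<omega> j $$ (r mod D, c mod D))" if "\<omega> \<in> space M" for \<omega>
      by (rule family_sum_index[OF Tc[OF that] rc])
    show ?thesis unfolding 2 by (rule has_bochner_integral_eq_on[OF 1 3])
  qed
  have "mat (k * D) (k * D) (\<lambda>rc. \<integral>\<omega>. family_sum (T \<omega>) $$ rc \<partial>M) = family_sum E"
    using hbi by (intro eq_matI) (auto simp: has_bochner_integral_iff carrier_matD[OF family_sum_carrier])
  then show ?thesis
    using supported_norm_jensen[OF M norm_supported p, of "\<lambda>\<omega>. family_sum (T \<omega>)"] hbi
    by (simp add: cost_def has_bochner_integral_iff)
qed

lemma borel_measurable_cost: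
  assumes "\<And>j. j \<in> I \<Longrightarrow> mat_meas D M (\<lambda>\<omega>. T \<omega> j)"
  shows "(\<lambda>\<omega>. ennreal (cost (T \<omega>))) \<in> borel_measurable M"
proof -
  have "(\<lambda>\<omega>. schatten_norm q (family_sum (T \<omega>))) \<in> borel_measurable M"
  proof (rule borel_measurable_supported_norm[OF norm_supported])
    fix r c assume rc: "r < k * D" "c < k * D"
    show "(\<lambda>\<omega>. family_sum (T \<omega>) $$ (r, c)) \<in> borel_measurable M"
    proof (rule measurable_eq_on)
      show "(\<lambda>\<omega>. \<Sum>j\<in>I. a j $$ (r div D, c div D) * T \<omega> j $$ (r mod D, c mod D)) \<in> borel_measurable M"
        using assms div_mod_bounds[OF rc(1)] div_mod_bounds[OF rc(2)]
        by (intro borel_measurable_sum borel_measurable_times borel_measurable_const) (auto simp: mat_meas_def)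
      show "family_sum (T \<omega>) $$ (r, c) = (\<Sum>j\<in>I. a j $$ (r div D, c div D) * T \<omega> j $$ (r mod D, c mod D))" if "\<omega> \<in> space M" for \<omega>
        using assms that by (intro family_sum_index rc) (auto simp: mat_meas_def)
    qed
  qed simp
  then show ?thesis unfolding cost_def by measurable
qed

text \<open>Triangle inequality and convexity of the p-th power. The exponent p - 1 leaves room for
  adding two equal terms in the decoupling, where the total becomes 2^p.\<close>

lemma cost_add:
  assumes A: "\<And>j. j \<in> I \<Longrightarrow> A j \<in> carrier_mat D D" and B: "\<And>j. j \<in> I \<Longrightarrow> B j \<in> carrier_mat D D"
  shows "cost (\<lambda>j. A j + B j) \<le> 2 powr (p - 1) * (cost A + cost B)"
proof -
  have "family_sum (\<lambda>j. A j + B j) = family_sum A + family_sum B"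
  proof (rule eq_matI)
    fix r c assume "r < dim_row (family_sum A + family_sum B)" "c < dim_col (family_sum A + family_sum B)"
    then have rc: "r < k * D" "c < k * D" using carrier_matD[OF family_sum_carrier] by auto
    have "(A j + B j) $$ (r mod D, c mod D) = A j $$ (r mod D, c mod D) + B j $$ (r mod D, c mod D)" if "j \<in> I" for j
      using B[OF that] div_mod_bounds[OF rc(1)] div_mod_bounds[OF rc(2)] by simp
    then show "family_sum (\<lambda>j. A j + B j) $$ (r, c) = (family_sum A + family_sum B) $$ (r, c)"
      using rc A B carrier_matD[OF family_sum_carrier]
      by (simp add: family_sum_index[OF _ rc] distrib_left sum.distrib)
  qed (simp_all add: carrier_matD[OF family_sum_carrier])
  then have "schatten_norm q (family_sum (\<lambda>j. A j + B j)) \<le> schatten_norm q (family_sum A) + schatten_norm q (family_sum B)"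
    using supported_norm_add[OF norm_supported, of "family_sum A" "family_sum B"] by simp
  then have "cost (\<lambda>j. A j + B j) \<le> (schatten_norm q (family_sum A) + schatten_norm q (family_sum B)) powr p"
    unfolding cost_def using p by (intro powr_mono2 norm_nonneg) auto
  also have "\<dots> \<le> 2 powr (p - 1) * (cost A + cost B)"
    unfolding cost_def by (intro powr_sum_le p norm_nonneg)
  finally show ?thesis .
qed

lemma cost_smult:
  assumes T: "\<And>j. j \<in> I \<Longrightarrow> T j \<in> carrier_mat D D" and b: "b > 0"
  shows "cost (\<lambda>j. of_real b \<cdot>\<^sub>m T j) = b powr p * cost T"
proof -
  have "family_sum (\<lambda>j. of_real b \<cdot>\<^sub>m T j) = of_real b \<cdot>\<^sub>m family_sum T"
  proof (rule eq_matI)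
    fix r c assume "r < dim_row (complex_of_real b \<cdot>\<^sub>m family_sum T)" "c < dim_col (complex_of_real b \<cdot>\<^sub>m family_sum T)"
    then have rc: "r < k * D" "c < k * D" using carrier_matD[OF family_sum_carrier] by auto
    have "(complex_of_real b \<cdot>\<^sub>m T j) $$ (r mod D, c mod D) = of_real b * T j $$ (r mod D, c mod D)" if "j \<in> I" for j
      using T[OF that] div_mod_bounds[OF rc(1)] div_mod_bounds[OF rc(2)] by simp
    then show "family_sum (\<lambda>j. of_real b \<cdot>\<^sub>m T j) $$ (r, c) = (complex_of_real b \<cdot>\<^sub>m family_sum T) $$ (r, c)"
      using rc T carrier_matD[OF family_sum_carrier]
      by (simp add: family_sum_index[OF _ rc] sum_distrib_left mult_ac)
  qed (simp_all add: carrier_matD[OF family_sum_carrier])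
  then have "schatten_norm q (family_sum (\<lambda>j. of_real b \<cdot>\<^sub>m T j)) = b * schatten_norm q (family_sum T)"
    using supported_norm_smult[OF norm_supported family_sum_carrier b] by simp
  then show ?thesis unfolding cost_def using b norm_nonneg by (simp add: powr_mult)
qed

end

section \<open>Comparison of the two random sums\<close>

lemma mat_meas_gaussian: "mat_meas N (gaussian_mat N) (\<lambda>A. A)"
  using measurable_mat_entry by (auto simp: mat_meas_def cong: measurable_cong_sets)

lemma mat_meas_haar: "is_haar_unitary N \<mu> \<Longrightarrow> mat_meas N \<mu> (\<lambda>A. A)"
  by (auto simp: mat_meas_def haar_unitaryD(2) intro: measurable_haar_entry unitary_matsD(1))

lemma mat_meas_component:
  assumes "mat_meas N M0 (\<lambda>A. A)" "\<alpha> \<in> measurable M (PiM I (\<lambda>_. M0))" "j \<in> I"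
  shows "mat_meas N M (\<lambda>\<omega>. \<alpha> \<omega> j)"
proof -
  have "(\<lambda>\<omega>. \<alpha> \<omega> j) \<in> measurable M M0"
    by (rule measurable_compose[OF assms(2) measurable_component_singleton[OF assms(3)]])
  from mat_meas_compose[OF assms(1) this] show ?thesis .
qed

text \<open>A polarisation identity: the unmixed products occur in both terms with the same sign and
  cancel, the mixed ones occur with opposite signs and double, and the doubling is offset by the
  square of 1 / sqrt 2.\<close>

lemma tensor_bar_rotate:
  assumes Z: "Z \<in> carrier_mat N N" "Z' \<in> carrier_mat N N"
  shows "tensor_bar N (fst (rotate_pair (Z, Z'))) (fst (rotate_pair (Z, Z'))) - tensor_bar N (snd (rotate_pair (Z, Z'))) (snd (rotate_pair (Z, Z')))
     = tensor_bar N Z Z' + tensor_bar N Z' Z"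
proof (rule eq_matI)
  let ?r = "complex_of_real (1 / sqrt 2)"
  let ?A = "?r \<cdot>\<^sub>m (Z + Z')" and ?B = "?r \<cdot>\<^sub>m (Z' - Z)"
  have AB: "?A \<in> carrier_mat N N" "?B \<in> carrier_mat N N" using Z by (auto intro: minus_carrier_mat)
  fix r c assume "r < dim_row (tensor_bar N Z Z' + tensor_bar N Z' Z)" "c < dim_col (tensor_bar N Z Z' + tensor_bar N Z' Z)"
  then have rc: "r < N * N" "c < N * N" using carrier_matD[OF tensor_bar_carrier] by auto
  note rb = div_mod_bounds[OF rc(1)] and cb = div_mod_bounds[OF rc(2)]
  have r2: "?r * cnj ?r = 1 / 2" by (simp flip: of_real_mult)
  define x x' y y' where "x = Z $$ (r div N, c div N)" and "x' = Z' $$ (r div N, c div N)"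
    and "y = cnj (Z $$ (r mod N, c mod N))" and "y' = cnj (Z' $$ (r mod N, c mod N))"
  have "tensor_bar N ?A ?A $$ (r, c) = (?r * (x + x')) * (cnj ?r * (y + y'))"
    unfolding tensor_bar_index[OF AB(1) AB(1) rc] x_def x'_def y_def y'_def using Z rb cb by simp
  moreover have "tensor_bar N ?B ?B $$ (r, c) = (?r * (x' - x)) * (cnj ?r * (y' - y))"
    unfolding tensor_bar_index[OF AB(2) AB(2) rc] x_def x'_def y_def y'_def using Z rb cb by simp
  moreover have "(u * (x + x')) * (v * (y + y')) - (u * (x' - x)) * (v * (y' - y)) = (u * v) * (2 * (x * y' + x' * y))" for u v
    by (simp add: algebra_simps)
  ultimately have "tensor_bar N ?A ?A $$ (r, c) - tensor_bar N ?B ?B $$ (r, c) = (?r * cnj ?r) * (2 * (x * y' + x' * y))"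
    by (simp only:)
  also have "\<dots> = x * y' + x' * y" unfolding r2 by simp
  finally show "(tensor_bar N (fst (rotate_pair (Z, Z'))) (fst (rotate_pair (Z, Z'))) - tensor_bar N (snd (rotate_pair (Z, Z'))) (snd (rotate_pair (Z, Z')))) $$ (r, c)
     = (tensor_bar N Z Z' + tensor_bar N Z' Z) $$ (r, c)"
    using rc carrier_matD[OF tensor_bar_carrier[of N]]
    by (simp add: rotate_pair_def tensor_bar_index[OF Z rc] tensor_bar_index[OF Z(2,1) rc] x_def x'_def y_def y'_def)
qed (simp_all add: carrier_matD[OF tensor_bar_carrier])

context tensor_family
begin

abbreviation "GG \<equiv> PiM I (\<lambda>_. gaussian_mat N)"

lemma prob_space_GG: "prob_space GG"
  by (intro prob_space_PiM prob_space_gaussian_mat)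

lemma GG_carrier: "Y \<in> space GG \<Longrightarrow> j \<in> I \<Longrightarrow> Y j \<in> carrier_mat N N"
  by (auto simp: space_PiM)

text \<open>P is subtracted while 1 - P is still there to hide it, as P (1 - P) = 0. Only then is 1
  - P discarded, and the centred family that remains is symmetrised by an independent copy through
  Jensen's inequality.\<close>

lemma cost_le_decoupled:
  assumes Y: "Y \<in> space GG"
  shows "ennreal (cost (\<lambda>j. tb (Y j) (Y j) * Q)) \<le> (\<integral>\<^sup>+Y'. ennreal (cost (\<lambda>j. tb (Y j) (Y j) - tb (Y' j) (Y' j))) \<partial>GG)"
proof -
  let ?P = "proj_id N"
  have mPc: "tb (Y j) (Y j) - ?P \<in> carrier_mat D D" for j by (rule minus_carrier_mat) simp
  have "(tb (Y j) (Y j) - ?P) * Q = tb (Y j) (Y j) * Q" for j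
  proof -
    have "(tb (Y j) (Y j) - ?P) * Q = tb (Y j) (Y j) * Q - ?P * Q"
      by (rule minus_mult_distrib_mat[OF tensor_bar_carrier proj_id_carrier compl_proj_carrier])
    also have "\<dots> = tb (Y j) (Y j) * Q"
      unfolding proj_compl_proj by (intro eq_matI) (auto simp: carrier_matD[OF tensor_bar_carrier] carrier_matD[OF proj_id_carrier])
    finally show ?thesis .
  qed
  then have "cost (\<lambda>j. tb (Y j) (Y j) * Q) = cost (\<lambda>j. (tb (Y j) (Y j) - ?P) * Q)" by simp
  also have "\<dots> \<le> cost (\<lambda>j. tb (Y j) (Y j) - ?P)" by (rule cost_compl_proj[OF mPc])
  finally have "ennreal (cost (\<lambda>j. tb (Y j) (Y j) * Q)) \<le> ennreal (cost (\<lambda>j. tb (Y j) (Y j) - ?P))"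
    by (rule ennreal_leI)
  also have "\<dots> \<le> (\<integral>\<^sup>+Y'. ennreal (cost (\<lambda>j. tb (Y j) (Y j) - tb (Y' j) (Y' j))) \<partial>GG)"
    by (intro cost_jensen prob_space_GG has_mat_expectation_diff has_mat_expectation_const tensor_bar_carrier
        has_mat_expectation_component[OF prob_space_gaussian_mat] gaussian_tensor_expectation N)
  finally show ?thesis .
qed

lemma gaussian_decoupling:
  "(\<integral>\<^sup>+Y. ennreal (cost (\<lambda>j. tb (Y j) (Y j) * Q)) \<partial>GG)
     \<le> ennreal (2 powr p) * (\<integral>\<^sup>+(Y, Y'). ennreal (cost (\<lambda>j. tb (Y j) (Y' j))) \<partial>(GG \<Otimes>\<^sub>M GG))"
proof -
  interpret G: prob_space GG by (rule prob_space_GG)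
  interpret pair_prob_space GG GG ..
  note comp = mat_meas_component[OF mat_meas_gaussian]
  \<comment> \<open>\<open>f\<close> is the symmetrised integrand and \<open>g\<close> the decoupled
    one; the rotation of the pair bounds f by 2^(p-1) times the sum of g and its mirror
    image.\<close>
  define f where "f = (\<lambda>xy. ennreal (cost (\<lambda>j. tb (fst xy j) (fst xy j) - tb (snd xy j) (snd xy j))))"
  define g where "g = (\<lambda>xy. ennreal (cost (\<lambda>j. tb (fst xy j) (snd xy j))))"
  have fm: "f \<in> borel_measurable (GG \<Otimes>\<^sub>M GG)"
    unfolding f_def by (intro borel_measurable_cost mat_meas_minus mat_meas_tensor_bar comp) simp_all
  have gm: "g \<in> borel_measurable (GG \<Otimes>\<^sub>M GG)"
    unfolding g_def by (intro borel_measurable_cost mat_meas_tensor_bar comp) simp_all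
  have gm': "(\<lambda>xy. ennreal (cost (\<lambda>j. tb (snd xy j) (fst xy j)))) \<in> borel_measurable (GG \<Otimes>\<^sub>M GG)"
    by (intro borel_measurable_cost mat_meas_tensor_bar comp) simp_all
  have "(\<integral>\<^sup>+Y. ennreal (cost (\<lambda>j. tb (Y j) (Y j) * Q)) \<partial>GG) \<le> (\<integral>\<^sup>+Y. \<integral>\<^sup>+Y'. f (Y, Y') \<partial>GG \<partial>GG)"
    unfolding f_def fst_conv snd_conv by (rule nn_integral_mono) (rule cost_le_decoupled)
  also have "\<dots> = (\<integral>\<^sup>+xy. f xy \<partial>(GG \<Otimes>\<^sub>M GG))" by (rule G.nn_integral_fst[OF fm])
  also have "\<dots> = (\<integral>\<^sup>+xy. f (\<lambda>i\<in>I. fst (rotate_pair (fst xy i, snd xy i)), \<lambda>i\<in>I. snd (rotate_pair (fst xy i, snd xy i))) \<partial>(GG \<Otimes>\<^sub>M GG))"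
  proof (rule pair_PiM_preserving[OF fin prob_space_gaussian_mat _ gaussian_mat_pair_rotate fm, symmetric])
    have sets: "sets (gaussian_mat N \<Otimes>\<^sub>M gaussian_mat N) = sets (mat_borel N \<Otimes>\<^sub>M mat_borel N)"
      by (rule sets_pair_measure_cong) auto
    show "rotate_pair \<in> measurable (gaussian_mat N \<Otimes>\<^sub>M gaussian_mat N) (gaussian_mat N \<Otimes>\<^sub>M gaussian_mat N)"
      using measurable_rotate_pair unfolding measurable_cong_sets[OF sets sets] .
  qed
  also have "\<dots> \<le> (\<integral>\<^sup>+xy. ennreal (2 powr (p - 1)) * (g xy + ennreal (cost (\<lambda>j. tb (snd xy j) (fst xy j)))) \<partial>(GG \<Otimes>\<^sub>M GG))"
  proof (rule nn_integral_mono)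
    fix xy assume "xy \<in> space (GG \<Otimes>\<^sub>M GG)"
    then have c: "fst xy j \<in> carrier_mat N N" "snd xy j \<in> carrier_mat N N" if "j \<in> I" for j
      using that by (auto simp: space_pair_measure intro: GG_carrier)
    have "f (\<lambda>i\<in>I. fst (rotate_pair (fst xy i, snd xy i)), \<lambda>i\<in>I. snd (rotate_pair (fst xy i, snd xy i)))
      = ennreal (cost (\<lambda>j. tb (fst xy j) (snd xy j) + tb (snd xy j) (fst xy j)))"
      unfolding f_def by (intro arg_cong[of _ _ ennreal] cost_cong) (simp add: tensor_bar_rotate c)
    also have "\<dots> \<le> ennreal (2 powr (p - 1) * (cost (\<lambda>j. tb (fst xy j) (snd xy j)) + cost (\<lambda>j. tb (snd xy j) (fst xy j))))"
      by (intro ennreal_leI cost_add) simp_all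
    also have "\<dots> = ennreal (2 powr (p - 1)) * (g xy + ennreal (cost (\<lambda>j. tb (snd xy j) (fst xy j))))"
      by (simp add: g_def ennreal_mult' cost_def)
    finally show "f (\<lambda>i\<in>I. fst (rotate_pair (fst xy i, snd xy i)), \<lambda>i\<in>I. snd (rotate_pair (fst xy i, snd xy i)))
      \<le> ennreal (2 powr (p - 1)) * (g xy + ennreal (cost (\<lambda>j. tb (snd xy j) (fst xy j))))" .
  qed
  also have "\<dots> = ennreal (2 powr (p - 1)) * ((\<integral>\<^sup>+xy. g xy \<partial>(GG \<Otimes>\<^sub>M GG)) + (\<integral>\<^sup>+xy. ennreal (cost (\<lambda>j. tb (snd xy j) (fst xy j))) \<partial>(GG \<Otimes>\<^sub>M GG)))"
    using gm gm' by (simp add: nn_integral_cmult nn_integral_add)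
  \<comment> \<open>The mirror image has the same integral, because the two independent families can
    be exchanged.\<close>
  also have "(\<integral>\<^sup>+xy. ennreal (cost (\<lambda>j. tb (snd xy j) (fst xy j))) \<partial>(GG \<Otimes>\<^sub>M GG)) = (\<integral>\<^sup>+xy. g ((\<lambda>(x, y). (y, x)) xy) \<partial>(GG \<Otimes>\<^sub>M GG))"
    by (simp add: g_def case_prod_unfold)
  also have "\<dots> = (\<integral>\<^sup>+xy. g xy \<partial>(GG \<Otimes>\<^sub>M GG))"
    by (rule measure_preserving_nn_integral[OF measurable_pair_swap' distr_pair_swap[symmetric] gm])
  also have "ennreal (2 powr (p - 1)) * ((\<integral>\<^sup>+xy. g xy \<partial>(GG \<Otimes>\<^sub>M GG)) + (\<integral>\<^sup>+xy. g xy \<partial>(GG \<Otimes>\<^sub>M GG)))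
     = ennreal (2 powr p) * (\<integral>\<^sup>+xy. g xy \<partial>(GG \<Otimes>\<^sub>M GG))"
  proof -
    have "ennreal (2 powr p) = ennreal (2 powr (p - 1)) * 2"
      by (simp add: powr_diff flip: ennreal_mult' ennreal_numeral)
    then show ?thesis by (simp add: mult.assoc flip: mult_2)
  qed
  finally show ?thesis by (simp add: g_def case_prod_unfold)
qed

text \<open>Jensen's inequality is used twice: over Y, to replace the mean of
  \<open>haar_coeff\<close>, which is at least 1/3, by the random coefficient, and then for fixed Y
  over R, whose average produces this coefficient. The resulting triple integral over A, R and Y is
  evaluated with Y innermost, where bi-invariance of the Gaussian law removes A and R.\<close>

lemma haar_le_gaussian:
  assumes \<mu>: "is_haar_unitary N \<mu>" and N2: "N \<ge> 2"
  shows "ennreal ((1 / 3) powr p) * (\<integral>\<^sup>+A. ennreal (cost (\<lambda>j. tb (A j) (A j) * Q)) \<partial>PiM I (\<lambda>_. \<mu>))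
     \<le> (\<integral>\<^sup>+Y. ennreal (cost (\<lambda>j. tb (Y j) (Y j) * Q)) \<partial>GG)"
proof -
  let ?H = "PiM I (\<lambda>_. \<mu>)"
  note \<mu>p = haar_unitaryD(1)[OF \<mu>]
  interpret G: prob_space GG by (rule prob_space_GG)
  interpret H: prob_space ?H by (intro prob_space_PiM \<mu>p)
  interpret HG: pair_prob_space ?H GG ..
  interpret HH: pair_prob_space ?H ?H ..
  note gcomp = mat_meas_component[OF mat_meas_gaussian] and hcomp = mat_meas_component[OF mat_meas_haar[OF \<mu>]]
  have HU: "A j \<in> unitary_mats N" if "A \<in> space ?H" "j \<in> I" for A j
    using that by (auto simp: space_PiM haar_unitaryD(2)[OF \<mu>])
  define g where "g = (\<lambda>Y. ennreal (cost (\<lambda>j. tb (Y j) (Y j) * Q)))"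
  \<comment> \<open>\<open>F\<close> is the Gaussian integrand after the two-sided rotation,
    \<open>K\<close> the one in which R has been averaged out.\<close>
  define F where "F = (\<lambda>A R Y. ennreal (cost (\<lambda>j. tb (A j * Y j * R j) (A j * Y j * R j) * Q)))"
  define K where "K = (\<lambda>A Y. ennreal (cost (\<lambda>j. complex_of_real (haar_coeff N (Y j)) \<cdot>\<^sub>m (tb (A j) (A j) * Q))))"
  have gm: "g \<in> borel_measurable GG"
    unfolding g_def by (intro borel_measurable_cost mat_meas_mult mat_meas_const mat_meas_tensor_bar compl_proj_carrier gcomp) simp_all
  have Fm: "(\<lambda>\<omega>. F (\<alpha> \<omega>) (\<rho> \<omega>) (\<upsilon> \<omega>)) \<in> borel_measurable M"
    if "\<alpha> \<in> measurable M ?H" "\<rho> \<in> measurable M ?H" "\<upsilon> \<in> measurable M GG" for M :: "'m measure" and \<alpha> \<rho> \<upsilon>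
    unfolding F_def using that
    by (intro borel_measurable_cost mat_meas_mult mat_meas_const mat_meas_tensor_bar compl_proj_carrier hcomp[OF that(1)] hcomp[OF that(2)] gcomp[OF that(3)])
  have coeff: "haar_coeff N \<in> borel_measurable (gaussian_mat N)"
    using haar_coeff_expectation(1)[OF N2] by (rule borel_measurable_integrable)
  have Km: "(\<lambda>(A, Y). K A Y) \<in> borel_measurable (?H \<Otimes>\<^sub>M GG)"
    unfolding K_def case_prod_unfold
  proof (intro borel_measurable_cost mat_meas_smult mat_meas_mult mat_meas_const mat_meas_tensor_bar compl_proj_carrier hcomp measurable_fst)
    fix j assume j: "j \<in> I"
    show "(\<lambda>x. haar_coeff N (snd x j)) \<in> borel_measurable (?H \<Otimes>\<^sub>M GG)"
      by (rule measurable_compose[OF measurable_compose[OF measurable_snd measurable_component_singleton[OF j]] coeff])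
  qed simp_all
  have inv: "(\<integral>\<^sup>+Y. F A R Y \<partial>GG) = (\<integral>\<^sup>+Y. g Y \<partial>GG)" if A: "A \<in> space ?H" and R: "R \<in> space ?H" for A R
  proof -
    have m3: "(\<lambda>Y. A j * Y * R j) \<in> measurable (gaussian_mat N) (gaussian_mat N)" if "j \<in> I" for j
      unfolding measurable_cong_sets[OF sets_gaussian_mat sets_gaussian_mat]
      by (intro measurable_mult3_mat unitary_matsD(1) HU A R that)
    have T: "(\<lambda>Y. \<lambda>j\<in>I. A j * Y j * R j) \<in> measurable GG GG"
    proof (rule measurable_restrict)
      fix j assume j: "j \<in> I"
      from measurable_compose[OF measurable_component_singleton[OF j] m3[OF j]]
      show "(\<lambda>Y. A j * Y j * R j) \<in> measurable GG (gaussian_mat N)" .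
    qed
    have "distr GG GG (\<lambda>Y. \<lambda>j\<in>I. A j * Y j * R j) = GG"
      by (rule distr_PiM_componentwise[OF fin prob_space_gaussian_mat m3]) (auto intro: gaussian_mat_bi_invariant HU A R)
    from measure_preserving_nn_integral[OF T this gm]
    have "(\<integral>\<^sup>+Y. g (\<lambda>j\<in>I. A j * Y j * R j) \<partial>GG) = (\<integral>\<^sup>+Y. g Y \<partial>GG)" .
    moreover have "g (\<lambda>j\<in>I. A j * Y j * R j) = F A R Y" for Y
      unfolding g_def F_def by (intro arg_cong[of _ _ ennreal] cost_cong) simp
    ultimately show ?thesis by simp
  qed
  \<comment> \<open>With Y fixed, its polar factors are constants of the integration over A and R.
    The result no longer mentions them, and only the result is integrated over Y.\<close>
  have fixY: "(\<integral>\<^sup>+A. K A Y \<partial>?H) \<le> (\<integral>\<^sup>+R. \<integral>\<^sup>+A. F A R Y \<partial>?H \<partial>?H)" if Y: "Y \<in> space GG" for Y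
  proof -
    have "\<forall>j. \<exists>V H. j \<in> I \<longrightarrow> V \<in> unitary_mats N \<and> H \<in> carrier_mat N N \<and> Y j = V * H \<and>
       mat_trace H = of_real (schatten_norm 1 (Y j)) \<and> hs_sq N H = hs_sq N (Y j)"
    proof
      fix j
      show "\<exists>V H. j \<in> I \<longrightarrow> V \<in> unitary_mats N \<and> H \<in> carrier_mat N N \<and> Y j = V * H \<and>
       mat_trace H = of_real (schatten_norm 1 (Y j)) \<and> hs_sq N H = hs_sq N (Y j)"
      proof (cases "j \<in> I")
        case True
        show ?thesis by (rule polar_decomposition[OF GG_carrier[OF Y True]]) blast
      qed simp
    qed
    then obtain V H where VH: "\<And>j. j \<in> I \<Longrightarrow> V j \<in> unitary_mats N" "\<And>j. j \<in> I \<Longrightarrow> H j \<in> carrier_mat N N"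
      "\<And>j. j \<in> I \<Longrightarrow> Y j = V j * H j" "\<And>j. j \<in> I \<Longrightarrow> mat_trace (H j) = of_real (schatten_norm 1 (Y j))"
      "\<And>j. j \<in> I \<Longrightarrow> hs_sq N (H j) = hs_sq N (Y j)"
      by metis
    define X where "X = (\<lambda>R j. mat_adjoint (R j) * H j * R j)"
    define F' where "F' = (\<lambda>A R. ennreal (cost (\<lambda>j. tb (A j * X R j) (A j * X R j) * Q)))"
    have F'm: "(\<lambda>(A, R). F' A R) \<in> borel_measurable (?H \<Otimes>\<^sub>M ?H)"
      unfolding F'_def X_def case_prod_unfold
      by (intro borel_measurable_cost mat_meas_mult mat_meas_adjoint mat_meas_const mat_meas_tensor_bar compl_proj_carrier hcomp VH(2)) simp_all
    have "(\<integral>\<^sup>+A. K A Y \<partial>?H) \<le> (\<integral>\<^sup>+A. \<integral>\<^sup>+R. F' A R \<partial>?H \<partial>?H)"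
    proof (rule nn_integral_mono)
      fix A assume A: "A \<in> space ?H"
      show "K A Y \<le> (\<integral>\<^sup>+R. F' A R \<partial>?H)"
        unfolding K_def F'_def X_def
      proof (rule cost_jensen[OF H.prob_space_axioms])
        fix j assume j: "j \<in> I"
        show "has_mat_expectation D ?H (\<lambda>R. tb (A j * (mat_adjoint (R j) * H j * R j)) (A j * (mat_adjoint (R j) * H j * R j)) * Q)
          (complex_of_real (haar_coeff N (Y j)) \<cdot>\<^sub>m (tb (A j) (A j) * Q))"
          by (rule has_mat_expectation_component[OF \<mu>p j haar_tensor_expectation[OF \<mu> N2 VH(2)[OF j] HU[OF A j] VH(4,5)[OF j]]])
      qed
    qed
    also have "\<dots> = (\<integral>\<^sup>+R. \<integral>\<^sup>+A. F' A R \<partial>?H \<partial>?H)" by (rule HH.Fubini'[OF F'm, symmetric])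
    also have "\<dots> = (\<integral>\<^sup>+R. \<integral>\<^sup>+A. F A R Y \<partial>?H \<partial>?H)"
    proof (rule nn_integral_cong)
      fix R assume R: "R \<in> space ?H"
      \<comment> \<open>The substitution A -> A R^* V^* turns A V H R into A R^* H R. As R is held
        fixed, it is a right translation of A.\<close>
      define W where "W = (\<lambda>j. mat_adjoint (R j) * mat_adjoint (V j))"
      have W: "W j \<in> unitary_mats N" if "j \<in> I" for j
        unfolding W_def by (intro unitary_mats_mult unitary_mats_adjoint HU[OF R that] VH(1)[OF that])
      have T: "(\<lambda>A. \<lambda>j\<in>I. A j * W j) \<in> measurable ?H ?H"
      proof (rule measurable_restrict)
        fix j assume j: "j \<in> I"
        from measurable_compose[OF measurable_component_singleton[OF j] haar_right(1)[OF \<mu> W[OF j]]]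
        show "(\<lambda>A. A j * W j) \<in> measurable ?H \<mu>" .
      qed
      have D: "distr ?H ?H (\<lambda>A. \<lambda>j\<in>I. A j * W j) = ?H"
        by (rule distr_PiM_componentwise[OF fin \<mu>p haar_right(1)[OF \<mu> W]]) (auto intro: haar_right(2)[OF \<mu>] W)
      have "(\<lambda>A. F A R Y) \<in> borel_measurable ?H"
        by (rule Fm) (use R Y in auto)
      from measure_preserving_nn_integral[OF T D this]
      have "(\<integral>\<^sup>+A. F (\<lambda>j\<in>I. A j * W j) R Y \<partial>?H) = (\<integral>\<^sup>+A. F A R Y \<partial>?H)" .
      moreover have "F (\<lambda>j\<in>I. A j * W j) R Y = F' A R" if A: "A \<in> space ?H" for A
        unfolding F_def F'_def
      proof (intro arg_cong[of _ _ ennreal] cost_cong)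
        fix j assume j: "j \<in> I"
        note Ac = unitary_matsD(1)[OF HU[OF A j]] and Rc = unitary_matsD(1,2)[OF HU[OF R j]] and Vc = unitary_matsD[OF VH(1)[OF j]]
          and Hc = VH(2)[OF j]
        have "A j * W j * Y j * R j = A j * (mat_adjoint (R j) * ((mat_adjoint (V j) * V j) * H j) * R j)"
          using Ac Rc Vc(1,2) Hc by (simp add: W_def VH(3)[OF j] assoc_mult_mat[of _ N N _ N _ N] mult_carrier_mat[of _ N N _ N])
        also have "\<dots> = A j * X R j" unfolding X_def Vc(4) using Hc by simp
        finally have "A j * W j * Y j * R j = A j * X R j" .
        then show "tb ((\<lambda>j\<in>I. A j * W j) j * Y j * R j) ((\<lambda>j\<in>I. A j * W j) j * Y j * R j) * Q = tb (A j * X R j) (A j * X R j) * Q"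
          using j by simp
      qed
      ultimately show "(\<integral>\<^sup>+A. F' A R \<partial>?H) = (\<integral>\<^sup>+A. F A R Y \<partial>?H)"
        by (simp cong: nn_integral_cong_simp)
    qed
    finally show ?thesis .
  qed
  define b where "b = (\<integral>Y. haar_coeff N Y \<partial>gaussian_mat N)"
  have b: "b \<ge> 1 / 3" unfolding b_def by (rule haar_coeff_expectation(2)[OF N2])
  have tQ: "tb (A j) (A j) * Q \<in> carrier_mat D D" for A :: "nat \<Rightarrow> complex mat" and j
    by (rule mult_carrier_mat[OF tensor_bar_carrier compl_proj_carrier])
  have gHm: "(\<lambda>A. ennreal (cost (\<lambda>j. tb (A j) (A j) * Q))) \<in> borel_measurable ?H"
    by (intro borel_measurable_cost mat_meas_mult mat_meas_const mat_meas_tensor_bar compl_proj_carrier hcomp) simp_all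
  have "ennreal ((1 / 3) powr p) * (\<integral>\<^sup>+A. ennreal (cost (\<lambda>j. tb (A j) (A j) * Q)) \<partial>?H)
     = (\<integral>\<^sup>+A. ennreal ((1 / 3) powr p) * ennreal (cost (\<lambda>j. tb (A j) (A j) * Q)) \<partial>?H)"
    by (rule nn_integral_cmult[OF gHm, symmetric])
  also have "\<dots> \<le> (\<integral>\<^sup>+A. \<integral>\<^sup>+Y. K A Y \<partial>GG \<partial>?H)"
  proof (rule nn_integral_mono)
    fix A
    have "ennreal ((1 / 3) powr p) * ennreal (cost (\<lambda>j. tb (A j) (A j) * Q)) = ennreal ((1 / 3) powr p * cost (\<lambda>j. tb (A j) (A j) * Q))"
      by (simp add: ennreal_mult')
    also have "\<dots> \<le> ennreal (b powr p * cost (\<lambda>j. tb (A j) (A j) * Q))"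
      using b p by (intro ennreal_leI mult_right_mono powr_mono2) (auto simp: cost_def)
    also have "b powr p * cost (\<lambda>j. tb (A j) (A j) * Q) = cost (\<lambda>j. complex_of_real b \<cdot>\<^sub>m (tb (A j) (A j) * Q))"
      using b by (intro cost_smult[symmetric] tQ) auto
    \<comment> \<open>Here A is held fixed, and each coefficient \<open>haar_coeff N (Y j)\<close>
      has mean b.\<close>
    also have "ennreal \<dots> \<le> (\<integral>\<^sup>+Y. K A Y \<partial>GG)"
      unfolding K_def
    proof (rule cost_jensen[OF prob_space_GG])
      fix j assume j: "j \<in> I"
      have "has_bochner_integral (gaussian_mat N) (haar_coeff N) b"
        using haar_coeff_expectation(1)[OF N2] by (simp add: has_bochner_integral_iff b_def)
      from has_mat_expectation_component[OF prob_space_gaussian_mat j has_mat_expectation_smult[OF this tQ]]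
      show "has_mat_expectation D GG (\<lambda>Y. complex_of_real (haar_coeff N (Y j)) \<cdot>\<^sub>m (tb (A j) (A j) * Q)) (complex_of_real b \<cdot>\<^sub>m (tb (A j) (A j) * Q))" .
    qed
    finally show "ennreal ((1 / 3) powr p) * ennreal (cost (\<lambda>j. tb (A j) (A j) * Q)) \<le> (\<integral>\<^sup>+Y. K A Y \<partial>GG)" .
  qed
  also have "\<dots> = (\<integral>\<^sup>+Y. \<integral>\<^sup>+A. K A Y \<partial>?H \<partial>GG)" by (rule HG.Fubini'[OF Km, symmetric])
  also have "\<dots> \<le> (\<integral>\<^sup>+Y. \<integral>\<^sup>+R. \<integral>\<^sup>+A. F A R Y \<partial>?H \<partial>?H \<partial>GG)"
    by (rule nn_integral_mono) (rule fixY)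
  also have "\<dots> = (\<integral>\<^sup>+R. \<integral>\<^sup>+Y. \<integral>\<^sup>+A. F A R Y \<partial>?H \<partial>GG \<partial>?H)"
  proof (rule HG.Fubini')
    show "(\<lambda>(R, Y). \<integral>\<^sup>+A. F A R Y \<partial>?H) \<in> borel_measurable (?H \<Otimes>\<^sub>M GG)"
      unfolding case_prod_unfold
      by (rule H.borel_measurable_nn_integral, unfold case_prod_unfold, rule Fm)
        (intro measurable_snd measurable_compose[OF measurable_fst measurable_fst] measurable_compose[OF measurable_fst measurable_snd])+
  qed
  also have "\<dots> = (\<integral>\<^sup>+R. \<integral>\<^sup>+A. \<integral>\<^sup>+Y. F A R Y \<partial>GG \<partial>?H \<partial>?H)"
  proof (rule nn_integral_cong)
    fix R assume R: "R \<in> space ?H"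
    show "(\<integral>\<^sup>+Y. \<integral>\<^sup>+A. F A R Y \<partial>?H \<partial>GG) = (\<integral>\<^sup>+A. \<integral>\<^sup>+Y. F A R Y \<partial>GG \<partial>?H)"
    proof (rule HG.Fubini')
      show "(\<lambda>(A, Y). F A R Y) \<in> borel_measurable (?H \<Otimes>\<^sub>M GG)"
        unfolding case_prod_unfold by (rule Fm) (use R in auto)
    qed
  qed
  also have "\<dots> = (\<integral>\<^sup>+R. \<integral>\<^sup>+A. (\<integral>\<^sup>+Y. g Y \<partial>GG) \<partial>?H \<partial>?H)"
    by (intro nn_integral_cong inv)
  also have "\<dots> = (\<integral>\<^sup>+Y. g Y \<partial>GG)" by (simp add: H.emeasure_space_1)
  finally show ?thesis by (simp only: g_def)
qed

lemma haar_le_decoupled_gaussian: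
  assumes \<mu>: "is_haar_unitary N \<mu>"
  shows "(\<integral>\<^sup>+A. ennreal (cost (\<lambda>j. tb (A j) (A j) * Q)) \<partial>PiM I (\<lambda>_. \<mu>))
     \<le> ennreal (6 powr p) * (\<integral>\<^sup>+(Y, Y'). ennreal (cost (\<lambda>j. tb (Y j) (Y' j))) \<partial>(GG \<Otimes>\<^sub>M GG))"
proof (cases "N \<ge> 2")
  case True
  let ?L = "\<integral>\<^sup>+A. ennreal (cost (\<lambda>j. tb (A j) (A j) * Q)) \<partial>PiM I (\<lambda>_. \<mu>)"
  have 1: "3 powr p * (1 / 3) powr p = 1" using powr_mult[of 3 "1 / 3" p] by simp
  have 2: "(6::real) powr p = 3 powr p * 2 powr p" using powr_mult[of 3 2 p] by simp
  have "?L = ennreal (3 powr p) * (ennreal ((1 / 3) powr p) * ?L)"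
    using 1 by (simp flip: mult.assoc ennreal_mult')
  also have "\<dots> \<le> ennreal (3 powr p) * (\<integral>\<^sup>+Y. ennreal (cost (\<lambda>j. tb (Y j) (Y j) * Q)) \<partial>GG)"
    by (intro mult_left_mono haar_le_gaussian[OF \<mu> True]) simp
  also have "\<dots> \<le> ennreal (3 powr p) * (ennreal (2 powr p) * (\<integral>\<^sup>+(Y, Y'). ennreal (cost (\<lambda>j. tb (Y j) (Y' j))) \<partial>(GG \<Otimes>\<^sub>M GG)))"
    by (intro mult_left_mono gaussian_decoupling) simp
  also have "\<dots> = ennreal (6 powr p) * (\<integral>\<^sup>+(Y, Y'). ennreal (cost (\<lambda>j. tb (Y j) (Y' j))) \<partial>(GG \<Otimes>\<^sub>M GG))"
    unfolding 2 by (simp add: ennreal_mult' mult.assoc)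
  finally show ?thesis .
next
  case False
  \<comment> \<open>For N = 1 every matrix is a multiple of the identity, so 1 - P is zero and the
    left-hand side vanishes; the averaging coefficient would have the denominator N^2 - 1 =
    0.\<close>
  then have N1: "N = 1" using N by simp
  have Q0: "Q = 0\<^sub>m D D"
    by (rule eq_matI) (auto simp: N1 proj_id_index carrier_matD[OF proj_id_carrier])
  have "cost (\<lambda>j. tb (A j) (A j) * Q) = 0" for A
  proof -
    have T0: "tb (A j) (A j) * Q = 0\<^sub>m D D" for j
      unfolding Q0 by (rule right_mult_zero_mat[OF tensor_bar_carrier])
    have "family_sum (\<lambda>j. tb (A j) (A j) * Q) = 0\<^sub>m (k * D) (k * D)"
    proof (rule eq_matI)
      fix r c assume "r < dim_row (0\<^sub>m (k * D) (k * D) :: complex mat)" "c < dim_col (0\<^sub>m (k * D) (k * D) :: complex mat)"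
      then have rc: "r < k * D" "c < k * D" by auto
      note rb = div_mod_bounds[OF rc(1)] and cb = div_mod_bounds[OF rc(2)]
      have "family_sum (\<lambda>j. 0\<^sub>m D D) $$ (r, c) = (\<Sum>j\<in>I. a j $$ (r div D, c div D) * 0\<^sub>m D D $$ (r mod D, c mod D))"
        by (rule family_sum_index) (use rc in auto)
      also have "\<dots> = 0" using rb cb by simp
      finally show "family_sum (\<lambda>j. tb (A j) (A j) * Q) $$ (r, c) = 0\<^sub>m (k * D) (k * D) $$ (r, c)"
        unfolding T0 using rc by simp
    qed (simp_all add: carrier_matD[OF family_sum_carrier])
    then show ?thesis
      using supported_norm_zero[OF norm_supported] p by (simp add: cost_def)
  qed
  then show ?thesis by simp
qed

end

text \<open>Scalars are 1 by 1 coefficients, so the scalar inequality is the matrix inequality for k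
  = 1.\<close>

lemma kron_scalar: "kron (mat 1 1 (\<lambda>_. x)) T = x \<cdot>\<^sub>m T"
  by (rule eq_matI) (auto simp: kron_def)

theorem lemma0p1:
  shows "\<exists>C::real. C > 0 \<and>
    (\<forall>(N::nat) (n::nat) (p::real) (q::ennreal) (\<mu>::complex mat measure).
       N \<ge> 1 \<longrightarrow> n \<ge> 1 \<longrightarrow> p \<ge> 1 \<longrightarrow> q \<ge> 1 \<longrightarrow> is_haar_unitary N \<mu> \<longrightarrow>
       (\<forall>a :: nat \<Rightarrow> complex.
          (\<integral>\<^sup>+U. ennreal (schatten_norm q
               (mat_sum (N * N)
                  (\<lambda>j. a j \<cdot>\<^sub>m (tensor_bar N (U j) (U j) * (1\<^sub>m (N * N) - proj_id N))) {1..n})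
               powr p) \<partial>iid n \<mu>)
          \<le> ennreal (C powr p) *
            (\<integral>\<^sup>+(Y, Y'). ennreal (schatten_norm q
               (mat_sum (N * N) (\<lambda>j. a j \<cdot>\<^sub>m tensor_bar N (Y j) (Y' j)) {1..n})
               powr p) \<partial>(iid n (gaussian_mat N) \<Otimes>\<^sub>M iid n (gaussian_mat N)))) \<and>
       (\<forall>(k::nat) (a :: nat \<Rightarrow> complex mat).
          k \<ge> 1 \<longrightarrow> (\<forall>j\<in>{1..n}. a j \<in> carrier_mat k k) \<longrightarrow>
          (\<integral>\<^sup>+U. ennreal (schatten_norm q
               (mat_sum (k * (N * N))
                  (\<lambda>j. kron (a j) (tensor_bar N (U j) (U j) * (1\<^sub>m (N * N) - proj_id N))) {1..n})
               powr p) \<partial>iid n \<mu>)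
          \<le> ennreal (C powr p) *
            (\<integral>\<^sup>+(Y, Y'). ennreal (schatten_norm q
               (mat_sum (k * (N * N)) (\<lambda>j. kron (a j) (tensor_bar N (Y j) (Y' j))) {1..n})
               powr p) \<partial>(iid n (gaussian_mat N) \<Otimes>\<^sub>M iid n (gaussian_mat N)))))"
proof (intro exI[of _ "6 :: real"] conjI allI impI)
  fix N n :: nat and p :: real and q :: ennreal and \<mu> :: "complex mat measure"
  assume N: "N \<ge> 1" and n: "n \<ge> 1" and p: "p \<ge> 1" and q: "q \<ge> 1" and \<mu>: "is_haar_unitary N \<mu>"
  have main: "(\<integral>\<^sup>+U. ennreal (schatten_norm q
               (mat_sum (k * (N * N))
                  (\<lambda>j. kron (a j) (tensor_bar N (U j) (U j) * (1\<^sub>m (N * N) - proj_id N))) {1..n})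
               powr p) \<partial>iid n \<mu>)
          \<le> ennreal (6 powr p) *
            (\<integral>\<^sup>+(Y, Y'). ennreal (schatten_norm q
               (mat_sum (k * (N * N)) (\<lambda>j. kron (a j) (tensor_bar N (Y j) (Y' j))) {1..n})
               powr p) \<partial>(iid n (gaussian_mat N) \<Otimes>\<^sub>M iid n (gaussian_mat N)))"
    if a: "\<forall>j\<in>{1..n}. a j \<in> carrier_mat k k" for k :: nat and a :: "nat \<Rightarrow> complex mat"
  proof -
    interpret tensor_family k N "{1..n}" a q p
      using a p q N by unfold_locales auto
    show ?thesis using haar_le_decoupled_gaussian[OF \<mu>] by (simp only: cost_def family_sum_def)
  qed
  then show "(\<integral>\<^sup>+U. ennreal (schatten_norm q
               (mat_sum (k * (N * N))
                  (\<lambda>j. kron (a j) (tensor_bar N (U j) (U j) * (1\<^sub>m (N * N) - proj_id N))) {1..n})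
               powr p) \<partial>iid n \<mu>)
          \<le> ennreal (6 powr p) *
            (\<integral>\<^sup>+(Y, Y'). ennreal (schatten_norm q
               (mat_sum (k * (N * N)) (\<lambda>j. kron (a j) (tensor_bar N (Y j) (Y' j))) {1..n})
               powr p) \<partial>(iid n (gaussian_mat N) \<Otimes>\<^sub>M iid n (gaussian_mat N)))"
    if "\<forall>j\<in>{1..n}. a j \<in> carrier_mat k k" for k :: nat and a :: "nat \<Rightarrow> complex mat"
    using that by blast
  fix a :: "nat \<Rightarrow> complex"
  show "(\<integral>\<^sup>+U. ennreal (schatten_norm q
               (mat_sum (N * N)
                  (\<lambda>j. a j \<cdot>\<^sub>m (tensor_bar N (U j) (U j) * (1\<^sub>m (N * N) - proj_id N))) {1..n})
               powr p) \<partial>iid n \<mu>)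
          \<le> ennreal (6 powr p) *
            (\<integral>\<^sup>+(Y, Y'). ennreal (schatten_norm q
               (mat_sum (N * N) (\<lambda>j. a j \<cdot>\<^sub>m tensor_bar N (Y j) (Y' j)) {1..n})
               powr p) \<partial>(iid n (gaussian_mat N) \<Otimes>\<^sub>M iid n (gaussian_mat N)))"
  proof -
    have "\<forall>j\<in>{1..n}. mat 1 1 (\<lambda>_. a j) \<in> carrier_mat 1 1" by simp
    from main[OF this] show ?thesis by (simp only: kron_scalar mult_1)
  qed
qed simp

end
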